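(* For each positive integer $n$ let $p=p(n)$ be a positive integer with $p(n)\le n$, and suppose $n-p(n)\to\infty$ as $n\to\infty$. Let $X_1,\dots,X_{n+1}$ be i.i.d. with distribution $\mathcal{N}_p(\mu,\Sigma)$, with $\mu\in\mathbb{R}^p$ and $\Sigma$ unknown, and set $$R_n=\inf_{\delta}\ \sup_{\mu,\Sigma}\ \mathbb{E}\left(\delta-\log\det\Sigma\right)^2,$$ where the infimum is over all measurable estimators $\delta=\delta(X_1,\dots,X_{n+1})$ and the supremum is over all $\mu\in\mathbb{R}^p$ and all $p\times p$ positive definite matrices $\Sigma$. Then $$2\cdot\liminf_{n\to\infty}\frac pn\ \le\ \liminf_{n\to\infty}R_n\ \le\ \limsup_{n\to\infty}R_n\ \le\ \limsup_{n\to\infty}\left(-2\log\left(1-\frac pn\right)\right).$$ In particular, if $\frac{p(n)}{n}\to0$, then $$\lim_{n\to\infty}\frac np\cdot R_n=2,$$ and the estimator $\hat T=\log\det\hat\Sigma-\tau_{n,p}$ is asymptotically sharp minimax, i.e. $$\lim_{n\to\infty}\frac{\sup_{\mu,\Sigma}\mathbb{E}(\hat T-\log\det\Sigma)^2}{R_n}=1.$$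
   Context: The sample covariance matrix is $\hat\Sigma=\frac1n\sum_{k=1}^{n+1}(X_k-\bar X)(X_k-\bar X)^T$, where $\bar X=\frac{1}{n+1}\sum_{k=1}^{n+1}X_k$. The bias correction constant is $$\tau_{n,p}=\sum_{k=1}^p\left[\psi\left(\frac{n-k+1}{2}\right)-\log\left(\frac n2\right)\right],$$ where $\psi(x)=\frac{d}{dx}\log\Gamma(x)$ is the digamma function. An estimator is a real-valued measurable function of the sample; it may not depend on the unknown parameters $\mu,\Sigma$. "Asymptotically sharp minimax" means that the estimator's maximal risk attains both the optimal rate and the optimal constant of the minimax risk asymptotically. Limits superior and inferior are taken in $[0,+\infty]$. *)

theory Defs
  imports
    "HOL-Probability.Probability"
    "Jordan_Normal_Form.Determinant"
    "Jordan_Normal_Form.Gauss_Jordan_Elimination"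
begin

text \<open>
  The dimension varies with the sample size, so matrices and parameter vectors use explicit
  carriers. An observation in \<open>\<real>\<^sup>p\<close> is an extensional function on \<open>{..<p}\<close> and is turned into
  a vector by \<^const>\<open>vec\<close>. A sample \<open>X\<close> has observations \<open>X 1, \<dots>, X (n + 1)\<close>.
  \<^const>\<open>Determinant.det\<close> is written in full because HOL-Analysis has another \<open>det\<close>.
\<close>

definition pos_def_mats :: "nat \<Rightarrow> real mat set" where
  "pos_def_mats p = {A \<in> carrier_mat p p. A\<^sup>T = A \<and>
     (\<forall>v \<in> carrier_vec p. v \<noteq> 0\<^sub>v p \<longrightarrow> scalar_prod v (A *\<^sub>v v) > 0)}"

text \<open>
  For positive definite \<open>\<Sigma>\<close>, \<^const>\<open>mat_inverse\<close> returns \<open>Some\<close> of the inverse matrix.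
\<close>

definition mvn_density :: "nat \<Rightarrow> real Matrix.vec \<Rightarrow> real mat \<Rightarrow> real Matrix.vec \<Rightarrow> real" where
  "mvn_density p \<mu> \<Sigma> x =
     exp (- scalar_prod (x - \<mu>) (the (mat_inverse \<Sigma>) *\<^sub>v (x - \<mu>)) / 2)
       / sqrt ((2 * pi) ^ p * Determinant.det \<Sigma>)"

definition mvn :: "nat \<Rightarrow> real Matrix.vec \<Rightarrow> real mat \<Rightarrow> (nat \<Rightarrow> real) measure" where
  "mvn p \<mu> \<Sigma> = density (\<Pi>\<^sub>M i\<in>{..<p}. lborel) (\<lambda>x. ennreal (mvn_density p \<mu> \<Sigma> (Matrix.vec p x)))"

definition sample_law ::
  "nat \<Rightarrow> nat \<Rightarrow> real Matrix.vec \<Rightarrow> real mat \<Rightarrow> (nat \<Rightarrow> nat \<Rightarrow> real) measure" where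
  "sample_law n p \<mu> \<Sigma> = (\<Pi>\<^sub>M k\<in>{1..n+1}. mvn p \<mu> \<Sigma>)"

definition estimators :: "nat \<Rightarrow> nat \<Rightarrow> ((nat \<Rightarrow> nat \<Rightarrow> real) \<Rightarrow> real) set" where
  "estimators n p = borel_measurable (\<Pi>\<^sub>M k\<in>{1..n+1}. \<Pi>\<^sub>M i\<in>{..<p}. borel)"

definition max_risk :: "nat \<Rightarrow> nat \<Rightarrow> ((nat \<Rightarrow> nat \<Rightarrow> real) \<Rightarrow> real) \<Rightarrow> ennreal" where
  "max_risk n p \<delta> = (SUP \<mu> \<in> carrier_vec p. SUP \<Sigma> \<in> pos_def_mats p.
     \<integral>\<^sup>+ X. ennreal ((\<delta> X - ln (Determinant.det \<Sigma>))\<^sup>2) \<partial>sample_law n p \<mu> \<Sigma>)"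

definition minimax_risk :: "nat \<Rightarrow> nat \<Rightarrow> ennreal" where
  "minimax_risk n p = (INF \<delta> \<in> estimators n p. max_risk n p \<delta>)"

definition sample_mean :: "nat \<Rightarrow> (nat \<Rightarrow> nat \<Rightarrow> real) \<Rightarrow> nat \<Rightarrow> real" where
  "sample_mean n X i = (\<Sum>k=1..n+1. X k i) / real (n + 1)"

definition sample_cov :: "nat \<Rightarrow> nat \<Rightarrow> (nat \<Rightarrow> nat \<Rightarrow> real) \<Rightarrow> real mat" where
  "sample_cov n p X = Matrix.mat p p (\<lambda>(i, j).
     (\<Sum>k=1..n+1. (X k i - sample_mean n X i) * (X k j - sample_mean n X j)) / real n)"

definition bias_correction :: "nat \<Rightarrow> nat \<Rightarrow> real" where
  "bias_correction n p =
     (\<Sum>k=1..p. (Digamma ((real n - real k + 1) / 2) - ln (real n / 2)))"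

text \<open>
  For \<open>p \<le> n\<close> the sample covariance is singular only on a null set, so the value of \<^const>\<open>ln\<close>
  at 0 does not affect the risk.
\<close>

definition logdet_estimator :: "nat \<Rightarrow> nat \<Rightarrow> (nat \<Rightarrow> nat \<Rightarrow> real) \<Rightarrow> real" where
  "logdet_estimator n p X = ln (Determinant.det (sample_cov n p X)) - bias_correction n p"

lemma logdet_estimator_in_estimators: "logdet_estimator n p \<in> estimators n p"
proof -
  let ?S = "\<Pi>\<^sub>M k\<in>{1..n+1}. \<Pi>\<^sub>M i\<in>{..<p}. (borel :: real measure)"
  have comp: "(\<lambda>X. X k i) \<in> borel_measurable ?S" if "k \<in> {1..n+1}" "i < p" for k i
    using measurable_compose[OF measurable_component_singleton[OF that(1)]
        measurable_component_singleton[of i "{..<p}"]] that(2) by simp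
  have mean: "(\<lambda>X. sample_mean n X i) \<in> borel_measurable ?S" if "i < p" for i
    unfolding sample_mean_def using that
    by (intro borel_measurable_divide borel_measurable_sum borel_measurable_const comp) auto
  have cov: "(\<lambda>X. sample_cov n p X $$ (i, j)) \<in> borel_measurable ?S" if "i < p" "j < p" for i j
  proof -
    have "(\<lambda>X. (\<Sum>k=1..n+1. (X k i - sample_mean n X i) * (X k j - sample_mean n X j)) / real n)
        \<in> borel_measurable ?S"
      using that
      by (intro borel_measurable_divide borel_measurable_sum borel_measurable_const
          borel_measurable_times borel_measurable_diff comp mean)
    then show ?thesis
      using that by (simp add: sample_cov_def)
  qed
  have "(\<lambda>X. Determinant.det (sample_cov n p X)) \<in> borel_measurable ?S"
  proof -
    have "(\<lambda>X. \<Sum>q \<in> {q. q permutes {0..<p}}. signof q * (\<Prod>i = 0..<p. sample_cov n p X $$ (i, q i)))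
        \<in> borel_measurable ?S"
    proof (intro borel_measurable_sum borel_measurable_times borel_measurable_const
        borel_measurable_prod)
      fix q i assume "q \<in> {q. q permutes {0..<p}}" "i \<in> {0..<p}"
      then show "(\<lambda>X. sample_cov n p X $$ (i, q i)) \<in> borel_measurable ?S"
        using permutes_in_image[of q "{0..<p}" i] by (intro cov) auto
    qed
    then show ?thesis
      by (simp add: Determinant.det_def sample_cov_def)
  qed
  then show ?thesis
    unfolding estimators_def logdet_estimator_def
    by (intro borel_measurable_diff borel_measurable_ln borel_measurable_const)
qed

end

theory Submission
  imports Defs "HOL-Real_Asymp.Real_Asymp"
begin

text \<open>
The minimax risk is squeezed between two explicit bounds that hold whenever \<open>1 \<le> p \<le> n\<close>:
\[ \frac{2p}{n+3} \le R_n \le \sum_{i<p} \psi'\Bigl(\frac{n-i}{2}\Bigr) . \]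
The asymptotic claims follow from them by calculus (\<open>risk_asymptotics\<close>), because the trigamma
function satisfies \<open>\<psi>'(x) \<le> 1/x + 1/x\<^sup>2\<close>.

For the lower bound (\<open>minimax_risk_lower_bound\<close>) it is enough to look at the scale family
\<open>\<mu> = 0\<close>, \<open>\<Sigma> = I/l\<close>. With an exponential prior on the precision \<open>l\<close> the posterior is a Gamma
distribution whose shape \<open>\<alpha> = p(n+1)/2 + 1\<close> is the same for all data, and the logarithm of a
Gamma variable of shape \<open>\<alpha>\<close> cannot be estimated with mean squared error below \<open>1/\<alpha>\<close>
(\<open>gamma_log_variance_lower_bound\<close>). As \<open>log det \<Sigma> = - p log l\<close>, the Bayes risk, and so the
maximal risk of any estimator, is at least \<open>p\<^sup>2/\<alpha>\<close>.

The upper bound is the risk of the bias-corrected estimator (\<open>logdet_risk_le\<close>). Read the data by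
coordinates: coordinate \<open>i\<close> gives a row \<open>r\<^sub>i\<close> of \<open>n+1\<close> numbers. Gram-Schmidt applied to
\<open>1, r\<^sub>0, \<dots>, r\<^sub>p\<^sub>-\<^sub>1\<close> shows that \<open>n\<^sup>p\<close> times the determinant of the sample covariance is the product
of the squared distances \<open>D\<^sub>i\<close> of \<open>r\<^sub>i\<close> from the span of \<open>1, r\<^sub>0, \<dots>, r\<^sub>i\<^sub>-\<^sub>1\<close> (\<open>det_sample_cov\<close>).
Given the earlier rows, \<open>r\<^sub>i\<close> is a Gaussian vector with independent entries of a variance
\<open>\<sigma>\<^sub>i\<^sup>2\<close>, centred at a point of that span, where \<open>\<Prod> \<sigma>\<^sub>i\<^sup>2 = det \<Sigma>\<close> (\<open>mvn_density_sequential\<close>). So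
\<open>D\<^sub>i/\<sigma>\<^sub>i\<^sup>2\<close> is chi-squared with \<open>n - i\<close> degrees of freedom, for almost all values of the earlier rows.

That last fact is used only through negative moments of \<open>D\<^sub>i\<close>, and they come without any change of
variables. Writing \<open>exp(t w\<^sup>2)\<close> as a Gaussian average of \<open>exp(\<surd>(2t) z w)\<close> turns the Laplace
transform of \<open>D\<^sub>i\<close> into a product of one-dimensional integrals (\<open>normal_row_laplace\<close>), and
integrating it against \<open>t\<^sup>s\<^sup>-\<^sup>1\<close> gives the moment of order \<open>-s\<close> as a ratio of Gamma values
(\<open>normal_row.negative_moment\<close>). Integrating one row after the other multiplies these ratios
(\<open>nn_integral_rowwise\<close>), which yields \<open>M(s) = E exp(-sZ)\<close> for the error \<open>Z\<close> of the estimator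
and small \<open>s > 0\<close>. By Fatou's lemma \<open>E Z\<^sup>2\<close> is at most the limit of the second difference
\<open>(1 - 2 M(s) + M(2s))/s\<^sup>2\<close>, that is \<open>(log M)''(0) = \<Sum> \<psi>'((n-i)/2)\<close>; the bias correction
enters as \<open>(log M)'(0) = 0\<close>.
\<close>

section \<open>Gaussian and Gamma integrals\<close>

lemma nn_integral_exp_quadratic:
  fixes c \<beta> :: real
  assumes c: "c > 0"
  shows "(\<integral>\<^sup>+x. ennreal (exp (- c * x\<^sup>2 / 2 + \<beta> * x)) \<partial>lborel)
    = ennreal (sqrt (2 * pi / c) * exp (\<beta>\<^sup>2 / (2 * c)))"
proof -
  have sd: "1 / sqrt c > 0" using c by simp
  have eq: "exp (- c * x\<^sup>2 / 2 + \<beta> * x)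
      = sqrt (2 * pi / c) * exp (\<beta>\<^sup>2 / (2 * c)) * normal_density (\<beta> / c) (1 / sqrt c) x" for x
  proof -
    have "sqrt (2 * pi * (1 / sqrt c)\<^sup>2) = sqrt (2 * pi / c)"
      using c by (simp add: power_divide)
    moreover have "- c * x\<^sup>2 / 2 + \<beta> * x = \<beta>\<^sup>2 / (2 * c) + - (x - \<beta> / c)\<^sup>2 / (2 * (1 / sqrt c)\<^sup>2)"
      using c by (simp add: power_divide field_simps power2_eq_square)
    ultimately show ?thesis
      using c by (simp add: normal_density_def exp_add[symmetric])
  qed
  have "(\<integral>\<^sup>+x. ennreal (normal_density (\<beta> / c) (1 / sqrt c) x) \<partial>lborel) = 1"
    using prob_space.emeasure_space_1[OF prob_space_normal_density[OF sd]]
    by (simp add: emeasure_density)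
  then show ?thesis
    unfolding eq using c by (simp add: ennreal_mult' nn_integral_cmult del: times_divide_eq_right)
qed

text \<open>
The Gamma density of shape \<open>a\<close> and rate \<open>b\<close> without its constant. Rate \<open>0\<close> is meaningful too: it
gives the kernel of the Mellin transform.
\<close>

definition gamma_kernel :: "real \<Rightarrow> real \<Rightarrow> real \<Rightarrow> real" where
  "gamma_kernel a b x = indicator {0<..} x * (x powr (a - 1) * exp (- b * x))"

lemma gamma_kernel_nonneg [simp]: "gamma_kernel a b x \<ge> 0"
  by (simp add: gamma_kernel_def)

lemma measurable_gamma_kernel [measurable]:
  assumes [measurable]: "f \<in> borel_measurable M" "g \<in> borel_measurable M"
  shows "(\<lambda>x. gamma_kernel a (f x) (g x)) \<in> borel_measurable M"
  unfolding gamma_kernel_def by measurable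

lemma nn_integral_gamma_kernel:
  assumes a: "a > 0" and b: "b > 0"
  shows "(\<integral>\<^sup>+x. ennreal (gamma_kernel a b x) \<partial>lborel) = ennreal (Gamma a / b powr a)"
proof -
  have "ennreal (Gamma a) = (\<integral>\<^sup>+t. ennreal (indicator {0..} t * t powr (a - 1) / exp t) \<partial>lborel)"
    by (rule Gamma_conv_nn_integral_real[OF a])
  also have "\<dots> = ennreal \<bar>b\<bar> *
      (\<integral>\<^sup>+t. ennreal (indicator {0..} (0 + b * t) * (0 + b * t) powr (a - 1) / exp (0 + b * t)) \<partial>lborel)"
    using b by (intro nn_integral_real_affine) auto
  also have "(\<integral>\<^sup>+t. ennreal (indicator {0..} (0 + b * t) * (0 + b * t) powr (a - 1) / exp (0 + b * t)) \<partial>lborel)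
     = (\<integral>\<^sup>+t. ennreal (b powr (a - 1)) * ennreal (gamma_kernel a b t) \<partial>lborel)"
    using b
    by (intro nn_integral_cong)
      (auto simp: gamma_kernel_def indicator_def powr_mult exp_minus divide_inverse
        zero_le_mult_iff ennreal_mult'[symmetric])
  also have "ennreal \<bar>b\<bar> * \<dots> = ennreal (b * b powr (a - 1)) * (\<integral>\<^sup>+x. ennreal (gamma_kernel a b x) \<partial>lborel)"
    using b by (simp add: nn_integral_cmult ennreal_mult' mult.assoc)
  also have "b * b powr (a - 1) = b powr a"
    using b by (simp add: powr_diff)
  finally have "ennreal (Gamma a) / ennreal (b powr a)
      = (\<integral>\<^sup>+x. ennreal (gamma_kernel a b x) \<partial>lborel)"
    using b by (simp add: ennreal_mult_divide_eq mult.commute[of "ennreal (b powr a)"])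
  then show ?thesis using b a by (simp add: divide_ennreal Gamma_real_pos less_imp_le)
qed

lemma has_integral_gamma_kernel:
  assumes "a > 0" and "b > 0"
  shows "has_bochner_integral lborel (gamma_kernel a b) (Gamma a / b powr a)"
  using assms by (intro has_bochner_integral_nn_integral nn_integral_gamma_kernel)
    (auto simp: Gamma_real_pos less_imp_le)

lemma gamma_kernel_Suc: "x * gamma_kernel a b x = gamma_kernel (a + 1) b x"
  by (auto simp: gamma_kernel_def indicator_def powr_diff)

text \<open>
If \<open>W\<close> has a Gamma distribution of shape \<open>a\<close> and rate \<open>b\<close>, then integration by parts gives
\<open>E (c + ln W)(bW - a) = 1\<close>, while \<open>E (bW - a)\<^sup>2 = a\<close>; the Cauchy-Schwarz inequality yields
\<open>E (c + ln W)\<^sup>2 \<ge> 1/a\<close> for every constant \<open>c\<close>. The integral on the left is the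
mass of the unnormalised density. The bound does not depend on \<open>b\<close>, which is why a Bayes estimator
gains nothing from the data that it happens to see.
\<close>

lemma gamma_log_variance_lower_bound:
  assumes a: "a > 0" and b: "b > 0"
  shows "ennreal (1 / a) * (\<integral>\<^sup>+x. ennreal (gamma_kernel a b x) \<partial>lborel)
    \<le> (\<integral>\<^sup>+x. ennreal ((c + ln x)\<^sup>2 * gamma_kernel a b x) \<partial>lborel)" (is "_ \<le> ?A")
proof (cases "?A = \<infinity>")
  case False
  define g where "g = gamma_kernel a b"
  define G where "G = Gamma a / b powr a"
  have A: "integrable lborel (\<lambda>x. (c + ln x)\<^sup>2 * g x)"
    using False unfolding g_def
    by (intro integrableI_bounded) (auto simp: top.not_eq_extremum abs_mult)
  have g0: "has_bochner_integral lborel g G"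
    unfolding g_def G_def by (rule has_integral_gamma_kernel[OF a b])
  have Gamma_Suc: "Gamma (a + 1) = a * Gamma a" "Gamma (2 + a) = (a + 1) * (a * Gamma a)"
    using a Gamma_plus1[of a] Gamma_plus1[of "a + 1"] by (auto simp: nonpos_Ints_def add.commute)
  have g1: "has_bochner_integral lborel (\<lambda>x. x * g x) (a / b * G)"
    unfolding g_def gamma_kernel_Suc G_def
    using has_integral_gamma_kernel[of "a + 1" b] a b
    by (simp add: Gamma_Suc powr_add mult.commute[of b])
  have g2: "has_bochner_integral lborel (\<lambda>x. x * (x * g x)) (a * (a + 1) / b\<^sup>2 * G)"
    unfolding g_def gamma_kernel_Suc G_def
    using has_integral_gamma_kernel[of "a + 1 + 1" b] a b
    by (simp add: Gamma_Suc powr_add mult_ac power2_eq_square)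
  have sq: "has_bochner_integral lborel (\<lambda>x. (b * x - a)\<^sup>2 * g x) (a * G)"
  proof -
    have "has_bochner_integral lborel
       (\<lambda>x. b\<^sup>2 * (x * (x * g x)) - (2 * a * b) * (x * g x) + a\<^sup>2 * g x)
       (b\<^sup>2 * (a * (a + 1) / b\<^sup>2 * G) - (2 * a * b) * (a / b * G) + a\<^sup>2 * G)"
      by (intro has_bochner_integral_add has_bochner_integral_diff has_bochner_integral_mult_right g0 g1 g2)
    moreover have "b\<^sup>2 * (a * (a + 1) / b\<^sup>2 * G) - (2 * a * b) * (a / b * G) + a\<^sup>2 * G = a * G"
      using b by (simp add: field_simps power2_eq_square)
    ultimately show ?thesis by (simp add: power2_eq_square algebra_simps)
  qed
  have cross_int: "integrable lborel (\<lambda>x. (c + ln x) * (b * x - a) * g x)"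
  proof (rule Bochner_Integration.integrable_bound)
    show "integrable lborel (\<lambda>x. (c + ln x)\<^sup>2 * g x + (b * x - a)\<^sup>2 * g x)"
      using A sq by (auto simp: has_bochner_integral_iff)
    show "(\<lambda>x. (c + ln x) * (b * x - a) * g x) \<in> borel_measurable lborel"
      unfolding g_def by measurable
    have "\<bar>u * v\<bar> \<le> u\<^sup>2 + v\<^sup>2" for u v :: real
      using sum_squares_bound[of "\<bar>u\<bar>" "\<bar>v\<bar>"] mult_nonneg_nonneg[OF abs_ge_zero[of u] abs_ge_zero[of v]]
      unfolding abs_mult power2_abs mult.assoc by linarith
    then show "AE x in lborel. norm ((c + ln x) * (b * x - a) * g x)
        \<le> norm ((c + ln x)\<^sup>2 * g x + (b * x - a)\<^sup>2 * g x)"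
      by (auto simp: g_def abs_mult distrib_right[symmetric] intro!: mult_right_mono)
  qed
  have cross: "has_bochner_integral lborel (\<lambda>x. (c + ln x) * (b * x - a) * g x) G"
  proof -
    (* F' is the difference of the density and the cross term, and F vanishes at both ends. *)
    define F where "F x = (c + ln x) * (x powr a * exp (- b * x))" for x
    define f where "f x = g x - (c + ln x) * (b * x - a) * g x" for x
    have fint: "integrable lborel f"
      unfolding f_def using cross_int g0 by (auto simp: has_bochner_integral_iff)
    have f_pos: "f x = x powr (a - 1) * exp (- b * x) - (c + ln x) * (b * x - a) * (x powr (a - 1) * exp (- b * x))"
      if "x > 0" for x using that by (simp add: f_def g_def gamma_kernel_def)
    have "(LBINT x=0..\<infinity>. f x) = 0 - 0"
    proof (rule interval_integral_FTC_integrable)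
      show "(F has_vector_derivative f x) (at x)" if "0 < ereal x" "ereal x < \<infinity>" for x
      proof -
        have x: "x > 0" using that by simp
        have "(F has_real_derivative f x) (at x)"
          unfolding F_def f_pos[OF x] using x
          by (auto intro!: derivative_eq_intros simp: powr_diff field_simps)
        then show ?thesis by (simp add: has_real_derivative_iff_has_vector_derivative)
      qed
      show "isCont f x" if "0 < ereal x" "ereal x < \<infinity>" for x
      proof -
        have x: "x > 0" using that by simp
        have "isCont (\<lambda>x. x powr (a - 1) * exp (- b * x) - (c + ln x) * (b * x - a) * (x powr (a - 1) * exp (- b * x))) x"
          using x by (intro continuous_intros) auto
        moreover have "eventually (\<lambda>y. y \<in> {0<..}) (nhds x)"
          using x by (intro eventually_nhds_in_open) auto
        then have "eventually (\<lambda>y. f y = y powr (a - 1) * exp (- b * y) - (c + ln y) * (b * y - a) * (y powr (a - 1) * exp (- b * y))) (nhds x)"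
          by eventually_elim (simp add: f_pos)
        ultimately show ?thesis by (simp add: isCont_cong)
      qed
      show "set_integrable lborel (einterval 0 \<infinity>) f"
        unfolding set_integrable_def using fint by (intro integrable_mult_indicator) auto
      show "((F \<circ> real_of_ereal) \<longlongrightarrow> 0) (at_right 0)"
        unfolding zero_ereal_def ereal_tendsto_simps F_def using a b by real_asymp
      show "((F \<circ> real_of_ereal) \<longlongrightarrow> 0) (at_left \<infinity>)"
        unfolding ereal_tendsto_simps F_def using a b by real_asymp
    qed auto
    moreover have "(LBINT x=0..\<infinity>. f x) = (\<integral>x. f x \<partial>lborel)"
      by (auto simp: interval_lebesgue_integral_def set_lebesgue_integral_def f_def g_def
        gamma_kernel_def einterval_def indicator_def intro!: Bochner_Integration.integral_cong)
    ultimately have "(\<integral>x. f x \<partial>lborel) = 0" by simp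
    then show ?thesis
      unfolding f_def using cross_int g0 by (simp add: has_bochner_integral_iff)
  qed
  (* Expand the square of (c + ln x) - (b x - a) / a, the residual of the regression on b x - a. *)
  have "has_bochner_integral lborel
     (\<lambda>x. (c + ln x)\<^sup>2 * g x - 2 / a * ((c + ln x) * (b * x - a) * g x) + 1 / a\<^sup>2 * ((b * x - a)\<^sup>2 * g x))
     ((\<integral>x. (c + ln x)\<^sup>2 * g x \<partial>lborel) - 2 / a * G + 1 / a\<^sup>2 * (a * G))"
    using A by (intro has_bochner_integral_add has_bochner_integral_diff
      has_bochner_integral_mult_right cross sq) (auto simp: has_bochner_integral_iff)
  moreover have "(\<lambda>x. (c + ln x)\<^sup>2 * g x - 2 / a * ((c + ln x) * (b * x - a) * g x) + 1 / a\<^sup>2 * ((b * x - a)\<^sup>2 * g x))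
     = (\<lambda>x. (c + ln x - (b * x - a) / a)\<^sup>2 * g x)"
    using a by (auto simp: field_simps power2_eq_square)
  ultimately have "has_bochner_integral lborel (\<lambda>x. (c + ln x - (b * x - a) / a)\<^sup>2 * g x)
     ((\<integral>x. (c + ln x)\<^sup>2 * g x \<partial>lborel) - 2 / a * G + 1 / a\<^sup>2 * (a * G))" by simp
  from has_bochner_integral_integral_eq[OF this]
  have "0 \<le> (\<integral>x. (c + ln x)\<^sup>2 * g x \<partial>lborel) - 2 / a * G + 1 / a\<^sup>2 * (a * G)"
    by (metis (no_types, lifting) g_def gamma_kernel_nonneg Bochner_Integration.integral_nonneg
        mult_nonneg_nonneg zero_le_power2)
  also have "\<dots> = (\<integral>x. (c + ln x)\<^sup>2 * g x \<partial>lborel) - 1 / a * G"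
    using a by (simp add: field_simps power2_eq_square)
  finally have le: "1 / a * G \<le> (\<integral>x. (c + ln x)\<^sup>2 * g x \<partial>lborel)" by simp
  have "?A = ennreal (\<integral>x. (c + ln x)\<^sup>2 * g x \<partial>lborel)"
    using A unfolding g_def by (intro nn_integral_eq_integral) auto
  moreover have "ennreal (1 / a) * (\<integral>\<^sup>+x. ennreal (gamma_kernel a b x) \<partial>lborel) = ennreal (1 / a * G)"
    unfolding nn_integral_gamma_kernel[OF a b] G_def using a b
    by (intro ennreal_mult[symmetric]) (auto simp: Gamma_real_pos less_imp_le)
  ultimately show ?thesis using le by (simp add: ennreal_leI)
qed (simp)

section \<open>Trigamma sums and the asymptotic statements\<close>

lemma trigamma_le:
  fixes x :: real
  assumes x: "x > 0"
  shows "Polygamma 1 x \<le> 1 / x + 1 / x\<^sup>2"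
proof -
  let ?f = "\<lambda>k. inverse ((x + real k)\<^sup>2)"
  have sf: "summable ?f" using Polygamma_converges'[of x 2] x by simp
  have "(\<lambda>k. 1 / (x + real k)) \<longlonglongrightarrow> 0" using x by real_asymp
  from telescope_sums'[OF this]
  have tel: "(\<lambda>k. 1 / (x + real k) - 1 / (x + real (Suc k))) sums (1 / x)" by simp
  have "(\<Sum>k. ?f (Suc k)) \<le> (\<Sum>k. 1 / (x + real k) - 1 / (x + real (Suc k)))"
  proof (rule suminf_le)
    show "summable (\<lambda>k. ?f (Suc k))" using sf by (subst summable_Suc_iff)
    show "summable (\<lambda>k. 1 / (x + real k) - 1 / (x + real (Suc k)))" using tel by (rule sums_summable)
    fix k
    have "(x + real k) * (x + real (Suc k)) \<le> (x + real (Suc k))\<^sup>2"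
      using x by (simp add: power2_eq_square mult_right_mono)
    moreover have "1 / (x + real k) - 1 / (x + real (Suc k)) = inverse ((x + real k) * (x + real (Suc k)))"
      using x by (simp add: field_simps)
    ultimately show "?f (Suc k) \<le> 1 / (x + real k) - 1 / (x + real (Suc k))"
      using x le_imp_inverse_le[of "(x + real k) * (x + real (Suc k))" "(x + real (Suc k))\<^sup>2"]
      by (simp del: of_nat_Suc)
  qed
  also have "\<dots> = 1 / x" using tel by (simp add: sums_iff)
  finally have "(\<Sum>k. ?f (Suc k)) \<le> 1 / x" .
  moreover have "(\<Sum>k. ?f k) = ?f 0 + (\<Sum>k. ?f (Suc k))"
    using suminf_split_head[OF sf] by simp
  ultimately show ?thesis
    by (simp add: Polygamma_def numeral_2_eq_2 divide_inverse)
qed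

text \<open>
Comparison with telescoping sums: \<open>1/d \<le> ln (d/(d-1))\<close> produces the logarithm, and
\<open>1/d\<^sup>2 \<le> 1/(d-1) - 1/d\<close> leaves an error that vanishes as \<open>n - p\<close> grows.
\<close>

lemma trigamma_sum_le_log:
  assumes "p < n"
  shows "(\<Sum>i<p. Polygamma 1 (real (n - i) / 2))
    \<le> - 2 * ln (1 - real p / real n) + 4 / real (n - p)"
proof -
  have "(\<Sum>i<p. 2 / real (n - i)) \<le> - 2 * ln (1 - real p / real n) \<and>
    (\<Sum>i<p. 4 / (real (n - i))\<^sup>2) \<le> 4 / real (n - p) - 4 / real n"
    using assms
  proof (induction p)
    case (Suc p)
    define d where "d = real n - real p"
    have d: "d > 1" "d \<le> n" using Suc.prems by (auto simp: d_def)
    have "ln (1 - real (Suc p) / real n) = ln ((1 - real p / real n) * (1 - 1 / d))"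
      using d by (intro arg_cong[where f = ln]) (simp add: d_def field_simps)
    also have "\<dots> = ln (1 - real p / real n) + ln (1 - 1 / d)"
      using Suc.prems d by (intro ln_mult_pos) (auto simp: field_simps)
    also have "ln (1 - 1 / d) \<le> - 1 / d"
      using ln_le_minus_one[of "1 - 1 / d"] d by simp
    finally have 1: "2 / d \<le> - 2 * ln (1 - real (Suc p) / real n) + 2 * ln (1 - real p / real n)"
      by simp
    have "4 / d\<^sup>2 \<le> 4 / (d * (d - 1))"
      using d by (intro divide_left_mono) (auto simp: power2_eq_square)
    also have "\<dots> = 4 / (d - 1) - 4 / d" using d by (simp add: field_simps)
    finally have 2: "4 / d\<^sup>2 \<le> 4 / (d - 1) - 4 / d" .
    have e: "real (n - p) = d" "real (n - Suc p) = d - 1"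
      using Suc.prems by (auto simp: d_def of_nat_diff)
    have "p < n" using Suc.prems by simp
    note IH = Suc.IH[OF this]
    show ?case unfolding sum.lessThan_Suc e using 1 2 IH unfolding e by linarith
  qed auto
  moreover have "(\<Sum>i<p. Polygamma 1 (real (n - i) / 2)) \<le> (\<Sum>i<p. 2 / real (n - i) + 4 / (real (n - i))\<^sup>2)"
    using assms by (intro sum_mono order.trans[OF trigamma_le]) (auto simp: power_divide)
  moreover have "4 / real n \<ge> 0" by simp
  ultimately show ?thesis unfolding sum.distrib by argo
qed

text \<open>
A bound proportional to \<open>p\<close>, for the case \<open>p/n \<longlonglongrightarrow> 0\<close>: there the additive error of the previous
bound would not be small compared with \<open>p/n\<close>.
\<close>

lemma trigamma_sum_le_linear:
  assumes "p < n"
  shows "(\<Sum>i<p. Polygamma 1 (real (n - i) / 2))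
    \<le> real p * (2 / real (n - p) + 4 / (real (n - p))\<^sup>2)"
proof -
  have "(\<Sum>i<p. Polygamma 1 (real (n - i) / 2)) \<le> (\<Sum>i<p. 2 / real (n - p) + 4 / (real (n - p))\<^sup>2)"
  proof (intro sum_mono)
    fix i assume i: "i \<in> {..<p}"
    have "Polygamma 1 (real (n - i) / 2) \<le> 2 / real (n - i) + 4 / (real (n - i))\<^sup>2"
      using assms i trigamma_le[of "real (n - i) / 2"] by (simp add: power_divide)
    also have "\<dots> \<le> 2 / real (n - p) + 4 / (real (n - p))\<^sup>2"
      using assms i by (intro add_mono divide_left_mono power_mono) auto
    finally show "Polygamma 1 (real (n - i) / 2) \<le> 2 / real (n - p) + 4 / (real (n - p))\<^sup>2" .
  qed
  then show ?thesis by simp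
qed

text \<open>
By l'Hopital's rule, since \<open>\<kappa>\<close> is the second derivative of \<open>M\<close> at \<open>0\<close>. The difference is one-sided
because \<open>M s\<close> will be known for positive \<open>s\<close> only, where it is a negative moment of the determinant.
\<close>

lemma second_difference_limit:
  fixes M M' :: "real \<Rightarrow> real"
  assumes r: "r > 0" and M0: "M 0 = 1" and M'0: "M' 0 = 0"
    and dM: "\<And>s. \<bar>s\<bar> < r \<Longrightarrow> (M has_real_derivative M' s) (at s)"
    and dM': "(M' has_real_derivative \<kappa>) (at 0)"
  shows "((\<lambda>s. (1 - 2 * M s + M (2 * s)) / s\<^sup>2) \<longlongrightarrow> \<kappa>) (at_right 0)"
proof (rule lhopital_right_0)
  have ev: "eventually (\<lambda>s. s \<in> {0<..<r / 2}) (at_right (0::real))"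
    using r by (intro eventually_at_right_real) auto
  have cM: "isCont M 0" using dM[of 0] r by (auto intro: DERIV_isCont)
  have l: "(M \<longlongrightarrow> 1) (at_right 0)"
    using cM M0 by (simp add: continuous_within filterlim_at_split)
  have l2: "((\<lambda>s. M (2 * s)) \<longlongrightarrow> 1) (at_right 0)"
  proof -
    have "isCont (\<lambda>s. M (2 * s)) 0" using cM isCont_o2[of 0 "\<lambda>s. 2 * s" M] by simp
    then show ?thesis using M0 by (simp add: continuous_within filterlim_at_split)
  qed
  show "((\<lambda>s. 1 - 2 * M s + M (2 * s)) \<longlongrightarrow> 0) (at_right 0)"
    using l l2 by (auto intro!: tendsto_eq_intros)
  show "((\<lambda>s::real. s\<^sup>2) \<longlongrightarrow> 0) (at_right 0)" by (auto intro!: tendsto_eq_intros)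
  show "eventually (\<lambda>s::real. s\<^sup>2 \<noteq> 0) (at_right 0)" "eventually (\<lambda>s::real. 2 * s \<noteq> 0) (at_right 0)"
    by (auto simp: eventually_at_filter)
  show "eventually (\<lambda>s::real. DERIV (\<lambda>s. s\<^sup>2) s :> 2 * s) (at_right 0)"
    by (auto intro!: always_eventually derivative_eq_intros)
  show "eventually (\<lambda>s. DERIV (\<lambda>s. 1 - 2 * M s + M (2 * s)) s :> - 2 * M' s + 2 * M' (2 * s)) (at_right 0)"
    using ev
  proof eventually_elim
    case (elim s)
    have "(M has_real_derivative M' s) (at s)" "(M has_real_derivative M' (2 * s)) (at (2 * s))"
      using elim r by (auto intro!: dM)
    then show ?case
      by (auto intro!: derivative_eq_intros DERIV_chain2[where f = M])
  qed
  have q: "((\<lambda>s. M' s / s) \<longlongrightarrow> \<kappa>) (at_right 0)"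
    using dM' M'0 by (simp add: has_field_derivative_iff filterlim_at_split)
  have "filterlim (\<lambda>s::real. 2 * s) (at_right 0) (at_right 0)"
    by real_asymp
  from filterlim_compose[OF q this]
  have q2: "((\<lambda>s. M' (2 * s) / (2 * s)) \<longlongrightarrow> \<kappa>) (at_right 0)" .
  have "((\<lambda>s. - (M' s / s) + 2 * (M' (2 * s) / (2 * s))) \<longlongrightarrow> \<kappa>) (at_right 0)"
    using tendsto_add[OF tendsto_minus[OF q] tendsto_mult[OF tendsto_const[of 2] q2]] by simp
  moreover have "eventually (\<lambda>s. - (M' s / s) + 2 * (M' (2 * s) / (2 * s))
      = (- 2 * M' s + 2 * M' (2 * s)) / (2 * s)) (at_right (0::real))"
    using ev by eventually_elim (simp add: field_simps)
  ultimately show "((\<lambda>s. (- 2 * M' s + 2 * M' (2 * s)) / (2 * s)) \<longlongrightarrow> \<kappa>) (at_right 0)"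
    using tendsto_cong by fast
qed

text \<open>
Here \<open>M\<close> is the moment generating function of a sum of independent centred negative log-Gamma
variables; its logarithm has derivative \<open>0\<close> at \<open>0\<close>, and the trigamma sum as second derivative.
\<close>

lemma gamma_ratio_second_difference:
  fixes a :: "nat \<Rightarrow> real"
  assumes I: "finite I" and r: "r > 0" and a: "\<And>i. i \<in> I \<Longrightarrow> a i > r"
    and M: "\<And>s. M s = (\<Prod>i\<in>I. exp (s * Digamma (a i)) * Gamma (a i - s) / Gamma (a i))"
  shows "((\<lambda>s. (1 - 2 * M s + M (2 * s)) / s\<^sup>2) \<longlongrightarrow> (\<Sum>i\<in>I. Polygamma 1 (a i))) (at_right 0)"
proof -
  define Q where "Q s = (\<Sum>i\<in>I. s * Digamma (a i) + ln_Gamma (a i - s) - ln_Gamma (a i))" for s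
  define Q' where "Q' s = (\<Sum>i\<in>I. Digamma (a i) - Digamma (a i - s))" for s
  have apos: "a i > 0" if "i \<in> I" for i using a[OF that] r by simp
  have MQ: "M s = exp (Q s)" if "\<bar>s\<bar> < r" for s
  proof -
    have "exp (s * Digamma (a i)) * Gamma (a i - s) / Gamma (a i)
        = exp (s * Digamma (a i) + ln_Gamma (a i - s) - ln_Gamma (a i))" if "i \<in> I" for i
      using a[OF that] apos[OF that] \<open>\<bar>s\<bar> < r\<close> by (simp add: exp_add exp_diff Gamma_real_pos_exp)
    then show ?thesis unfolding M Q_def exp_sum[OF I] by (intro prod.cong) auto
  qed
  have dQ: "(Q has_real_derivative Q' s) (at s)" if "\<bar>s\<bar> < r" for s
    unfolding Q_def Q'_def using a that
    by (auto intro!: derivative_eq_intros sum.cong) (fastforce)+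
  have dQ': "(Q' has_real_derivative (\<Sum>i\<in>I. Polygamma 1 (a i))) (at 0)"
    unfolding Q'_def using apos
    by (auto intro!: derivative_eq_intros DERIV_chain2[where f = Digamma] sum.cong
      has_field_derivative_Polygamma simp: nonpos_Ints_def) fastforce+
  show ?thesis
  proof (rule second_difference_limit[OF r, where M' = "\<lambda>s. exp (Q s) * Q' s"])
    show "M 0 = 1" using r MQ[of 0] by (simp add: Q_def)
    show "exp (Q 0) * Q' 0 = 0" by (simp add: Q'_def)
    show "(M has_real_derivative exp (Q s) * Q' s) (at s)" if "\<bar>s\<bar> < r" for s
    proof -
      have "((\<lambda>s. exp (Q s)) has_real_derivative exp (Q s) * Q' s) (at s)"
        using dQ[OF that] by (auto intro!: derivative_eq_intros)
      moreover have "eventually (\<lambda>t. t \<in> ball 0 r) (nhds s)"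
        using that by (intro eventually_nhds_in_open) auto
      then have "eventually (\<lambda>t. exp (Q t) = M t) (nhds s)"
        by eventually_elim (simp add: MQ)
      ultimately show ?thesis by (simp add: DERIV_cong_ev)
    qed
    have "((\<lambda>s. exp (Q s) * Q' s) has_real_derivative
        exp (Q 0) * Q' 0 * Q' 0 + (\<Sum>i\<in>I. Polygamma 1 (a i)) * exp (Q 0)) (at 0)"
      using dQ[of 0] dQ' r by (intro DERIV_mult) (auto intro!: derivative_eq_intros)
    then show "((\<lambda>s. exp (Q s) * Q' s) has_real_derivative (\<Sum>i\<in>I. Polygamma 1 (a i))) (at 0)"
      by (simp add: Q'_def Q_def)
  qed
qed

lemma Limsup_le_if_vanishing_gap:
  fixes f g :: "nat \<Rightarrow> ennreal" and e :: "nat \<Rightarrow> real"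
  assumes e: "e \<longlonglongrightarrow> 0" and le: "eventually (\<lambda>n. f n \<le> g n + ennreal (e n)) sequentially"
  shows "limsup f \<le> limsup g" and "liminf f \<le> liminf g"
proof -
  have ev: "eventually (\<lambda>n. f n \<le> g n + ennreal \<epsilon>) sequentially" if "\<epsilon> > 0" for \<epsilon>
    using le order_tendstoD(2)[OF e that]
    by eventually_elim (meson add_left_mono ennreal_leI less_imp_le order.trans)
  show "limsup f \<le> limsup g"
  proof (rule ennreal_le_epsilon)
    fix \<epsilon> :: real assume "\<epsilon> > 0"
    from Limsup_mono[OF ev[OF this]] show "limsup f \<le> limsup g + ennreal \<epsilon>"
      using Limsup_const_add[of sequentially "ennreal \<epsilon>" g] by (simp add: add.commute)
  qed
  show "liminf f \<le> liminf g"
  proof (rule ennreal_le_epsilon)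
    fix \<epsilon> :: real assume "\<epsilon> > 0"
    from Liminf_mono[OF ev[OF this]] show "liminf f \<le> liminf g + ennreal \<epsilon>"
      using Liminf_const_add[of sequentially "ennreal \<epsilon>" g] by (simp add: add.commute)
  qed
qed

text \<open>
All four asymptotic claims follow from the two bounds. \<open>R\<close> stands for the minimax risk and \<open>T\<close> for
the maximal risk of the bias-corrected estimator.
\<close>

lemma risk_asymptotics:
  fixes R T :: "nat \<Rightarrow> ennreal" and p :: "nat \<Rightarrow> nat"
  assumes p_bounds: "\<And>n. n \<ge> 1 \<Longrightarrow> 1 \<le> p n \<and> p n \<le> n"
    and gap: "filterlim (\<lambda>n. n - p n) at_top sequentially"
    and RT: "\<And>n. R n \<le> T n"
    and lower: "\<And>n. n \<ge> 1 \<Longrightarrow> ennreal (2 * real (p n) / (real n + 3)) \<le> R n"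
    and upper: "\<And>n. n \<ge> 1 \<Longrightarrow> T n \<le> ennreal (\<Sum>i<p n. Polygamma 1 (real (n - i) / 2))"
  shows "2 * liminf (\<lambda>n. ennreal (real (p n) / real n)) \<le> liminf R"
    and "limsup R \<le> limsup (\<lambda>n. ennreal (- 2 * ln (1 - real (p n) / real n)))"
    and "(\<lambda>n. real (p n) / real n) \<longlonglongrightarrow> 0 \<Longrightarrow> (\<lambda>n. ennreal (real n / real (p n)) * R n) \<longlonglongrightarrow> 2"
    and "(\<lambda>n. real (p n) / real n) \<longlonglongrightarrow> 0 \<Longrightarrow> (\<lambda>n. T n / R n) \<longlonglongrightarrow> 1"
proof -
  define x where "x n = real (p n) / real n" for n
  define d where "d n = real (n - p n)" for n
  have evp: "eventually (\<lambda>n. 1 \<le> n \<and> 1 \<le> p n \<and> p n < n) sequentially"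
    using filterlim_at_top[THEN iffD1, OF gap, rule_format, of 1] eventually_ge_at_top[of 1]
    by eventually_elim (use p_bounds in auto)
  have d: "filterlim d at_top sequentially"
    unfolding d_def using gap by (rule filterlim_compose[OF filterlim_real_sequentially])
  have d0: "(\<lambda>n. 4 / d n) \<longlonglongrightarrow> 0"
    using d by (intro tendsto_divide_0[OF tendsto_const] filterlim_at_top_imp_at_infinity)
  show "2 * liminf (\<lambda>n. ennreal (real (p n) / real n)) \<le> liminf R"
  proof -
    have "2 * liminf (\<lambda>n. ennreal (real (p n) / real n)) = liminf (\<lambda>n. 2 * ennreal (x n))"
      unfolding x_def
      by (intro Liminf_compose_continuous_mono[symmetric] ennreal_continuous_on_cmult continuous_on_id monoI)
        (auto simp: mult_left_mono)
    also have "\<dots> \<le> liminf R"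
    proof (rule Limsup_le_if_vanishing_gap(2)[where e = "\<lambda>n. 6 / (real n + 3)"])
      show "(\<lambda>n. 6 / (real n + 3)) \<longlonglongrightarrow> 0" by real_asymp
      show "eventually (\<lambda>n. 2 * ennreal (x n) \<le> R n + ennreal (6 / (real n + 3))) sequentially"
        using evp
      proof eventually_elim
        case (elim n)
        have "2 * x n = (2 * real (p n) + 6 * x n) / (real n + 3)"
        proof -
          have "real (p n) = x n * real n" using elim by (simp add: x_def)
          then show ?thesis by (simp add: field_simps)
        qed
        also have "\<dots> \<le> (2 * real (p n) + 6 * 1) / (real n + 3)"
          using elim by (intro divide_right_mono add_left_mono mult_left_mono) (auto simp: x_def)
        also have "\<dots> = 2 * real (p n) / (real n + 3) + 6 / (real n + 3)"
          by (simp add: add_divide_distrib)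
        finally have "2 * x n \<le> 2 * real (p n) / (real n + 3) + 6 / (real n + 3)" .
        then have "ennreal (2 * x n) \<le> ennreal (2 * real (p n) / (real n + 3) + 6 / (real n + 3))"
          by (rule ennreal_leI)
        also have "\<dots> = ennreal (2 * real (p n) / (real n + 3)) + ennreal (6 / (real n + 3))"
          by (intro ennreal_plus) auto
        also have "\<dots> \<le> R n + ennreal (6 / (real n + 3))"
          using elim lower by (intro add_right_mono) auto
        finally show ?case by (simp add: ennreal_mult')
      qed
    qed
    finally show ?thesis .
  qed
  show "limsup R \<le> limsup (\<lambda>n. ennreal (- 2 * ln (1 - real (p n) / real n)))"
  proof (rule Limsup_le_if_vanishing_gap(1)[OF d0])
    show "eventually (\<lambda>n. R n \<le> ennreal (- 2 * ln (1 - real (p n) / real n)) + ennreal (4 / d n)) sequentially"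
      using evp
    proof eventually_elim
      case (elim n)
      have "R n \<le> ennreal (\<Sum>i<p n. Polygamma 1 (real (n - i) / 2))"
        using RT upper elim by (meson order.trans)
      also have "\<dots> \<le> ennreal (- 2 * ln (1 - real (p n) / real n) + 4 / d n)"
        unfolding d_def using elim by (intro ennreal_leI trigamma_sum_le_log) auto
      also have "\<dots> = ennreal (- 2 * ln (1 - real (p n) / real n)) + ennreal (4 / d n)"
        using elim by (intro ennreal_plus) (auto simp: d_def)
      finally show ?case .
    qed
  qed
  assume x0: "(\<lambda>n. real (p n) / real n) \<longlonglongrightarrow> 0"
  (* After multiplication by n / p = 1 / x both R and T lie between L and U, which tend to 2. *)
  define U where "U n = 1 / (1 - x n) * (2 + 4 / d n)" for n
  define L where "L n = 2 * real n / (real n + 3)" for n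
  have xlim: "x \<longlonglongrightarrow> 0" using x0 by (simp add: x_def[abs_def])
  have "U \<longlonglongrightarrow> 1 / (1 - 0) * (2 + 0)"
    unfolding U_def
    by (rule tendsto_mult[OF tendsto_divide[OF tendsto_const tendsto_diff[OF tendsto_const xlim]]
        tendsto_add[OF tendsto_const d0]]) simp
  then have U: "U \<longlonglongrightarrow> 2" by simp
  have L: "L \<longlonglongrightarrow> 2" unfolding L_def by real_asymp
  have bounds: "eventually (\<lambda>n. ennreal (L n) \<le> ennreal (1 / x n) * R n
      \<and> ennreal (1 / x n) * T n \<le> ennreal (U n) \<and> 0 < L n \<and> 0 < x n) sequentially"
    using evp
  proof eventually_elim
    case (elim n)
    have x: "x n > 0" using elim by (simp add: x_def)
    have dn: "d n = real n * (1 - x n)" "d n > 0" using elim by (auto simp: d_def x_def field_simps of_nat_diff)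
    have "ennreal (L n) = ennreal (1 / x n) * ennreal (2 * real (p n) / (real n + 3))"
      using elim x by (subst ennreal_mult'[symmetric]) (auto simp: L_def x_def)
    also have "\<dots> \<le> ennreal (1 / x n) * R n"
      using elim lower by (intro mult_left_mono) auto
    finally have 1: "ennreal (L n) \<le> ennreal (1 / x n) * R n" .
    have "ennreal (1 / x n) * T n \<le> ennreal (1 / x n) * ennreal (real (p n) * (2 / d n + 4 / (d n)\<^sup>2))"
      using elim upper trigamma_sum_le_linear[of "p n" n] unfolding d_def
      by (intro mult_left_mono order.trans[OF upper] ennreal_leI) auto
    also have "\<dots> = ennreal (U n)"
    proof -
      have "1 / x n * (real (p n) * (2 / d n + 4 / (d n)\<^sup>2)) = real n / d n * (2 + 4 / d n)"
        using elim dn(2) by (simp add: x_def field_simps power2_eq_square)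
      also have "real n / d n = 1 / (1 - x n)"
        unfolding dn(1) using elim by simp
      finally show ?thesis
        using x by (subst ennreal_mult'[symmetric]) (auto simp: U_def)
    qed
    finally show ?case using 1 elim x by (auto simp: L_def)
  qed
  show "(\<lambda>n. ennreal (real n / real (p n)) * R n) \<longlonglongrightarrow> 2"
  proof (rule tendsto_sandwich)
    show "(\<lambda>n. ennreal (L n)) \<longlonglongrightarrow> 2" "(\<lambda>n. ennreal (U n)) \<longlonglongrightarrow> 2"
      using tendsto_ennrealI[OF L] tendsto_ennrealI[OF U] by simp_all
    show "eventually (\<lambda>n. ennreal (L n) \<le> ennreal (real n / real (p n)) * R n) sequentially"
      using bounds by eventually_elim (simp add: x_def)
    show "eventually (\<lambda>n. ennreal (real n / real (p n)) * R n \<le> ennreal (U n)) sequentially"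
      using bounds
    proof eventually_elim
      case (elim n)
      have "ennreal (1 / x n) * R n \<le> ennreal (U n)"
        by (rule order.trans[OF mult_left_mono[OF RT]]) (use elim in auto)
      then show ?case by (simp add: x_def)
    qed
  qed
  show "(\<lambda>n. T n / R n) \<longlonglongrightarrow> 1"
  proof (rule tendsto_sandwich[where f = "\<lambda>_. 1" and h = "\<lambda>n. ennreal (U n / L n)"])
    have "(\<lambda>n. U n / L n) \<longlonglongrightarrow> 1" using tendsto_divide[OF U L] by simp
    from tendsto_ennrealI[OF this] show "(\<lambda>n. ennreal (U n / L n)) \<longlonglongrightarrow> 1" by simp
    show "(\<lambda>n. 1 :: ennreal) \<longlonglongrightarrow> 1" by simp
    show "eventually (\<lambda>n. 1 \<le> T n / R n) sequentially"
      using bounds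
    proof eventually_elim
      case (elim n)
      have "ennreal (1 / x n) * R n \<le> ennreal (U n)"
        by (rule order.trans[OF mult_left_mono[OF RT]]) (use elim in auto)
      then have top: "R n \<noteq> \<top>" using elim by (auto simp: ennreal_mult_top top_unique)
      have "R n \<noteq> 0" using elim by auto
      then have "1 = R n / R n" using top by (simp add: ennreal_divide_self top.not_eq_extremum)
      also have "\<dots> \<le> T n / R n" by (intro divide_right_mono_ennreal RT)
      finally show ?case .
    qed
    show "eventually (\<lambda>n. T n / R n \<le> ennreal (U n / L n)) sequentially"
      using bounds
    proof eventually_elim
      case (elim n)
      let ?c = "ennreal (1 / x n)"
      have c: "?c \<noteq> 0" "?c \<noteq> \<top>" using elim by auto
      have "T n / R n = (T n * ?c) / (R n * ?c)"
        using c by (simp add: divide_mult_eq)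
      also have "\<dots> \<le> ennreal (U n / L n)"
      proof (rule divide_le_posI_ennreal)
        show "0 < R n * ?c"
          using elim by (metis ennreal_less_zero_iff mult.commute order.strict_trans2)
        have "T n * ?c \<le> ennreal (U n / L n * L n)" using elim by (simp add: mult.commute)
        also have "\<dots> = ennreal (U n / L n) * ennreal (L n)" using elim by (intro ennreal_mult'') auto
        also have "\<dots> \<le> ennreal (U n / L n) * (R n * ?c)"
          using elim by (intro mult_left_mono) (auto simp: mult.commute)
        finally show "T n * ?c \<le> R n * ?c * ennreal (U n / L n)" by (simp only: mult.commute)
      qed
      finally show ?case .
    qed
  qed
qed

section \<open>Product measures\<close>

lemma nn_integral_PiM_density:
  fixes f :: "'a \<Rightarrow> ennreal"
  assumes "finite K" and M: "sigma_finite_measure M" and fin: "sigma_finite_measure (density M f)"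
    and f[measurable]: "f \<in> borel_measurable M" and "g \<in> borel_measurable (PiM K (\<lambda>_. M))"
  shows "(\<integral>\<^sup>+x. g x \<partial>PiM K (\<lambda>_. density M f)) = (\<integral>\<^sup>+x. (\<Prod>k\<in>K. f (x k)) * g x \<partial>PiM K (\<lambda>_. M))"
  using assms(1,5)
proof (induction K arbitrary: g rule: finite_induct)
  case empty
  then show ?case by (simp add: PiM_empty nn_integral_count_space_finite)
next
  case (insert k K)
  note [simp] = \<open>finite K\<close> \<open>k \<notin> K\<close>
  note [measurable] = insert.prems
  interpret D: product_sigma_finite "\<lambda>_::'b. density M f" by (simp add: product_sigma_finite_def fin)
  interpret M: product_sigma_finite "\<lambda>_::'b. M" by (simp add: product_sigma_finite_def M)
  interpret MK: finite_product_sigma_finite "\<lambda>_::'b. M" K by standard simp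
  interpret MM: sigma_finite_measure M by (rule M)
  have sets[measurable_cong]: "sets (PiM J (\<lambda>_. density M f)) = sets (PiM J (\<lambda>_. M))" for J :: "'b set"
    by (intro sets_PiM_cong) auto
  have "(\<integral>\<^sup>+x. g x \<partial>PiM (insert k K) (\<lambda>_. density M f))
     = (\<integral>\<^sup>+x. \<integral>\<^sup>+y. g (x(k := y)) \<partial>density M f \<partial>PiM K (\<lambda>_. density M f))"
    by (intro D.product_nn_integral_insert) (simp_all add: measurable_cong_sets[OF sets refl])
  also have "\<dots> = (\<integral>\<^sup>+x. \<integral>\<^sup>+y. f y * g (x(k := y)) \<partial>M \<partial>PiM K (\<lambda>_. density M f))"
    by (intro nn_integral_cong nn_integral_density)
      (auto simp: space_PiM intro!: measurable_compose[OF measurable_component_update[of _ K "\<lambda>_. M"] insert.prems])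
  also have "\<dots> = (\<integral>\<^sup>+x. (\<Prod>k\<in>K. f (x k)) * (\<integral>\<^sup>+y. f y * g (x(k := y)) \<partial>M) \<partial>PiM K (\<lambda>_. M))"
    by (rule insert.IH) measurable
  also have "\<dots> = (\<integral>\<^sup>+x. (\<integral>\<^sup>+y. (\<Prod>j\<in>insert k K. f ((x(k := y)) j)) * g (x(k := y)) \<partial>M) \<partial>PiM K (\<lambda>_. M))"
  proof (intro nn_integral_cong)
    fix x assume x: "x \<in> space (PiM K (\<lambda>_. M))"
    have "(\<lambda>y. g (x(k := y))) \<in> borel_measurable M"
      by (rule measurable_compose[OF measurable_component_update[OF x] insert.prems]) simp
    moreover have "(\<Prod>j\<in>insert k K. f ((x(k := y)) j)) = (\<Prod>k\<in>K. f (x k)) * f y" for y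
    proof -
      have "(\<Prod>j\<in>K. f ((x(k := y)) j)) = (\<Prod>k\<in>K. f (x k))"
        by (intro prod.cong) auto
      then show ?thesis by (simp add: mult.commute)
    qed
    ultimately show "(\<Prod>k\<in>K. f (x k)) * (\<integral>\<^sup>+y. f y * g (x(k := y)) \<partial>M)
      = (\<integral>\<^sup>+y. (\<Prod>j\<in>insert k K. f ((x(k := y)) j)) * g (x(k := y)) \<partial>M)"
      by (simp add: nn_integral_cmult[symmetric] mult.assoc)
  qed
  also have "\<dots> = (\<integral>\<^sup>+x. (\<Prod>k\<in>insert k K. f (x k)) * g x \<partial>PiM (insert k K) (\<lambda>_. M))"
    by (intro M.product_nn_integral_insert[symmetric]) auto
  finally show ?case .
qed

text \<open>
Observations are stored as vectors, but the argument runs over coordinates. This splits off the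
coordinate \<open>q\<close> of all observations at once, as an inner integral over the row \<open>r\<close>. The proof is by
induction on the index set of the observations, with Tonelli's theorem moving the new coordinate
of the new observation inwards.
\<close>

lemma nn_integral_PiM_split_row:
  fixes f :: "('k \<Rightarrow> 'i \<Rightarrow> real) \<Rightarrow> ennreal"
  assumes "finite K" and I: "finite I" "q \<notin> I"
    and "f \<in> borel_measurable (PiM K (\<lambda>_. PiM (insert q I) (\<lambda>_. lborel)))"
  shows "(\<integral>\<^sup>+X. f X \<partial>PiM K (\<lambda>_. PiM (insert q I) (\<lambda>_. lborel)))
    = (\<integral>\<^sup>+X. \<integral>\<^sup>+r. f (\<lambda>k\<in>K. (X k)(q := r k)) \<partial>PiM K (\<lambda>_. lborel) \<partial>PiM K (\<lambda>_. PiM I (\<lambda>_. lborel)))"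
  using assms(1,4)
proof (induction K arbitrary: f rule: finite_induct)
  case empty
  then show ?case by (simp add: PiM_empty nn_integral_count_space_finite)
next
  case (insert k K)
  note [simp] = \<open>finite K\<close> \<open>k \<notin> K\<close>
  note f[measurable] = insert.prems
  let ?L = "\<lambda>J::'i set. PiM J (\<lambda>_. lborel :: real measure)"
  interpret L: product_sigma_finite "\<lambda>_::'i. lborel :: real measure"
    by (simp add: product_sigma_finite_def lborel.sigma_finite_measure_axioms)
  interpret LK: product_sigma_finite "\<lambda>_::'k. lborel :: real measure"
    by (simp add: product_sigma_finite_def lborel.sigma_finite_measure_axioms)
  interpret LI: finite_product_sigma_finite "\<lambda>_::'i. lborel :: real measure" I by standard (rule I)
  interpret LqI: finite_product_sigma_finite "\<lambda>_::'i. lborel :: real measure" "insert q I" by standard (simp add: I)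
  interpret MI: product_sigma_finite "\<lambda>_::'k. ?L I"
    by (simp add: product_sigma_finite_def LI.sigma_finite_measure_axioms)
  interpret MqI: product_sigma_finite "\<lambda>_::'k. ?L (insert q I)"
    by (simp add: product_sigma_finite_def LqI.sigma_finite_measure_axioms)
  interpret LKK: finite_product_sigma_finite "\<lambda>_::'k. lborel :: real measure" K by standard simp
  interpret MIK: finite_product_sigma_finite "\<lambda>_::'k. ?L I" K by standard simp
  have upd[measurable]: "(\<lambda>z. (u z)(q := v z)) \<in> measurable N (?L (insert q I))"
    if "u \<in> measurable N (?L I)" "v \<in> measurable N lborel" for N :: "'z measure" and u v
    using that by (intro measurable_fun_upd[where J = I]) auto
  have upd'[measurable]: "(\<lambda>z. (u z)(k := v z)) \<in> measurable N (PiM (insert k K) (\<lambda>_. Q))"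
    if "u \<in> measurable N (PiM K (\<lambda>_. Q))" "v \<in> measurable N Q"
    for N :: "'z measure" and Q :: "'q measure" and u v
    using that by (intro measurable_fun_upd[where J = K]) auto
  have split: "(\<integral>\<^sup>+x. h x \<partial>?L (insert q I)) = (\<integral>\<^sup>+y. \<integral>\<^sup>+a. h (y(q := a)) \<partial>lborel \<partial>?L I)"
    if "h \<in> borel_measurable (?L (insert q I))" for h
    by (rule L.product_nn_integral_insert[OF I that])
  have "(\<integral>\<^sup>+X. f X \<partial>PiM (insert k K) (\<lambda>_. ?L (insert q I)))
     = (\<integral>\<^sup>+X. \<integral>\<^sup>+x. f (X(k := x)) \<partial>?L (insert q I) \<partial>PiM K (\<lambda>_. ?L (insert q I)))"
    by (intro MqI.product_nn_integral_insert) (simp_all add: f)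
  also have "\<dots> = (\<integral>\<^sup>+X. \<integral>\<^sup>+y. \<integral>\<^sup>+a. f (X(k := y(q := a))) \<partial>lborel \<partial>?L I \<partial>PiM K (\<lambda>_. ?L (insert q I)))"
    by (intro nn_integral_cong split) measurable
  also have "\<dots> = (\<integral>\<^sup>+X. \<integral>\<^sup>+r. \<integral>\<^sup>+y. \<integral>\<^sup>+a. f ((\<lambda>k\<in>K. (X k)(q := r k))(k := y(q := a)))
      \<partial>lborel \<partial>?L I \<partial>PiM K (\<lambda>_. lborel) \<partial>PiM K (\<lambda>_. ?L I))"
    by (intro insert.IH) measurable
  also have "\<dots> = (\<integral>\<^sup>+X. \<integral>\<^sup>+y. \<integral>\<^sup>+r. \<integral>\<^sup>+a. f ((\<lambda>k\<in>K. (X k)(q := r k))(k := y(q := a)))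
      \<partial>lborel \<partial>PiM K (\<lambda>_. lborel) \<partial>?L I \<partial>PiM K (\<lambda>_. ?L I))"
  proof (intro nn_integral_cong)
    fix X assume [measurable]: "X \<in> space (PiM K (\<lambda>_. ?L I))"
    interpret pair_sigma_finite "PiM K (\<lambda>_. lborel :: real measure)" "?L I" ..
    have [measurable]: "(\<lambda>z. \<lambda>j\<in>K. (X j)(q := r z j)) \<in> measurable N (PiM K (\<lambda>_. ?L (insert q I)))"
      if [measurable]: "r \<in> measurable N (PiM K (\<lambda>_. lborel))" for N :: "'z measure" and r
    proof (intro measurable_restrict upd)
      fix j assume j: "j \<in> K"
      show "(\<lambda>z. X j) \<in> measurable N (?L I)"
        using \<open>X \<in> space _\<close> j by (intro measurable_const) (auto simp: space_PiM)
      show "(\<lambda>z. r z j) \<in> measurable N lborel" using j by measurable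
    qed
    show "(\<integral>\<^sup>+r. \<integral>\<^sup>+y. \<integral>\<^sup>+a. f ((\<lambda>k\<in>K. (X k)(q := r k))(k := y(q := a))) \<partial>lborel \<partial>?L I \<partial>PiM K (\<lambda>_. lborel))
      = (\<integral>\<^sup>+y. \<integral>\<^sup>+r. \<integral>\<^sup>+a. f ((\<lambda>k\<in>K. (X k)(q := r k))(k := y(q := a))) \<partial>lborel \<partial>PiM K (\<lambda>_. lborel) \<partial>?L I)"
      by (intro Fubini'[symmetric]) measurable
  qed
  also have "\<dots> = (\<integral>\<^sup>+X. \<integral>\<^sup>+y. \<integral>\<^sup>+r. f (\<lambda>j\<in>insert k K. ((X(k := y)) j)(q := r j))
      \<partial>PiM (insert k K) (\<lambda>_. lborel) \<partial>?L I \<partial>PiM K (\<lambda>_. ?L I))"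
  proof (intro nn_integral_cong)
    fix X y assume X: "X \<in> space (PiM K (\<lambda>_. ?L I))" and y: "y \<in> space (?L I)"
    have m: "(\<lambda>r. \<lambda>j\<in>insert k K. ((X(k := y)) j)(q := r j)) \<in>
        measurable (PiM (insert k K) (\<lambda>_. lborel)) (PiM (insert k K) (\<lambda>_. ?L (insert q I)))"
    proof (intro measurable_restrict upd)
      fix j assume j: "j \<in> insert k K"
      show "(\<lambda>r. (X(k := y)) j) \<in> measurable (PiM (insert k K) (\<lambda>_. lborel)) (?L I)"
        using X y j by (intro measurable_const) (auto simp: space_PiM)
      show "(\<lambda>r. r j) \<in> measurable (PiM (insert k K) (\<lambda>_. lborel :: real measure)) lborel" using j by measurable
    qed
    have "(\<integral>\<^sup>+r. f (\<lambda>j\<in>insert k K. ((X(k := y)) j)(q := r j)) \<partial>PiM (insert k K) (\<lambda>_. lborel))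
      = (\<integral>\<^sup>+r. \<integral>\<^sup>+a. f (\<lambda>j\<in>insert k K. ((X(k := y)) j)(q := (r(k := a)) j)) \<partial>lborel \<partial>PiM K (\<lambda>_. lborel))"
      by (intro LK.product_nn_integral_insert measurable_compose[OF m f]) simp_all
    moreover have "(\<lambda>j\<in>insert k K. ((X(k := y)) j)(q := (r(k := a)) j))
        = (\<lambda>k\<in>K. (X k)(q := r k))(k := y(q := a))" for r a
      by (auto simp: fun_eq_iff restrict_def)
    ultimately show "(\<integral>\<^sup>+r. \<integral>\<^sup>+a. f ((\<lambda>k\<in>K. (X k)(q := r k))(k := y(q := a))) \<partial>lborel \<partial>PiM K (\<lambda>_. lborel))
      = (\<integral>\<^sup>+r. f (\<lambda>j\<in>insert k K. ((X(k := y)) j)(q := r j)) \<partial>PiM (insert k K) (\<lambda>_. lborel))"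
      by simp
  qed
  also have "\<dots> = (\<integral>\<^sup>+X. \<integral>\<^sup>+r. f (\<lambda>j\<in>insert k K. (X j)(q := r j))
      \<partial>PiM (insert k K) (\<lambda>_. lborel) \<partial>PiM (insert k K) (\<lambda>_. ?L I))"
  proof (intro MI.product_nn_integral_insert[symmetric])
    interpret LkK: finite_product_sigma_finite "\<lambda>_::'k. lborel :: real measure" "insert k K" by standard simp
    show "(\<lambda>X. \<integral>\<^sup>+r. f (\<lambda>j\<in>insert k K. (X j)(q := r j)) \<partial>PiM (insert k K) (\<lambda>_. lborel))
       \<in> borel_measurable (PiM (insert k K) (\<lambda>_. ?L I))"
      by measurable
  qed auto
  finally show ?case .
qed

section \<open>Gram-Schmidt orthogonalisation\<close>

text \<open>
Gram-Schmidt for an arbitrary semi-inner product \<open>ip\<close>. It is used twice: with the dot product for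
the rows of the data, and with the form of \<open>\<Sigma>\<close> for a Cholesky factorisation. A vector that depends
on its predecessors has residual of length \<open>0\<close>, and \<open>x / 0 = 0\<close> turns its unit vector into a null
vector; orthogonality and the expansion below then remain true for dependent vectors.
\<close>

fun gs_unit :: "(('k \<Rightarrow> real) \<Rightarrow> ('k \<Rightarrow> real) \<Rightarrow> real) \<Rightarrow> (nat \<Rightarrow> 'k \<Rightarrow> real) \<Rightarrow> nat \<Rightarrow> 'k \<Rightarrow> real" where
  "gs_unit ip v i =
    (let w = (\<lambda>k. v i k - (\<Sum>j<i. ip (v i) (gs_unit ip v j) * gs_unit ip v j k))
     in (\<lambda>k. w k / sqrt (ip w w)))"

declare gs_unit.simps [simp del]

definition gs_resid :: "(('k \<Rightarrow> real) \<Rightarrow> ('k \<Rightarrow> real) \<Rightarrow> real) \<Rightarrow> (nat \<Rightarrow> 'k \<Rightarrow> real) \<Rightarrow> nat \<Rightarrow> 'k \<Rightarrow> real" where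
  "gs_resid ip v i k = v i k - (\<Sum>j<i. ip (v i) (gs_unit ip v j) * gs_unit ip v j k)"

text \<open>
The squared distance of \<open>v i\<close> from the span of its predecessors.
\<close>

definition gs_dist2 :: "(('k \<Rightarrow> real) \<Rightarrow> ('k \<Rightarrow> real) \<Rightarrow> real) \<Rightarrow> (nat \<Rightarrow> 'k \<Rightarrow> real) \<Rightarrow> nat \<Rightarrow> real" where
  "gs_dist2 ip v i = ip (gs_resid ip v i) (gs_resid ip v i)"

lemma gs_resid_0: "gs_resid ip v 0 = v 0"
  by (simp add: gs_resid_def[abs_def])

lemma gs_unit_eq: "gs_unit ip v i k = gs_resid ip v i k / sqrt (gs_dist2 ip v i)"
  by (simp add: gs_unit.simps[of ip v i] gs_resid_def[abs_def] gs_dist2_def Let_def)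

locale semi_inner_product =
  fixes ip :: "('k \<Rightarrow> real) \<Rightarrow> ('k \<Rightarrow> real) \<Rightarrow> real"
  assumes ip_sym: "ip x y = ip y x"
    and ip_lin: "ip (\<lambda>k. a * x k + b * y k) z = a * ip x z + b * ip y z"
    and ip_nonneg: "ip x x \<ge> 0"
    and ip_null: "ip x x = 0 \<Longrightarrow> ip x y = 0"
begin

lemma ip_zero: "ip (\<lambda>k. 0) z = 0"
  using ip_lin[of 0 "\<lambda>_. 0" 0 "\<lambda>_. 0" z] by simp

lemma ip_scale: "ip (\<lambda>k. x k / a) z = ip x z / a"
  using ip_lin[of "1 / a" x 0 "\<lambda>_. 0" z] by simp

lemma ip_diff: "ip (\<lambda>k. x k - y k) z = ip x z - ip y z"
  using ip_lin[of 1 x "- 1" y z] by simp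

lemma ip_sum: "finite J \<Longrightarrow> ip (\<lambda>k. \<Sum>j\<in>J. c j * u j k) z = (\<Sum>j\<in>J. c j * ip (u j) z)"
proof (induction J rule: finite_induct)
  case (insert j J)
  then show ?case
    using ip_lin[of "c j" "u j" 1 "\<lambda>k. \<Sum>j\<in>J. c j * u j k" z] by simp
qed (simp add: ip_zero)

abbreviation "U \<equiv> gs_unit ip"
abbreviation "D \<equiv> gs_dist2 ip"

lemma gs_dist2_nonneg: "D v i \<ge> 0"
  by (simp add: gs_dist2_def ip_nonneg)

lemma ip_resid: "ip (gs_resid ip v i) z = ip (v i) z - (\<Sum>j<i. ip (v i) (U v j) * ip (U v j) z)"
  unfolding gs_resid_def[abs_def] ip_diff by (subst ip_sum) simp_all

lemma ip_unit: "ip (U v i) z = ip (gs_resid ip v i) z / sqrt (D v i)"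
  unfolding gs_unit_eq[abs_def] by (rule ip_scale)

lemma ip_unit_null: "D v i = 0 \<Longrightarrow> ip (U v i) z = 0"
  by (simp add: ip_unit)

lemma ip_unit_self: "ip (U v i) (U v i) = (if D v i = 0 then 0 else 1)"
  using gs_dist2_nonneg[of v i]
  by (simp add: ip_unit ip_sym[of "gs_resid ip v i" "U v i"] gs_dist2_def[symmetric])

lemma ip_unit_orthogonal: "l < i \<Longrightarrow> ip (U v i) (U v l) = 0"
proof (induction i arbitrary: l rule: less_induct)
  case (less i)
  have orth: "ip (U v j) (U v l) = 0" if "j < i" "j \<noteq> l" for j
    using that less.IH[of j l] less.IH[of l j] less.prems
    by (cases "l < j") (auto simp: ip_sym[of "U v j" "U v l"])
  have "ip (gs_resid ip v i) (U v l) = ip (v i) (U v l) - ip (v i) (U v l) * ip (U v l) (U v l)"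
    unfolding ip_resid
    using less.prems orth by (subst sum.remove[of _ l]) (auto intro!: sum.neutral)
  also have "\<dots> = 0"
    by (auto simp: ip_unit_self ip_sym[of "v i"] ip_unit_null)
  finally show ?case by (simp add: ip_unit)
qed

lemma ip_unit_unit: "ip (U v i) (U v l) = (if i = l \<and> D v i \<noteq> 0 then 1 else 0)"
  using ip_unit_orthogonal[of i l v] ip_unit_orthogonal[of l i v] ip_unit_self[of v i]
  by (cases "i < l"; cases "l < i") (auto simp: ip_sym[of "U v i" "U v l"])

lemma ip_vec_unit: "ip (v i) (U v i) = sqrt (D v i)"
proof -
  have "ip (gs_resid ip v i) (U v i) = ip (v i) (U v i)"
    unfolding ip_resid by (auto simp: ip_unit_unit intro!: sum.neutral)
  then have "ip (v i) (U v i) = D v i / sqrt (D v i)"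
    by (simp add: ip_sym[of "gs_resid ip v i"] ip_unit gs_dist2_def[symmetric])
  then show ?thesis using gs_dist2_nonneg[of v i] by (simp add: real_div_sqrt)
qed

text \<open>
Each vector is the combination of the unit vectors up to its index. It is tested against an
arbitrary \<open>z\<close> because a semi-inner product cannot see null vectors.
\<close>

lemma gs_expansion: "ip (v i) z = (\<Sum>j\<le>i. ip (v i) (U v j) * ip (U v j) z)"
proof -
  have "ip (gs_resid ip v i) z = ip (v i) (U v i) * ip (U v i) z"
  proof (cases "D v i = 0")
    case True
    then show ?thesis using ip_null[of "gs_resid ip v i" z] by (simp add: gs_dist2_def ip_unit_null)
  next
    case False
    then show ?thesis using gs_dist2_nonneg[of v i] by (simp add: ip_vec_unit ip_unit)
  qed
  then show ?thesis unfolding ip_resid lessThan_Suc_atMost[symmetric] by simp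
qed

lemma ip_vec_unit_later: "i < j \<Longrightarrow> ip (v i) (U v j) = 0"
  by (subst gs_expansion) (auto simp: ip_unit_unit intro!: sum.neutral)

lemma gs_expansion_upto:
  assumes "i < n" shows "ip (v i) z = (\<Sum>j<n. ip (v i) (U v j) * ip (U v j) z)"
  unfolding gs_expansion[of v i z]
  using assms by (intro sum.mono_neutral_left) (auto simp: ip_vec_unit_later)

lemma gs_dist2_eq: "D v i = ip (v i) (v i) - (\<Sum>j<i. (ip (v i) (U v j))\<^sup>2)"
proof -
  have "ip (v i) (v i) = (\<Sum>j\<le>i. (ip (v i) (U v j))\<^sup>2)"
    unfolding gs_expansion[of v i "v i"] by (simp add: ip_sym[of _ "v i"] power2_eq_square)
  also have "\<dots> = (\<Sum>j<i. (ip (v i) (U v j))\<^sup>2) + D v i"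
    using gs_dist2_nonneg[of v i] by (simp add: lessThan_Suc_atMost[symmetric] ip_vec_unit)
  finally show ?thesis by simp
qed

end

definition dot :: "'k set \<Rightarrow> ('k \<Rightarrow> real) \<Rightarrow> ('k \<Rightarrow> real) \<Rightarrow> real" where
  "dot K x y = (\<Sum>k\<in>K. x k * y k)"

lemma semi_inner_product_dot: "finite K \<Longrightarrow> semi_inner_product (dot K)"
proof
  fix x y z :: "'a \<Rightarrow> real" and a b
  assume K: "finite K"
  show "dot K x y = dot K y x" by (simp add: dot_def mult.commute)
  show "dot K (\<lambda>k. a * x k + b * y k) z = a * dot K x z + b * dot K y z"
    by (simp add: dot_def distrib_right sum.distrib sum_distrib_left mult.assoc)
  show "dot K x x \<ge> 0" by (simp add: dot_def sum_nonneg)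
  show "dot K x y = 0" if "dot K x x = 0"
    using that K by (auto simp: dot_def sum_nonneg_eq_0_iff intro!: sum.neutral)
qed

lemma dot_cong:
  assumes "\<And>k. k \<in> K \<Longrightarrow> x k = x' k" "\<And>k. k \<in> K \<Longrightarrow> y k = y' k"
  shows "dot K x y = dot K x' y'"
  by (simp add: dot_def assms)

lemma gs_cong:
  assumes "\<And>j k. j \<le> i \<Longrightarrow> k \<in> K \<Longrightarrow> v j k = v' j k"
  shows "k \<in> K \<Longrightarrow> gs_unit (dot K) v i k = gs_unit (dot K) v' i k"
    and "gs_dist2 (dot K) v i = gs_dist2 (dot K) v' i"
proof -
  have *: "(\<forall>k\<in>K. gs_unit (dot K) v i k = gs_unit (dot K) v' i k) \<and>
      gs_dist2 (dot K) v i = gs_dist2 (dot K) v' i"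
    using assms
  proof (induction i rule: less_induct)
    case (less i)
    have u: "gs_unit (dot K) v j k = gs_unit (dot K) v' j k" if "j < i" "k \<in> K" for j k
      using less.IH[OF that(1)] less.prems that by auto
    have d: "dot K (v i) (gs_unit (dot K) v j) = dot K (v' i) (gs_unit (dot K) v' j)" if "j < i" for j
      using u[OF that] less.prems[OF order_refl] by (rule dot_cong[rotated])
    have r: "gs_resid (dot K) v i k = gs_resid (dot K) v' i k" if "k \<in> K" for k
    proof -
      have "(\<Sum>j<i. dot K (v i) (gs_unit (dot K) v j) * gs_unit (dot K) v j k)
          = (\<Sum>j<i. dot K (v' i) (gs_unit (dot K) v' j) * gs_unit (dot K) v' j k)"
        using that by (intro sum.cong refl) (simp add: u d)
      then show ?thesis unfolding gs_resid_def less.prems[OF order_refl that] by simp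
    qed
    have "gs_dist2 (dot K) v i = gs_dist2 (dot K) v' i"
      unfolding gs_dist2_def by (rule dot_cong; rule r)
    with r show ?case by (auto simp: gs_unit_eq)
  qed
  show "k \<in> K \<Longrightarrow> gs_unit (dot K) v i k = gs_unit (dot K) v' i k"
    and "gs_dist2 (dot K) v i = gs_dist2 (dot K) v' i"
    using * by auto
qed

lemma dot_point: "finite K \<Longrightarrow> k \<in> K \<Longrightarrow> dot K x (\<lambda>l. if l = k then 1 else 0) = x k"
  by (simp add: dot_def sum.delta if_distrib cong: if_cong)

text \<open>
The indicator of the point \<open>k\<close> as test vector turns the expansion into an equation at \<open>k\<close>.
\<close>

lemma gs_expansion_pointwise:
  assumes "finite K" "k \<in> K" "i < n"
  shows "v i k = (\<Sum>j<n. dot K (v i) (gs_unit (dot K) v j) * gs_unit (dot K) v j k)"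
  using semi_inner_product.gs_expansion_upto[OF semi_inner_product_dot[OF assms(1)] assms(3),
      of v "\<lambda>l. if l = k then 1 else 0"] assms
  by (simp add: dot_point)

section \<open>The sample covariance and the Gaussian density\<close>

text \<open>
The all-ones vector comes before the coordinates of the data, so that orthogonalisation against it
is the same as centring at the sample mean.
\<close>

definition data_rows :: "('k \<Rightarrow> nat \<Rightarrow> real) \<Rightarrow> nat \<Rightarrow> 'k \<Rightarrow> real" where
  "data_rows X i k = (case i of 0 \<Rightarrow> 1 | Suc i \<Rightarrow> X k i)"

lemma data_rows_simps [simp]: "data_rows X 0 k = 1" "data_rows X (Suc i) k = X k i"
  by (simp_all add: data_rows_def)

text \<open>
The centred rows are the expansions of the rows without their component along the all-ones vector.
So \<open>n\<close> times the sample covariance is \<open>A A\<^sup>T\<close> for the lower triangular matrix \<open>A\<close> of the other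
coefficients, whose diagonal entries are the Gram-Schmidt distances.
\<close>

lemma det_sample_cov:
  fixes X :: "nat \<Rightarrow> nat \<Rightarrow> real"
  assumes n: "n \<ge> 1"
  shows "Determinant.det (sample_cov n p X)
    = (\<Prod>i<p. gs_dist2 (dot {1..n+1}) (data_rows X) (Suc i) / real n)"
proof -
  define K where "K = {1..n+1}"
  define N where "N = real (n + 1)"
  have K: "finite K" "real (card K) = N" and N: "N > 0" by (simp_all add: K_def N_def)
  let ?v = "data_rows X"
  interpret semi_inner_product "dot K" by (rule semi_inner_product_dot[OF K(1)])
  define u where "u = gs_unit (dot K) ?v"
  define A where "A = Matrix.mat p p (\<lambda>(i, j). dot K (?v (Suc i)) (u (Suc j)))"
  have A: "A \<in> carrier_mat p p" by (simp add: A_def)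
  have u0: "u 0 k = 1 / sqrt N" for k
    by (simp add: u_def gs_unit_eq gs_resid_0 gs_dist2_def dot_def K)
  have s: "(\<Sum>k\<in>K. X k i) = N * sample_mean n X i" for i
    using N by (simp add: sample_mean_def K_def N_def del: sum.cl_ivl_Suc)
  (* The component along the first unit vector is the multiple that represents the mean. *)
  have u0': "dot K (?v (Suc i)) (u 0) = sqrt N * sample_mean n X i" for i
  proof -
    have "dot K (?v (Suc i)) (u 0) = (\<Sum>k\<in>K. X k i) / sqrt N"
      unfolding dot_def u0 by (simp add: sum_divide_distrib)
    also have "\<dots> = N / sqrt N * sample_mean n X i"
      by (simp add: s)
    finally show ?thesis using N by (simp add: real_div_sqrt)
  qed
  have entry: "sample_cov n p X $$ (i, l) = (1 / real n) * (\<Sum>j<p. A $$ (i, j) * A $$ (l, j))"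
    if "i < p" "l < p" for i l
  proof -
    have "(\<Sum>k\<in>K. (X k i - a) * (X k l - b))
       = (\<Sum>k\<in>K. X k i * X k l) - a * (\<Sum>k\<in>K. X k l) - b * (\<Sum>k\<in>K. X k i)
         + N * (a * b)" for a b
    proof -
      have "(\<Sum>k\<in>K. (X k i - a) * (X k l - b))
          = (\<Sum>k\<in>K. X k i * X k l - a * X k l - b * X k i + a * b)"
        by (intro sum.cong refl) (simp add: algebra_simps)
      then show ?thesis by (simp add: sum.distrib sum_subtractf sum_distrib_left K)
    qed
    then have "(\<Sum>k\<in>K. (X k i - sample_mean n X i) * (X k l - sample_mean n X l))
       = (\<Sum>k\<in>K. X k i * X k l) - sample_mean n X i * (\<Sum>k\<in>K. X k l)
         - sample_mean n X l * (\<Sum>k\<in>K. X k i) + N * (sample_mean n X i * sample_mean n X l)"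
      by blast
    also have "\<dots> = dot K (?v (Suc i)) (?v (Suc l)) - N * sample_mean n X i * sample_mean n X l"
      unfolding s by (simp add: dot_def algebra_simps)
    also have "dot K (?v (Suc i)) (?v (Suc l))
       = (\<Sum>j<Suc p. dot K (?v (Suc i)) (u j) * dot K (?v (Suc l)) (u j))"
      using gs_expansion_upto[of "Suc i" "Suc p" ?v "?v (Suc l)"] that(1)
      by (simp add: u_def ip_sym[of "gs_unit _ _ _"])
    also have "\<dots> = N * sample_mean n X i * sample_mean n X l
       + (\<Sum>j<p. A $$ (i, j) * A $$ (l, j))"
      using that by (subst sum.lessThan_Suc_shift) (simp add: u0' A_def abs_of_pos[OF N])
    finally show ?thesis using that by (simp add: sample_cov_def K_def del: sum.cl_ivl_Suc)
  qed
  have "sample_cov n p X = (1 / real n) \<cdot>\<^sub>m (A * A\<^sup>T)"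
  proof (rule eq_matI)
    fix i l assume "i < dim_row ((1 / real n) \<cdot>\<^sub>m (A * A\<^sup>T))" "l < dim_col ((1 / real n) \<cdot>\<^sub>m (A * A\<^sup>T))"
    then have il: "i < p" "l < p" using A by auto
    then show "sample_cov n p X $$ (i, l) = ((1 / real n) \<cdot>\<^sub>m (A * A\<^sup>T)) $$ (i, l)"
      unfolding entry[OF il] using A
      by (simp add: scalar_prod_def atLeast0LessThan)
  qed (use A in \<open>auto simp: sample_cov_def\<close>)
  then have "Determinant.det (sample_cov n p X) = (1 / real n) ^ p * (Determinant.det A)\<^sup>2"
    using A by (simp add: det_smult det_mult[OF A] det_transpose[OF A] power2_eq_square)
  also have "Determinant.det A = (\<Prod>i<p. sqrt (gs_dist2 (dot K) ?v (Suc i)))"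
  proof -
    have "Determinant.det A = prod_list (diag_mat A)"
      using A by (rule det_lower_triangular[rotated]) (simp add: A_def u_def ip_vec_unit_later)
    also have "\<dots> = (\<Prod>i<p. A $$ (i, i))"
      using A by (simp add: prod_list_diag_prod atLeast0LessThan)
    also have "\<dots> = (\<Prod>i<p. sqrt (gs_dist2 (dot K) ?v (Suc i)))"
      by (intro prod.cong) (auto simp: A_def u_def ip_vec_unit)
    finally show ?thesis .
  qed
  finally show ?thesis
    unfolding K_def[symmetric] using gs_dist2_nonneg[of ?v]
    by (simp add: prod_power_distrib prod_dividef power_divide)
qed

lemma scalar_prod_mult_mat_vec:
  assumes "A \<in> carrier_mat p p"
  shows "scalar_prod (Matrix.vec p x) (A *\<^sub>v Matrix.vec p y) = (\<Sum>i<p. \<Sum>j<p. x i * A $$ (i, j) * y j)"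
  using assms by (simp add: scalar_prod_def atLeast0LessThan sum_distrib_left mult.assoc)

lemma mat_inverse_eqI:
  fixes A :: "real mat"
  assumes A: "A \<in> carrier_mat p p" and B: "B \<in> carrier_mat p p" and AB: "A * B = 1\<^sub>m p"
  shows "mat_inverse A = Some B"
proof -
  have BA: "B * A = 1\<^sub>m p" by (rule mat_mult_left_right_inverse[OF A B AB])
  have "A \<in> Units (ring_mat TYPE(real) p undefined)"
    using A B AB BA by (auto simp: Units_def ring_mat_simps)
  then obtain C where C: "mat_inverse A = Some C"
    using mat_inverse(1)[OF A] by fastforce
  from mat_inverse(2)[OF A C] have CA: "C * A = 1\<^sub>m p" and Cc: "C \<in> carrier_mat p p" by auto
  have "C = C * (A * B)" using AB Cc by simp
  also have "\<dots> = (C * A) * B" using Cc A B by (simp add: assoc_mult_mat)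
  also have "\<dots> = B" using CA B by simp
  finally show ?thesis using C by simp
qed

definition mat_form :: "nat \<Rightarrow> real mat \<Rightarrow> (nat \<Rightarrow> real) \<Rightarrow> (nat \<Rightarrow> real) \<Rightarrow> real" where
  "mat_form p A x y = (\<Sum>i<p. \<Sum>j<p. x i * A $$ (i, j) * y j)"

lemma mat_form_pos:
  assumes "A \<in> pos_def_mats p" and "i < p" "x i \<noteq> 0"
  shows "mat_form p A x x > 0"
proof -
  have "Matrix.vec p x \<noteq> 0\<^sub>v p"
    using assms(2,3) by (metis index_vec index_zero_vec(1))
  then show ?thesis
    using assms(1) unfolding pos_def_mats_def mat_form_def
    by (auto simp: scalar_prod_mult_mat_vec[symmetric])
qed

lemma semi_inner_product_mat_form:
  assumes A: "A \<in> pos_def_mats p"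
  shows "semi_inner_product (mat_form p A)"
proof
  fix x y z :: "nat \<Rightarrow> real" and a b
  have sym: "A $$ (i, j) = A $$ (j, i)" if "i < p" "j < p" for i j
  proof -
    have "A\<^sup>T $$ (i, j) = A $$ (j, i)" using A that by (intro index_transpose_mat) (auto simp: pos_def_mats_def)
    then show ?thesis using A by (simp add: pos_def_mats_def)
  qed
  show "mat_form p A x y = mat_form p A y x"
    unfolding mat_form_def by (subst sum.swap) (auto simp: sym mult_ac intro!: sum.cong)
  show "mat_form p A (\<lambda>k. a * x k + b * y k) z = a * mat_form p A x z + b * mat_form p A y z"
    by (simp add: mat_form_def distrib_right sum.distrib sum_distrib_left mult.assoc)
  have zero: "mat_form p A x y = 0" if "\<And>i. i < p \<Longrightarrow> x i = 0" for y
    using that by (simp add: mat_form_def)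
  show "mat_form p A x x \<ge> 0"
    using mat_form_pos[OF A, of _ x] zero[of x] by (metis less_eq_real_def)
  show "mat_form p A x y = 0" if "mat_form p A x x = 0"
    using mat_form_pos[OF A, of _ x] zero[of y] that by (metis less_irrefl)
qed

lemma sqrt_prod: "sqrt (\<Prod>i\<in>I. f i) = (\<Prod>i\<in>I. sqrt (f i))"
  by (induction I rule: infinite_finite_induct) (auto simp: real_sqrt_mult)

text \<open>
Sequential (Cholesky) factorisation of a Gaussian density: each coordinate is normal given the
earlier ones, with a mean that is affine in them. Orthonormalising the standard basis \<open>e\<close> with
respect to the form of \<open>\<Sigma>\<close> gives a lower triangular matrix \<open>W\<close> with \<open>W \<Sigma> W\<^sup>T = 1\<close>, hence
\<open>\<Sigma>\<^sup>-\<^sup>1 = W\<^sup>T W\<close>, and the quadratic form in the exponent becomes the sum of the squares of the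
entries of \<open>W (x - \<mu>)\<close>.
\<close>

lemma mvn_density_sequential:
  assumes S: "\<Sigma> \<in> pos_def_mats p" and \<mu>: "\<mu> \<in> carrier_vec p"
  shows "\<exists>\<beta> \<sigma>. (\<forall>i<p. \<sigma> i > 0) \<and> Determinant.det \<Sigma> = (\<Prod>i<p. (\<sigma> i)\<^sup>2) \<and>
    (\<forall>x. mvn_density p \<mu> \<Sigma> (Matrix.vec p x)
       = (\<Prod>i<p. normal_density (\<mu> $ i + (\<Sum>j<i. \<beta> i j * (x j - \<mu> $ j))) (\<sigma> i) (x i)))"
proof -
  interpret semi_inner_product "mat_form p \<Sigma>" by (rule semi_inner_product_mat_form[OF S])
  have Sc: "\<Sigma> \<in> carrier_mat p p" using S by (simp add: pos_def_mats_def)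
  define e :: "nat \<Rightarrow> nat \<Rightarrow> real" where "e i k = (if k = i then 1 else 0)" for i k
  define u where "u = gs_unit (mat_form p \<Sigma>) e"
  define \<sigma> where "\<sigma> i = sqrt (gs_dist2 (mat_form p \<Sigma>) e i)" for i
  have u_eq: "u i k = gs_resid (mat_form p \<Sigma>) e i k / \<sigma> i" for i k
    by (simp add: u_def \<sigma>_def gs_unit_eq)
  have u_upper: "u i k = 0" if "i < k" for i k
    using that
  proof (induction i rule: less_induct)
    case (less i)
    have "gs_resid (mat_form p \<Sigma>) e i k = 0"
      using less by (auto simp: gs_resid_def e_def u_def[symmetric] intro!: sum.neutral)
    then show ?case by (simp add: u_eq)
  qed
  have resid: "gs_resid (mat_form p \<Sigma>) e i i = 1" for i
    by (auto simp: gs_resid_def e_def u_def[symmetric] u_upper intro!: sum.neutral)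
  have D: "gs_dist2 (mat_form p \<Sigma>) e i > 0" if "i < p" for i
    unfolding gs_dist2_def using that resid by (intro mat_form_pos[OF S that]) simp
  then have \<sigma>: "\<sigma> i > 0" if "i < p" for i using that by (simp add: \<sigma>_def)
  have u_diag: "u i i = 1 / \<sigma> i" for i by (simp add: u_eq resid)
  define W where "W = Matrix.mat p p (\<lambda>(i, j). u i j)"
  have W: "W \<in> carrier_mat p p" by (simp add: W_def)
  have WSW: "W * (\<Sigma> * W\<^sup>T) = 1\<^sub>m p"
  proof (rule eq_matI)
    fix i l assume "i < dim_row (1\<^sub>m p :: real mat)" "l < dim_col (1\<^sub>m p :: real mat)"
    then have il: "i < p" "l < p" by auto
    have "(W * (\<Sigma> * W\<^sup>T)) $$ (i, l) = (\<Sum>a<p. \<Sum>b<p. u i a * \<Sigma> $$ (a, b) * u l b)"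
      using il W Sc by (simp add: W_def scalar_prod_def atLeast0LessThan sum_distrib_left mult.assoc)
    also have "\<dots> = mat_form p \<Sigma> (u i) (u l)" by (simp add: mat_form_def)
    also have "\<dots> = (if i = l then 1 else 0)" using D[OF il(1)] by (auto simp: u_def ip_unit_unit)
    finally show "(W * (\<Sigma> * W\<^sup>T)) $$ (i, l) = (1\<^sub>m p) $$ (i, l)" using il by simp
  qed (use W Sc in auto)
  have "(\<Sigma> * W\<^sup>T) * W = 1\<^sub>m p"
    by (rule mat_mult_left_right_inverse[OF W _ WSW]) (use W Sc in auto)
  then have inv: "mat_inverse \<Sigma> = Some (W\<^sup>T * W)"
    using W Sc by (intro mat_inverse_eqI) (auto simp: assoc_mult_mat[of _ p p _ p _ p])
  have detW: "Determinant.det W = (\<Prod>i<p. 1 / \<sigma> i)"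
  proof -
    have "Determinant.det W = prod_list (diag_mat W)"
      using W by (rule det_lower_triangular[rotated]) (simp add: W_def u_upper)
    also have "\<dots> = (\<Prod>i<p. W $$ (i, i))"
      using W by (simp add: prod_list_diag_prod atLeast0LessThan)
    finally show ?thesis by (simp add: W_def u_diag)
  qed
  have \<sigma>prod: "(\<Prod>i<p. \<sigma> i) > 0" using \<sigma> by (intro prod_pos) auto
  have detS: "Determinant.det \<Sigma> = (\<Prod>i<p. (\<sigma> i)\<^sup>2)"
  proof -
    have "Determinant.det W * (Determinant.det \<Sigma> * Determinant.det W) = 1"
      using arg_cong[OF WSW, of Determinant.det] W Sc
      by (simp add: det_mult[of _ p] det_transpose[OF W])
    then show ?thesis using \<sigma>prod unfolding detW
      by (simp add: prod_dividef prod.distrib field_simps power2_eq_square)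
  qed
  have dens: "mvn_density p \<mu> \<Sigma> (Matrix.vec p x)
       = (\<Prod>i<p. normal_density (\<mu> $ i + (\<Sum>j<i. - \<sigma> i * u i j * (x j - \<mu> $ j))) (\<sigma> i) (x i))" for x
  proof -
    define y where "y i = x i - \<mu> $ i" for i
    have xy: "Matrix.vec p x - \<mu> = Matrix.vec p y"
      using \<mu> by (intro eq_vecI) (auto simp: y_def)
    (* Entry i of W (x - mu) is the standardised deviation of x i from its conditional mean. *)
    have z: "(\<Sum>j<p. u i j * y j) = (x i - (\<mu> $ i + (\<Sum>j<i. - \<sigma> i * u i j * (x j - \<mu> $ j)))) / \<sigma> i"
      if "i < p" for i
    proof -
      have "(\<Sum>j<p. u i j * y j) = (\<Sum>j<Suc i. u i j * y j)"
        using that by (intro sum.mono_neutral_right) (auto simp: u_upper)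
      also have "\<dots> = (\<Sum>j<i. u i j * y j) + y i / \<sigma> i" by (simp add: u_diag)
      also have "(\<Sum>j<i. u i j * y j) = - (\<Sum>j<i. - \<sigma> i * u i j * y j) / \<sigma> i"
        using \<sigma>[OF that] by (simp add: sum_negf sum_divide_distrib)
      finally show ?thesis by (simp add: y_def diff_divide_distrib add_divide_distrib)
    qed
    have "scalar_prod (Matrix.vec p y) ((W\<^sup>T * W) *\<^sub>v Matrix.vec p y)
       = scalar_prod (W *\<^sub>v Matrix.vec p y) (W *\<^sub>v Matrix.vec p y)"
    proof -
      have "(W\<^sup>T * W) *\<^sub>v Matrix.vec p y = W\<^sup>T *\<^sub>v (W *\<^sub>v Matrix.vec p y)"
        using W by (intro assoc_mult_mat_vec) auto
      moreover have "scalar_prod (Matrix.vec p y) (W\<^sup>T *\<^sub>v (W *\<^sub>v Matrix.vec p y))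
          = scalar_prod (W *\<^sub>v Matrix.vec p y) (W *\<^sub>v Matrix.vec p y)"
        using W transpose_vec_mult_scalar[of "W\<^sup>T" p p "W *\<^sub>v Matrix.vec p y" "Matrix.vec p y"]
        by (auto simp: comm_scalar_prod[of _ p])
      ultimately show ?thesis by simp
    qed
    also have "\<dots> = (\<Sum>i<p. (\<Sum>j<p. u i j * y j)\<^sup>2)"
      using W by (simp add: W_def scalar_prod_def atLeast0LessThan power2_eq_square)
    finally have quad: "scalar_prod (Matrix.vec p x - \<mu>) (the (mat_inverse \<Sigma>) *\<^sub>v (Matrix.vec p x - \<mu>))
        = (\<Sum>i<p. (\<Sum>j<p. u i j * y j)\<^sup>2)"
      unfolding xy inv by simp
    have norm: "sqrt ((2 * pi) ^ p * Determinant.det \<Sigma>) = (\<Prod>i<p. sqrt (2 * pi * (\<sigma> i)\<^sup>2))"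
      unfolding detS sqrt_prod[symmetric] by (simp add: prod.distrib)
    show ?thesis
      unfolding mvn_density_def quad norm
      by (auto simp: sum_divide_distrib sum_negf[symmetric] exp_sum prod_dividef[symmetric]
          normal_density_def z power_divide intro!: prod.cong)
  qed
  show ?thesis
    by (rule exI[of _ "\<lambda>i j. - \<sigma> i * u i j"], rule exI[of _ \<sigma>]) (use \<sigma> detS dens in simp)
qed

section \<open>The distance of a Gaussian row from a subspace\<close>

interpretation product_sigma_finite_lborel: product_sigma_finite "\<lambda>_. lborel :: real measure"
  by (simp add: product_sigma_finite_def lborel.sigma_finite_measure_axioms)

lemma sigma_finite_PiM_lborel:
  "finite I \<Longrightarrow> sigma_finite_measure (PiM I (\<lambda>_. lborel :: real measure))"
  by (rule product_sigma_finite_lborel.sigma_finite)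

lemma ennreal_mult_prod:
  assumes "A \<ge> 0" "\<And>i. i \<in> I \<Longrightarrow> f i \<ge> 0"
  shows "ennreal (A * (\<Prod>i\<in>I. f i)) = ennreal A * (\<Prod>i\<in>I. ennreal (f i))"
  using assms by (simp add: prod_ennreal ennreal_mult prod_nonneg)

lemma nn_integral_tilted_normal:
  assumes \<sigma>: "\<sigma> > 0" and t: "t \<ge> 0"
  shows "(\<integral>\<^sup>+x. ennreal (normal_density m \<sigma> x * exp (- t * (x - m)\<^sup>2 + b * (x - m))) \<partial>lborel)
    = ennreal (1 / sqrt (1 + 2 * t * \<sigma>\<^sup>2) * exp (b\<^sup>2 * \<sigma>\<^sup>2 / (2 * (1 + 2 * t * \<sigma>\<^sup>2))))"
proof -
  define c where "c = 1 + 2 * t * \<sigma>\<^sup>2"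
  have c: "c > 0" using t by (simp add: c_def add_pos_nonneg)
  have cs: "c / \<sigma>\<^sup>2 > 0" using c \<sigma> by simp
  have "(\<integral>\<^sup>+x. ennreal (normal_density m \<sigma> x * exp (- t * (x - m)\<^sup>2 + b * (x - m))) \<partial>lborel)
    = (\<integral>\<^sup>+y. ennreal (normal_density m \<sigma> (m + 1 * y) * exp (- t * (m + 1 * y - m)\<^sup>2 + b * (m + 1 * y - m))) \<partial>lborel)"
    by (subst nn_integral_real_affine[where c = 1 and t = m]) auto
  also have "\<dots> = (\<integral>\<^sup>+y. ennreal (1 / sqrt (2 * pi * \<sigma>\<^sup>2)) * ennreal (exp (- (c / \<sigma>\<^sup>2) * y\<^sup>2 / 2 + b * y)) \<partial>lborel)"
  proof (intro nn_integral_cong)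
    fix y :: real
    have "- (y\<^sup>2 / (2 * \<sigma>\<^sup>2)) + (- t * y\<^sup>2 + b * y) = - (c / \<sigma>\<^sup>2) * y\<^sup>2 / 2 + b * y"
      using \<sigma> by (simp add: c_def field_simps)
    then have "exp (- (y\<^sup>2 / (2 * \<sigma>\<^sup>2))) * exp (- t * y\<^sup>2 + b * y) = exp (- (c / \<sigma>\<^sup>2) * y\<^sup>2 / 2 + b * y)"
      by (simp only: exp_add[symmetric])
    then show "ennreal (normal_density m \<sigma> (m + 1 * y) * exp (- t * (m + 1 * y - m)\<^sup>2 + b * (m + 1 * y - m)))
      = ennreal (1 / sqrt (2 * pi * \<sigma>\<^sup>2)) * ennreal (exp (- (c / \<sigma>\<^sup>2) * y\<^sup>2 / 2 + b * y))"
      by (subst ennreal_mult[symmetric]) (auto simp: normal_density_def)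
  qed
  also have "\<dots> = ennreal (1 / sqrt (2 * pi * \<sigma>\<^sup>2))
      * ennreal (sqrt (2 * pi / (c / \<sigma>\<^sup>2)) * exp (b\<^sup>2 / (2 * (c / \<sigma>\<^sup>2))))"
    by (simp only: nn_integral_exp_quadratic[OF cs, symmetric]) (rule nn_integral_cmult, measurable)
  also have "\<dots> = ennreal (1 / sqrt (2 * pi * \<sigma>\<^sup>2)
      * (sqrt (2 * pi / (c / \<sigma>\<^sup>2)) * exp (b\<^sup>2 / (2 * (c / \<sigma>\<^sup>2)))))"
    using c by (intro ennreal_mult[symmetric]) auto
  also have "1 / sqrt (2 * pi * \<sigma>\<^sup>2) * (sqrt (2 * pi / (c / \<sigma>\<^sup>2)) * exp (b\<^sup>2 / (2 * (c / \<sigma>\<^sup>2))))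
      = 1 / sqrt c * exp (b\<^sup>2 * \<sigma>\<^sup>2 / (2 * c))"
    using \<sigma> c by (simp add: real_sqrt_mult real_sqrt_divide field_simps)
  finally show ?thesis by (simp add: c_def)
qed

text \<open>
The squared distance of a Gaussian vector from a \<open>d\<close>-dimensional subspace containing its mean has
the Laplace transform of \<open>\<sigma>\<^sup>2\<close> times a chi-squared variable with \<open>card K - d\<close> degrees of freedom.
Instead of a rotation of the space the proof uses a linearisation: the identity
\<open>exp (t w\<^sup>2) = E exp (\<surd>(2t) w z)\<close> for a standard normal \<open>z\<close>, applied to the \<open>d\<close> squares that are
subtracted, makes the exponent linear in their dot products. Then the integral over the entries of
\<open>r\<close> is a product of one-dimensional integrals, and orthonormality of the \<open>u j\<close> makes the remaining
integral over the auxiliary variables a product too.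
\<close>

lemma normal_row_laplace:
  fixes u :: "nat \<Rightarrow> 'k \<Rightarrow> real"
  assumes K: "finite K" and d: "d \<le> card K" and \<sigma>: "\<sigma> > 0" and t: "t \<ge> 0"
    and orth: "\<And>i j. i < d \<Longrightarrow> j < d \<Longrightarrow> dot K (u i) (u j) = (if i = j then 1 else 0)"
    and m: "\<And>k. k \<in> K \<Longrightarrow> m k = (\<Sum>j<d. a j * u j k)"
  shows "(\<integral>\<^sup>+r. ennreal ((\<Prod>k\<in>K. normal_density (m k) \<sigma> (r k))
      * exp (- t * (dot K r r - (\<Sum>j<d. (dot K r (u j))\<^sup>2)))) \<partial>PiM K (\<lambda>_. lborel))
    = ennreal ((1 + 2 * t * \<sigma>\<^sup>2) powr (- real (card K - d) / 2))"
proof -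
  define c where "c = 1 + 2 * t * \<sigma>\<^sup>2"
  have c: "c \<ge> 1" using t by (simp add: c_def)
  define q where "q = sqrt (2 * t)"
  have q: "q\<^sup>2 = 2 * t" using t by (simp add: q_def)
  define y where "y r k = r k - m k" for r :: "'k \<Rightarrow> real" and k
  have one_pos: "(1::real) > 0" by simp
  define \<phi> :: "real \<Rightarrow> real" where "\<phi> z = exp (- z\<^sup>2 / 2) / sqrt (2 * pi)" for z
  have \<phi>_nonneg: "\<phi> z \<ge> 0" for z by (simp add: \<phi>_def)
  let ?PK = "PiM K (\<lambda>_. lborel :: real measure)"
  let ?PD = "PiM {..<d} (\<lambda>_. lborel :: real measure)"
  (* The mean lies in the span, so the distance is unchanged when it is subtracted. *)
  have dist: "dot K r r - (\<Sum>j<d. (dot K r (u j))\<^sup>2)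
      = dot K (y r) (y r) - (\<Sum>j<d. (dot K (y r) (u j))\<^sup>2)" for r
  proof -
    interpret semi_inner_product "dot K" by (rule semi_inner_product_dot[OF K])
    define s where "s k = (\<Sum>j<d. a j * u j k)" for k
    have sz: "dot K s z = (\<Sum>j<d. a j * dot K (u j) z)" for z
      unfolding s_def by (rule ip_sum) simp
    have su: "dot K s (u j) = a j" if "j < d" for j
      unfolding sz using that by (subst sum.remove[of _ j]) (auto simp: orth intro!: sum.neutral)
    have ss: "dot K s s = (\<Sum>j<d. (a j)\<^sup>2)"
      unfolding sz[of s] by (intro sum.cong refl) (simp add: ip_sym[of "u _" s] su power2_eq_square)
    have yr: "dot K (y r) z = dot K r z - dot K s z" for z
    proof -
      have "dot K (y r) z = dot K (\<lambda>k. r k - s k) z"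
        by (rule dot_cong) (simp_all add: y_def s_def m)
      then show ?thesis by (simp add: ip_diff)
    qed
    have "dot K (y r) (y r) = dot K (y r) r - dot K (y r) s"
      unfolding yr[of "y r"] using ip_sym[of r "y r"] ip_sym[of s "y r"] by simp
    also have "\<dots> = dot K r r - 2 * dot K s r + dot K s s"
      unfolding yr using ip_sym[of r s] by simp
    also have "dot K s r = (\<Sum>j<d. a j * dot K r (u j))"
      unfolding sz by (simp add: ip_sym[of "u _" r])
    finally have 1: "dot K (y r) (y r) = dot K r r - 2 * (\<Sum>j<d. a j * dot K r (u j)) + (\<Sum>j<d. (a j)\<^sup>2)"
      by (simp add: ss)
    have 2: "(\<Sum>j<d. (dot K (y r) (u j))\<^sup>2)
        = (\<Sum>j<d. (dot K r (u j))\<^sup>2) - 2 * (\<Sum>j<d. a j * dot K r (u j)) + (\<Sum>j<d. (a j)\<^sup>2)"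
    proof -
      have "(\<Sum>j<d. (dot K (y r) (u j))\<^sup>2)
          = (\<Sum>j<d. (dot K r (u j))\<^sup>2 - 2 * (a j * dot K r (u j)) + (a j)\<^sup>2)"
        by (intro sum.cong refl) (simp add: yr su power2_diff mult_ac)
      then show ?thesis by (simp add: sum.distrib sum_subtractf sum_distrib_left)
    qed
    show ?thesis unfolding 1 2 by simp
  qed
  (* The Hubbard-Stratonovich identity. *)
  have hubbard: "ennreal (exp (t * w\<^sup>2)) = (\<integral>\<^sup>+z. ennreal (\<phi> z * exp (q * w * z)) \<partial>lborel)" for w
  proof -
    have "(\<integral>\<^sup>+z. ennreal (\<phi> z * exp (q * w * z)) \<partial>lborel)
       = (\<integral>\<^sup>+z. ennreal (1 / sqrt (2 * pi)) * ennreal (exp (- 1 * z\<^sup>2 / 2 + (q * w) * z)) \<partial>lborel)"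
      by (intro nn_integral_cong, subst ennreal_mult[symmetric])
        (auto simp: \<phi>_def exp_add[symmetric] exp_diff exp_minus field_simps)
    also have "\<dots> = ennreal (1 / sqrt (2 * pi)) * ennreal (sqrt (2 * pi / 1) * exp ((q * w)\<^sup>2 / (2 * 1)))"
      by (simp only: nn_integral_exp_quadratic[OF one_pos, symmetric]) (rule nn_integral_cmult, measurable)
    also have "\<dots> = ennreal (exp (t * w\<^sup>2))"
      by (subst ennreal_mult[symmetric]) (auto simp: power_mult_distrib q)
    finally show ?thesis ..
  qed
  define F where "F r z = (\<Prod>k\<in>K. normal_density (m k) \<sigma> (r k)) * exp (- t * dot K (y r) (y r))
     * (\<Prod>j<d. \<phi> (z j) * exp (q * dot K (y r) (u j) * z j))" for r z
  have Fm[measurable]: "(\<lambda>(r, z). F r z) \<in> borel_measurable (?PK \<Otimes>\<^sub>M ?PD)"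
    unfolding F_def dot_def y_def \<phi>_def using K by measurable
  have lin: "(\<integral>\<^sup>+z. ennreal (F r z) \<partial>?PD)
      = ennreal ((\<Prod>k\<in>K. normal_density (m k) \<sigma> (r k))
          * exp (- t * (dot K r r - (\<Sum>j<d. (dot K r (u j))\<^sup>2))))" for r
  proof -
    define A where "A = (\<Prod>k\<in>K. normal_density (m k) \<sigma> (r k)) * exp (- t * dot K (y r) (y r))"
    have A: "A \<ge> 0" unfolding A_def by (intro mult_nonneg_nonneg prod_nonneg) auto
    have "(\<integral>\<^sup>+z. ennreal (F r z) \<partial>?PD)
       = (\<integral>\<^sup>+z. ennreal A * (\<Prod>j<d. ennreal (\<phi> (z j) * exp (q * dot K (y r) (u j) * z j))) \<partial>?PD)"
      unfolding F_def A_def[symmetric] using A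
      by (intro nn_integral_cong ennreal_mult_prod) (auto simp: \<phi>_nonneg)
    also have "\<dots> = ennreal A * (\<Prod>j<d. \<integral>\<^sup>+z. ennreal (\<phi> z * exp (q * dot K (y r) (u j) * z)) \<partial>lborel)"
      by (subst nn_integral_cmult, unfold \<phi>_def, measurable)
        (subst product_sigma_finite_lborel.product_nn_integral_prod, auto)
    also have "\<dots> = ennreal A * (\<Prod>j<d. ennreal (exp (t * (dot K (y r) (u j))\<^sup>2)))"
      by (simp only: hubbard[symmetric])
    also have "\<dots> = ennreal (A * exp (\<Sum>j<d. t * (dot K (y r) (u j))\<^sup>2))"
      unfolding exp_sum[OF finite_lessThan] using A by (intro ennreal_mult_prod[symmetric]) auto
    also have "A * exp (\<Sum>j<d. t * (dot K (y r) (u j))\<^sup>2) = (\<Prod>k\<in>K. normal_density (m k) \<sigma> (r k))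
          * exp (- t * (dot K (y r) (y r) - (\<Sum>j<d. (dot K (y r) (u j))\<^sup>2)))"
      unfolding A_def by (simp add: mult.assoc exp_add[symmetric] sum_distrib_left[symmetric] right_diff_distrib)
    finally show ?thesis unfolding dist[symmetric] .
  qed
  (* For fixed z the exponent is a sum over the entries of r of a quadratic function of one entry. *)
  have inner: "(\<integral>\<^sup>+r. ennreal (F r z) \<partial>?PK)
      = ennreal ((1 / sqrt c) ^ card K) * (\<Prod>j<d. ennreal (\<phi> (z j) * exp (t * \<sigma>\<^sup>2 / c * (z j)\<^sup>2)))" for z
  proof -
    define b where "b k = q * (\<Sum>j<d. z j * u j k)" for k
    define B where "B = (\<Prod>j<d. \<phi> (z j))"
    have B: "B \<ge> 0" by (simp add: B_def prod_nonneg \<phi>_nonneg)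
    have Fr: "F r z = B * (\<Prod>k\<in>K. normal_density (m k) \<sigma> (r k) * exp (- t * (r k - m k)\<^sup>2 + b k * (r k - m k)))" for r
    proof -
      have "(\<Sum>j<d. q * dot K (y r) (u j) * z j) = (\<Sum>k\<in>K. b k * y r k)"
        unfolding b_def dot_def
        by (simp add: sum_distrib_left sum_distrib_right) (subst sum.swap, simp add: mult_ac)
      then have e: "(\<Prod>j<d. exp (q * dot K (y r) (u j) * z j)) = exp (\<Sum>k\<in>K. b k * y r k)"
        by (simp add: exp_sum[symmetric])
      have g: "exp (- t * dot K (y r) (y r)) * exp (\<Sum>k\<in>K. b k * y r k)
          = (\<Prod>k\<in>K. exp (- t * (y r k)\<^sup>2 + b k * y r k))"
        unfolding exp_sum[OF K, symmetric]
        by (simp add: exp_add[symmetric] dot_def sum_distrib_left power2_eq_square sum_subtractf sum_negf)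
      have "F r z = B * ((\<Prod>k\<in>K. normal_density (m k) \<sigma> (r k))
          * (exp (- t * dot K (y r) (y r)) * exp (\<Sum>k\<in>K. b k * y r k)))"
        unfolding F_def prod.distrib e B_def by (simp only: mult_ac)
      then show ?thesis unfolding g by (simp add: prod.distrib y_def)
    qed
    have "(\<integral>\<^sup>+r. ennreal (F r z) \<partial>?PK) = (\<integral>\<^sup>+r. ennreal B *
        (\<Prod>k\<in>K. ennreal (normal_density (m k) \<sigma> (r k) * exp (- t * (r k - m k)\<^sup>2 + b k * (r k - m k)))) \<partial>?PK)"
      unfolding Fr using B by (intro nn_integral_cong ennreal_mult_prod) auto
    also have "\<dots> = ennreal B * (\<Prod>k\<in>K. \<integral>\<^sup>+x. ennreal (normal_density (m k) \<sigma> x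
        * exp (- t * (x - m k)\<^sup>2 + b k * (x - m k))) \<partial>lborel)"
      using K by (subst nn_integral_cmult, measurable)
        (subst product_sigma_finite_lborel.product_nn_integral_prod, auto)
    also have "\<dots> = ennreal B * (\<Prod>k\<in>K. ennreal (1 / sqrt c * exp ((b k)\<^sup>2 * \<sigma>\<^sup>2 / (2 * c))))"
      by (simp only: nn_integral_tilted_normal[OF \<sigma> t] c_def)
    also have "\<dots> = ennreal (B * ((1 / sqrt c) ^ card K * exp (\<Sum>k\<in>K. (b k)\<^sup>2 * \<sigma>\<^sup>2 / (2 * c))))"
      using B c K by (subst ennreal_mult_prod[symmetric]) (auto simp: prod_dividef power_one_over exp_sum)
    also have "(\<Sum>k\<in>K. (b k)\<^sup>2 * \<sigma>\<^sup>2 / (2 * c)) = (\<Sum>j<d. t * \<sigma>\<^sup>2 / c * (z j)\<^sup>2)"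
    proof -
      interpret semi_inner_product "dot K" by (rule semi_inner_product_dot[OF K])
      define s where "s k = (\<Sum>j<d. z j * u j k)" for k
      have sz: "dot K s x = (\<Sum>j<d. z j * dot K (u j) x)" for x
        unfolding s_def by (rule ip_sum) simp
      have su: "dot K s (u j) = z j" if "j < d" for j
        unfolding sz using that by (subst sum.remove[of _ j]) (auto simp: orth intro!: sum.neutral)
      have ss: "dot K s s = (\<Sum>j<d. (z j)\<^sup>2)"
        unfolding sz[of s] by (intro sum.cong refl) (simp add: ip_sym[of "u _" s] su power2_eq_square)
      have "(\<Sum>k\<in>K. (b k)\<^sup>2 * \<sigma>\<^sup>2 / (2 * c)) = (\<Sum>k\<in>K. t * \<sigma>\<^sup>2 / c * (s k * s k))"
        unfolding b_def s_def[symmetric]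
        by (intro sum.cong refl) (simp add: power_mult_distrib q power2_eq_square[of "s _"])
      also have "\<dots> = t * \<sigma>\<^sup>2 / c * dot K s s"
        by (simp add: dot_def sum_distrib_left)
      finally show ?thesis by (simp add: ss sum_distrib_left)
    qed
    also have "B * ((1 / sqrt c) ^ card K * exp (\<Sum>j<d. t * \<sigma>\<^sup>2 / c * (z j)\<^sup>2))
        = (1 / sqrt c) ^ card K * (\<Prod>j<d. \<phi> (z j) * exp (t * \<sigma>\<^sup>2 / c * (z j)\<^sup>2))"
      by (simp add: exp_sum prod.distrib B_def mult_ac)
    also have "ennreal \<dots> = ennreal ((1 / sqrt c) ^ card K) * (\<Prod>j<d. ennreal (\<phi> (z j) * exp (t * \<sigma>\<^sup>2 / c * (z j)\<^sup>2)))"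
      using c by (intro ennreal_mult_prod) (auto simp: \<phi>_nonneg)
    finally show ?thesis .
  qed
  have last: "(\<integral>\<^sup>+z. ennreal (\<phi> z * exp (t * \<sigma>\<^sup>2 / c * z\<^sup>2)) \<partial>lborel) = ennreal (sqrt c)"
  proof -
    have ic: "1 / c > 0" using c by simp
    have e: "- (z\<^sup>2 / 2) + t * \<sigma>\<^sup>2 / c * z\<^sup>2 = - (1 / c) * z\<^sup>2 / 2 + 0 * z" for z
    proof -
      have ts: "t * \<sigma>\<^sup>2 = (c - 1) / 2" by (simp add: c_def)
      show ?thesis unfolding ts using c by (simp add: field_simps)
    qed
    have "(\<integral>\<^sup>+z. ennreal (\<phi> z * exp (t * \<sigma>\<^sup>2 / c * z\<^sup>2)) \<partial>lborel)
      = (\<integral>\<^sup>+z. ennreal (1 / sqrt (2 * pi)) * ennreal (exp (- (1 / c) * z\<^sup>2 / 2 + 0 * z)) \<partial>lborel)"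
      unfolding e[symmetric] exp_add
      by (intro nn_integral_cong, subst ennreal_mult[symmetric]) (auto simp: \<phi>_def)
    also have "\<dots> = ennreal (1 / sqrt (2 * pi)) * ennreal (sqrt (2 * pi / (1 / c)) * exp (0\<^sup>2 / (2 * (1 / c))))"
      by (simp only: nn_integral_exp_quadratic[OF ic, symmetric]) (rule nn_integral_cmult, measurable)
    also have "\<dots> = ennreal (sqrt c)"
      using c by (subst ennreal_mult[symmetric]) (auto simp: real_sqrt_mult)
    finally show ?thesis .
  qed
  interpret PK: sigma_finite_measure ?PK by (rule sigma_finite_PiM_lborel[OF K])
  interpret PD: sigma_finite_measure ?PD by (rule sigma_finite_PiM_lborel) simp
  interpret P: pair_sigma_finite ?PK ?PD ..
  have "(\<integral>\<^sup>+r. \<integral>\<^sup>+z. ennreal (F r z) \<partial>?PD \<partial>?PK) = (\<integral>\<^sup>+z. \<integral>\<^sup>+r. ennreal (F r z) \<partial>?PK \<partial>?PD)"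
    by (rule P.Fubini'[symmetric]) measurable
  also have "\<dots> = ennreal ((1 / sqrt c) ^ card K) * (\<Prod>j<d. \<integral>\<^sup>+z. ennreal (\<phi> z * exp (t * \<sigma>\<^sup>2 / c * z\<^sup>2)) \<partial>lborel)"
    unfolding inner
    by (subst nn_integral_cmult, unfold \<phi>_def, measurable)
      (subst product_sigma_finite_lborel.product_nn_integral_prod, auto)
  also have "\<dots> = ennreal ((1 / sqrt c) ^ card K * sqrt c ^ d)"
    unfolding last using c by (simp add: ennreal_mult ennreal_power)
  also have "(1 / sqrt c) ^ card K * sqrt c ^ d = c powr (- real (card K - d) / 2)"
  proof -
    have "sqrt c ^ card K = sqrt c ^ d * sqrt c ^ (card K - d)"
      using d by (simp add: power_add[symmetric])
    then have "(1 / sqrt c) ^ card K * sqrt c ^ d = inverse (sqrt c ^ (card K - d))"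
      using c by (simp add: power_one_over field_simps)
    also have "sqrt c ^ (card K - d) = (c powr (1 / 2)) powr real (card K - d)"
      using c by (simp add: powr_realpow powr_half_sqrt)
    finally show ?thesis
      using c by (simp add: powr_powr powr_minus[symmetric])
  qed
  finally show ?thesis unfolding lin c_def .
qed

text \<open>
The Beta integral over a half-line. Writing the power of \<open>1 + c t\<close> as a Gamma integral and
exchanging the integrals leaves two Gamma integrals.
\<close>

lemma nn_integral_beta_kernel:
  assumes s: "0 < s" "s < a" and c: "c > 0"
  shows "(\<integral>\<^sup>+t. ennreal (gamma_kernel s 0 t) * ennreal ((1 + c * t) powr (- a)) \<partial>lborel)
    = ennreal (c powr (- s) * Gamma s * Gamma (a - s) / Gamma a)" (is "?I = _")
proof -
  have a: "a > 0" using s by simp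
  have G: "Gamma a > 0" "Gamma s > 0" "Gamma (a - s) > 0" using s by (auto intro: Gamma_real_pos)
  have "ennreal (Gamma a) * ?I
    = (\<integral>\<^sup>+t. ennreal (gamma_kernel s 0 t) * (ennreal (Gamma a) * ennreal ((1 + c * t) powr (- a))) \<partial>lborel)"
    by (subst nn_integral_cmult[symmetric]) (auto simp: mult_ac)
  also have "\<dots> = (\<integral>\<^sup>+t. ennreal (gamma_kernel s 0 t) * (\<integral>\<^sup>+v. ennreal (gamma_kernel a (1 + c * t) v) \<partial>lborel) \<partial>lborel)"
  proof (intro nn_integral_cong)
    fix t :: real
    show "ennreal (gamma_kernel s 0 t) * (ennreal (Gamma a) * ennreal ((1 + c * t) powr (- a)))
      = ennreal (gamma_kernel s 0 t) * (\<integral>\<^sup>+v. ennreal (gamma_kernel a (1 + c * t) v) \<partial>lborel)"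
    proof (cases "t > 0")
      case True
      then have "1 + c * t > 0" using c by (simp add: add_pos_pos)
      then show ?thesis
        using G by (simp add: nn_integral_gamma_kernel[OF a] ennreal_mult[symmetric] powr_minus divide_inverse)
    qed (simp add: gamma_kernel_def)
  qed
  also have "\<dots> = (\<integral>\<^sup>+t. \<integral>\<^sup>+v. ennreal (gamma_kernel a 1 v) * ennreal (gamma_kernel s (c * v) t) \<partial>lborel \<partial>lborel)"
  proof (intro nn_integral_cong)
    fix t :: real
    have "gamma_kernel s 0 t * gamma_kernel a (1 + c * t) v = gamma_kernel a 1 v * gamma_kernel s (c * v) t" for v
    proof -
      have e: "exp (- (1 + c * t) * v) = exp (- 1 * v) * exp (- (c * v) * t)"
        unfolding exp_add[symmetric] by (simp add: algebra_simps)
      show ?thesis by (simp only: gamma_kernel_def e) simp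
    qed
    then show "ennreal (gamma_kernel s 0 t) * (\<integral>\<^sup>+v. ennreal (gamma_kernel a (1 + c * t) v) \<partial>lborel)
      = (\<integral>\<^sup>+v. ennreal (gamma_kernel a 1 v) * ennreal (gamma_kernel s (c * v) t) \<partial>lborel)"
      by (subst nn_integral_cmult[symmetric]) (auto simp: ennreal_mult[symmetric])
  qed
  also have "\<dots> = (\<integral>\<^sup>+v. \<integral>\<^sup>+t. ennreal (gamma_kernel a 1 v) * ennreal (gamma_kernel s (c * v) t) \<partial>lborel \<partial>lborel)"
    by (rule lborel_pair.Fubini') measurable
  also have "\<dots> = (\<integral>\<^sup>+v. ennreal (Gamma s * c powr (- s)) * ennreal (gamma_kernel (a - s) 1 v) \<partial>lborel)"
  proof (intro nn_integral_cong)
    fix v :: real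
    have "(\<integral>\<^sup>+t. ennreal (gamma_kernel a 1 v) * ennreal (gamma_kernel s (c * v) t) \<partial>lborel)
      = ennreal (gamma_kernel a 1 v) * (\<integral>\<^sup>+t. ennreal (gamma_kernel s (c * v) t) \<partial>lborel)"
      by (rule nn_integral_cmult) measurable
    also have "\<dots> = ennreal (Gamma s * c powr (- s)) * ennreal (gamma_kernel (a - s) 1 v)"
    proof (cases "v > 0")
      case True
      have "v powr (a - 1) / v powr s = v powr (a - s - 1)"
        by (simp add: powr_diff[symmetric] diff_diff_eq add.commute)
      then have "gamma_kernel a 1 v * (Gamma s / (c * v) powr s) = Gamma s * c powr (- s) * gamma_kernel (a - s) 1 v"
        using True c by (simp add: gamma_kernel_def powr_mult powr_minus field_simps)
      then show ?thesis
        using True c G s by (simp add: nn_integral_gamma_kernel ennreal_mult[symmetric])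
    qed (simp add: gamma_kernel_def)
    finally show "(\<integral>\<^sup>+t. ennreal (gamma_kernel a 1 v) * ennreal (gamma_kernel s (c * v) t) \<partial>lborel)
      = ennreal (Gamma s * c powr (- s)) * ennreal (gamma_kernel (a - s) 1 v)" .
  qed
  also have "\<dots> = ennreal (Gamma s * c powr (- s)) * ennreal (Gamma (a - s))"
    using s by (subst nn_integral_cmult) (auto simp: nn_integral_gamma_kernel)
  finally have "ennreal (Gamma a) * ?I = ennreal (Gamma a) * ennreal (c powr (- s) * Gamma s * Gamma (a - s) / Gamma a)"
    using G by (simp add: ennreal_mult[symmetric] mult_ac)
  then show ?thesis using G by (simp add: ennreal_mult_cancel_left)
qed

text \<open>
A row of independent Gaussian entries whose mean lies in the span of \<open>d\<close> orthonormal vectors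
\<open>u\<close>; \<open>shape\<close> below is half the number of remaining degrees of freedom.
\<close>

locale normal_row =
  fixes K :: "'k set" and d :: nat and u :: "nat \<Rightarrow> 'k \<Rightarrow> real"
    and m :: "'k \<Rightarrow> real" and a :: "nat \<Rightarrow> real" and \<sigma> :: real
  assumes finite_K: "finite K" and d_less: "d < card K" and \<sigma>_pos: "\<sigma> > 0"
    and orth: "\<And>i j. i < d \<Longrightarrow> j < d \<Longrightarrow> dot K (u i) (u j) = (if i = j then 1 else 0)"
    and mean: "\<And>k. k \<in> K \<Longrightarrow> m k = (\<Sum>j<d. a j * u j k)"
begin

definition "dens r = (\<Prod>k\<in>K. normal_density (m k) \<sigma> (r k))"
definition "dist2 r = dot K r r - (\<Sum>j<d. (dot K r (u j))\<^sup>2)"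
definition "shape = real (card K - d) / 2"

abbreviation "L \<equiv> PiM K (\<lambda>_. lborel :: real measure)"

lemma shape_pos: "shape > 0"
  using d_less by (simp add: shape_def)

lemma dens_pos: "dens r > 0"
  unfolding dens_def using \<sigma>_pos by (intro prod_pos normal_density_pos) auto

lemma measurable_dens [measurable]: "dens \<in> borel_measurable L"
  unfolding dens_def[abs_def] by measurable

lemma measurable_dist2 [measurable]: "dist2 \<in> borel_measurable L"
  unfolding dist2_def[abs_def] dot_def by measurable

text \<open>
Bessel's inequality: \<open>dist2 r\<close> is the squared length of the residual of \<open>r\<close>.
\<close>

lemma dist2_nonneg: "dist2 r \<ge> 0"
proof -
  interpret semi_inner_product "dot K" by (rule semi_inner_product_dot[OF finite_K])
  define w where "w k = (\<Sum>j<d. dot K r (u j) * u j k)" for k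
  have wz: "dot K w z = (\<Sum>j<d. dot K r (u j) * dot K (u j) z)" for z
    unfolding w_def by (rule ip_sum) simp
  have wu: "dot K w (u j) = dot K r (u j)" if "j < d" for j
    unfolding wz using that by (subst sum.remove[of _ j]) (auto simp: orth intro!: sum.neutral)
  have ww: "dot K w w = (\<Sum>j<d. (dot K r (u j))\<^sup>2)"
    unfolding wz[of w] by (intro sum.cong refl) (simp add: ip_sym[of "u _" w] wu power2_eq_square)
  have wr: "dot K w r = (\<Sum>j<d. (dot K r (u j))\<^sup>2)"
    unfolding wz[of r] by (intro sum.cong refl) (simp add: ip_sym[of "u _" r] power2_eq_square)
  let ?e = "\<lambda>k. r k - w k"
  have "0 \<le> dot K ?e ?e" by (rule ip_nonneg)
  also have "dot K ?e ?e = dot K r ?e - dot K w ?e" by (rule ip_diff)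
  also have "dot K r ?e = dot K r r - dot K w r" using ip_sym[of r ?e] by (simp add: ip_diff)
  also have "dot K w ?e = dot K r w - dot K w w" using ip_sym[of w ?e] by (simp add: ip_diff)
  also have "dot K r w = dot K w r" by (rule ip_sym)
  finally show ?thesis by (simp add: ww wr dist2_def)
qed

lemma laplace:
  assumes "t \<ge> 0"
  shows "(\<integral>\<^sup>+r. ennreal (dens r) * ennreal (exp (- t * dist2 r)) \<partial>L)
    = ennreal ((1 + 2 * \<sigma>\<^sup>2 * t) powr (- shape))"
  using normal_row_laplace[OF finite_K less_imp_le[OF d_less] \<sigma>_pos assms orth mean] less_imp_le[OF dens_pos]
  by (simp add: dens_def dist2_def shape_def ennreal_mult mult_ac)

text \<open>
The mass of \<open>{dist2 = 0}\<close> is bounded by the Laplace transform at every \<open>t\<close>, which tends to \<open>0\<close>. As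
the density is positive everywhere, the set is null for the Lebesgue measure as well.
\<close>

lemma AE_dist2_pos: "AE r in L. dist2 r > 0"
proof -
  have "(\<integral>\<^sup>+r. ennreal (dens r) * indicator {r. dist2 r = 0} r \<partial>L) \<le> 0"
  proof (rule tendsto_lowerbound)
    have lim: "filterlim (\<lambda>n. 1 + 2 * \<sigma>\<^sup>2 * real n) at_top sequentially"
      using \<sigma>_pos by (intro filterlim_tendsto_add_at_top[OF tendsto_const]
        filterlim_tendsto_pos_mult_at_top[OF tendsto_const] filterlim_real_sequentially) auto
    have "(\<lambda>n. (1 + 2 * \<sigma>\<^sup>2 * real n) powr (- shape)) \<longlonglongrightarrow> 0"
      using shape_pos by (intro tendsto_neg_powr lim) auto
    from tendsto_ennrealI[OF this]
    show "(\<lambda>n. ennreal ((1 + 2 * \<sigma>\<^sup>2 * real n) powr (- shape))) \<longlonglongrightarrow> 0" by simp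
    show "\<forall>\<^sub>F n in sequentially. (\<integral>\<^sup>+r. ennreal (dens r) * indicator {r. dist2 r = 0} r \<partial>L)
        \<le> ennreal ((1 + 2 * \<sigma>\<^sup>2 * real n) powr (- shape))"
      by (subst laplace[symmetric]) (auto intro!: always_eventually nn_integral_mono simp: indicator_def)
  qed simp
  then have "(\<integral>\<^sup>+r. ennreal (dens r) * indicator {r. dist2 r = 0} r \<partial>L) = 0" by simp
  moreover have "(\<lambda>r. ennreal (dens r) * indicator {r. dist2 r = 0} r) \<in> borel_measurable L"
    by measurable
  ultimately have "AE r in L. ennreal (dens r) * indicator {r. dist2 r = 0} r = 0"
    by (simp add: nn_integral_0_iff_AE)
  then show ?thesis
  proof eventually_elim
    case (elim r)
    then show ?case using dens_pos[of r] dist2_nonneg[of r]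
      by (auto simp: indicator_def ennreal_eq_0_iff split: if_splits)
  qed
qed

text \<open>
The Gamma integral represents \<open>x powr - s\<close> as a mixture of the functions \<open>exp (- t x)\<close>, so the
moment is the Mellin transform of the Laplace transform.
\<close>

lemma negative_moment:
  assumes s: "0 < s" "s < shape"
  shows "(\<integral>\<^sup>+r. ennreal (dens r) * ennreal (dist2 r powr (- s)) \<partial>L)
    = ennreal ((2 * \<sigma>\<^sup>2) powr (- s) * Gamma (shape - s) / Gamma shape)"
proof -
  interpret L: sigma_finite_measure L by (rule sigma_finite_PiM_lborel[OF finite_K])
  interpret P: pair_sigma_finite L "lborel :: real measure" ..
  have G: "Gamma s > 0" using s by (auto intro: Gamma_real_pos)
  have "ennreal (Gamma s) * (\<integral>\<^sup>+r. ennreal (dens r) * ennreal (dist2 r powr (- s)) \<partial>L)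
     = (\<integral>\<^sup>+r. ennreal (dens r) * (ennreal (Gamma s) * ennreal (dist2 r powr (- s))) \<partial>L)"
    by (subst nn_integral_cmult[symmetric]) (auto simp: mult_ac)
  also have "\<dots> = (\<integral>\<^sup>+r. \<integral>\<^sup>+t. ennreal (dens r) * ennreal (gamma_kernel s (dist2 r) t) \<partial>lborel \<partial>L)"
    using AE_dist2_pos
  proof (intro nn_integral_cong_AE, eventually_elim)
    case (elim r)
    have "ennreal (Gamma s) * ennreal (dist2 r powr (- s)) = (\<integral>\<^sup>+t. ennreal (gamma_kernel s (dist2 r) t) \<partial>lborel)"
      using elim s G by (simp add: nn_integral_gamma_kernel ennreal_mult[symmetric] powr_minus divide_inverse)
    then show ?case by (simp add: nn_integral_cmult)
  qed
  also have "\<dots> = (\<integral>\<^sup>+t. \<integral>\<^sup>+r. ennreal (dens r) * ennreal (gamma_kernel s (dist2 r) t) \<partial>L \<partial>lborel)"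
    by (rule P.Fubini'[symmetric]) measurable
  also have "\<dots> = (\<integral>\<^sup>+t. ennreal (gamma_kernel s 0 t) * ennreal ((1 + (2 * \<sigma>\<^sup>2) * t) powr (- shape)) \<partial>lborel)"
  proof (intro nn_integral_cong)
    fix t :: real
    show "(\<integral>\<^sup>+r. ennreal (dens r) * ennreal (gamma_kernel s (dist2 r) t) \<partial>L)
      = ennreal (gamma_kernel s 0 t) * ennreal ((1 + (2 * \<sigma>\<^sup>2) * t) powr (- shape))"
    proof (cases "t > 0")
      case True
      have "gamma_kernel s (dist2 r) t = gamma_kernel s 0 t * exp (- t * dist2 r)" for r
        by (simp add: gamma_kernel_def mult.commute)
      then have "(\<integral>\<^sup>+r. ennreal (dens r) * ennreal (gamma_kernel s (dist2 r) t) \<partial>L)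
        = (\<integral>\<^sup>+r. ennreal (gamma_kernel s 0 t) * (ennreal (dens r) * ennreal (exp (- t * dist2 r))) \<partial>L)"
        by (intro nn_integral_cong) (simp add: ennreal_mult mult_ac)
      also have "\<dots> = ennreal (gamma_kernel s 0 t) * (\<integral>\<^sup>+r. ennreal (dens r) * ennreal (exp (- t * dist2 r)) \<partial>L)"
        by (rule nn_integral_cmult) measurable
      finally show ?thesis using True laplace[of t] by simp
    qed (simp add: gamma_kernel_def)
  qed
  also have "\<dots> = ennreal ((2 * \<sigma>\<^sup>2) powr (- s) * Gamma s * Gamma (shape - s) / Gamma shape)"
    using s \<sigma>_pos by (intro nn_integral_beta_kernel) auto
  also have "\<dots> = ennreal (Gamma s) * ennreal ((2 * \<sigma>\<^sup>2) powr (- s) * Gamma (shape - s) / Gamma shape)"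
    using G by (subst ennreal_mult'[symmetric]) (auto simp: mult_ac)
  finally show ?thesis using G by (simp add: ennreal_mult_cancel_left)
qed

end

section \<open>Integrating the data row by row\<close>

text \<open>
The conditional mean of coordinate \<open>i\<close> of observation \<open>k\<close> given its earlier coordinates, in the
sequential factorisation of the Gaussian density.
\<close>

definition row_mean :: "(nat \<Rightarrow> real) \<Rightarrow> (nat \<Rightarrow> nat \<Rightarrow> real) \<Rightarrow> ('k \<Rightarrow> nat \<Rightarrow> real) \<Rightarrow> nat \<Rightarrow> 'k \<Rightarrow> real" where
  "row_mean \<mu> \<beta> X i k = \<mu> i + (\<Sum>j<i. \<beta> i j * (X k j - \<mu> j))"

definition row_density :: "'k set \<Rightarrow> (nat \<Rightarrow> real) \<Rightarrow> (nat \<Rightarrow> nat \<Rightarrow> real) \<Rightarrow> (nat \<Rightarrow> real)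
    \<Rightarrow> ('k \<Rightarrow> nat \<Rightarrow> real) \<Rightarrow> nat \<Rightarrow> real" where
  "row_density K \<mu> \<beta> \<sigma> X i = (\<Prod>k\<in>K. normal_density (row_mean \<mu> \<beta> X i k) (\<sigma> i) (X k i))"

definition row_dist2 :: "'k set \<Rightarrow> ('k \<Rightarrow> nat \<Rightarrow> real) \<Rightarrow> nat \<Rightarrow> real" where
  "row_dist2 K X i = gs_dist2 (dot K) (data_rows X) (Suc i)"

definition put_row :: "'k set \<Rightarrow> ('k \<Rightarrow> nat \<Rightarrow> real) \<Rightarrow> nat \<Rightarrow> ('k \<Rightarrow> real) \<Rightarrow> 'k \<Rightarrow> nat \<Rightarrow> real" where
  "put_row K X i r = (\<lambda>k\<in>K. (X k)(i := r k))"

abbreviation data_space :: "'k set \<Rightarrow> nat \<Rightarrow> ('k \<Rightarrow> nat \<Rightarrow> real) measure" where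
  "data_space K p \<equiv> PiM K (\<lambda>_. PiM {..<p} (\<lambda>_. lborel))"

lemma row_dist2_nonneg: "finite K \<Longrightarrow> row_dist2 K X i \<ge> 0"
  unfolding row_dist2_def by (rule semi_inner_product.gs_dist2_nonneg[OF semi_inner_product_dot])

lemma put_row_apply: "k \<in> K \<Longrightarrow> put_row K X i r k j = (if j = i then r k else X k j)"
  by (simp add: put_row_def)

lemma row_mean_put_row: "k \<in> K \<Longrightarrow> j \<le> i \<Longrightarrow> row_mean \<mu> \<beta> (put_row K X i r) j k = row_mean \<mu> \<beta> X j k"
  unfolding row_mean_def by (intro arg_cong2[where f = "(+)"] sum.cong refl) (simp add: put_row_apply)

lemma row_density_put_row:
  "j < i \<Longrightarrow> row_density K \<mu> \<beta> \<sigma> (put_row K X i r) j = row_density K \<mu> \<beta> \<sigma> X j"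
  unfolding row_density_def by (intro prod.cong refl) (simp add: row_mean_put_row put_row_apply)

lemma row_dist2_put_row: "j < i \<Longrightarrow> row_dist2 K (put_row K X i r) j = row_dist2 K X j"
  unfolding row_dist2_def by (intro gs_cong(2)) (auto simp: data_rows_def put_row_apply split: nat.split)

lemma measurable_entry:
  assumes "k \<in> K" "i < p"
  shows "(\<lambda>X. X k i) \<in> borel_measurable (data_space K p)"
  using measurable_compose[OF measurable_component_singleton[OF assms(1)]
      measurable_component_singleton[of i "{..<p}" "\<lambda>_. lborel :: real measure"]] assms(2) by simp

lemma measurable_dot:
  assumes "\<And>k. k \<in> K \<Longrightarrow> (\<lambda>x. f x k) \<in> borel_measurable M" "\<And>k. k \<in> K \<Longrightarrow> (\<lambda>x. g x k) \<in> borel_measurable M"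
  shows "(\<lambda>x. dot K (f x) (g x)) \<in> borel_measurable M"
  unfolding dot_def using assms by (intro borel_measurable_sum borel_measurable_times) auto

lemma measurable_gs:
  assumes "i \<le> p"
  shows "k \<in> K \<Longrightarrow> (\<lambda>X. gs_unit (dot K) (data_rows X) i k) \<in> borel_measurable (data_space K p)"
    and "(\<lambda>X. gs_dist2 (dot K) (data_rows X) i) \<in> borel_measurable (data_space K p)"
proof -
  have "(\<forall>k\<in>K. (\<lambda>X. gs_unit (dot K) (data_rows X) i k) \<in> borel_measurable (data_space K p)) \<and>
    (\<lambda>X. gs_dist2 (dot K) (data_rows X) i) \<in> borel_measurable (data_space K p)"
    using assms
  proof (induction i rule: less_induct)
    case (less i)
    have row: "(\<lambda>X. data_rows X i k) \<in> borel_measurable (data_space K p)" if "k \<in> K" for k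
      using that less.prems by (cases i) (auto intro!: measurable_entry)
    have unit: "(\<lambda>X. gs_unit (dot K) (data_rows X) j k) \<in> borel_measurable (data_space K p)"
      if "j < i" "k \<in> K" for j k
      using less.IH[OF that(1)] less.prems that by auto
    have resid: "(\<lambda>X. gs_resid (dot K) (data_rows X) i k) \<in> borel_measurable (data_space K p)"
      if "k \<in> K" for k
      unfolding gs_resid_def using that
      by (intro borel_measurable_diff borel_measurable_sum borel_measurable_times measurable_dot row unit) auto
    have "(\<lambda>X. gs_dist2 (dot K) (data_rows X) i) \<in> borel_measurable (data_space K p)"
      unfolding gs_dist2_def by (intro measurable_dot resid)
    then show ?case
      unfolding gs_unit_eq using resid
      by (auto intro!: borel_measurable_divide borel_measurable_sqrt)
  qed
  then show "k \<in> K \<Longrightarrow> (\<lambda>X. gs_unit (dot K) (data_rows X) i k) \<in> borel_measurable (data_space K p)"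
    and "(\<lambda>X. gs_dist2 (dot K) (data_rows X) i) \<in> borel_measurable (data_space K p)"
    by auto
qed

lemma measurable_row_dist2:
  "i < p \<Longrightarrow> (\<lambda>X. row_dist2 K X i) \<in> borel_measurable (data_space K p)"
  unfolding row_dist2_def by (rule measurable_gs) simp

lemma measurable_normal_density:
  assumes "f \<in> borel_measurable M" "g \<in> borel_measurable M"
  shows "(\<lambda>x. normal_density (f x) s (g x)) \<in> borel_measurable M"
  unfolding normal_density_def using assms by measurable

lemma measurable_row_density:
  assumes "i < p"
  shows "(\<lambda>X. row_density K \<mu> \<beta> \<sigma> X i) \<in> borel_measurable (data_space K p)"
  unfolding row_density_def row_mean_def using assms
  by (intro borel_measurable_prod measurable_normal_density borel_measurable_add borel_measurable_sum
      borel_measurable_times borel_measurable_diff borel_measurable_const measurable_entry) auto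

lemma measurable_put_row:
  assumes X: "X \<in> space (data_space K p)"
  shows "put_row K X p \<in> measurable (PiM K (\<lambda>_. lborel)) (data_space K (Suc p))"
  unfolding put_row_def[abs_def]
proof (intro measurable_restrict)
  fix k assume k: "k \<in> K"
  show "(\<lambda>r. (X k)(p := r k)) \<in> measurable (PiM K (\<lambda>_. lborel)) (PiM {..<Suc p} (\<lambda>_. lborel :: real measure))"
  proof (rule measurable_fun_upd)
    show "{..<Suc p} = {..<p} \<union> {p}" by auto
    show "(\<lambda>r. X k) \<in> measurable (PiM K (\<lambda>_. lborel :: real measure)) (PiM {..<p} (\<lambda>_. lborel))"
      using X k by (intro measurable_const) (auto simp: space_PiM)
    show "(\<lambda>r. r k) \<in> measurable (PiM K (\<lambda>_. lborel :: real measure)) lborel"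
      using k by measurable
  qed
qed

text \<open>
If the innermost integral of each factor is a constant \<open>c i\<close>, independent of the earlier rows, then
the integral of the product is the product of the constants. The innermost integral need only be
known when the factors of the earlier rows do not vanish. This lets a factor \<open>g\<close> with \<open>g 0 = 0\<close>
exclude the degenerate data, for which the span has too small a dimension.
\<close>

lemma nn_integral_rowwise:
  fixes g :: "nat \<Rightarrow> real \<Rightarrow> ennreal"
  assumes K: "finite K" and g: "\<And>i. g i \<in> borel_measurable borel"
    and step: "\<And>X i. i < p \<Longrightarrow> (\<Prod>j<i. g j (row_dist2 K X j)) \<noteq> 0 \<Longrightarrow>
      (\<integral>\<^sup>+r. ennreal (row_density K \<mu> \<beta> \<sigma> (put_row K X i r) i) * g i (row_dist2 K (put_row K X i r) i)
        \<partial>PiM K (\<lambda>_. lborel)) = c i"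
  shows "(\<integral>\<^sup>+X. (\<Prod>i<p. ennreal (row_density K \<mu> \<beta> \<sigma> X i) * g i (row_dist2 K X i)) \<partial>data_space K p) = (\<Prod>i<p. c i)"
  using step
proof (induction p)
  case 0
  interpret P: prob_space "PiM {} (\<lambda>_. lborel :: real measure)" by (rule prob_space_PiM) simp
  interpret prob_space "data_space K 0"
    using P.prob_space_axioms by (intro prob_space_PiM) simp
  show ?case using emeasure_space_1 by simp
next
  case (Suc p)
  define h where "h i X = ennreal (row_density K \<mu> \<beta> \<sigma> X i) * g i (row_dist2 K X i)" for i X
  have hm: "h i \<in> borel_measurable (data_space K q)" if "i < q" for i q
  proof -
    note [measurable] = measurable_row_density[OF that] measurable_row_dist2[OF that] g
    show ?thesis unfolding h_def[abs_def] by measurable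
  qed
  have prod_m: "(\<lambda>X. \<Prod>i<Suc p. h i X) \<in> borel_measurable (data_space K (Suc p))"
    by (intro borel_measurable_prod_ennreal hm) simp
  have "(\<integral>\<^sup>+X. (\<Prod>i<Suc p. h i X) \<partial>data_space K (Suc p))
     = (\<integral>\<^sup>+X. \<integral>\<^sup>+r. (\<Prod>i<Suc p. h i (put_row K X p r)) \<partial>PiM K (\<lambda>_. lborel) \<partial>data_space K p)"
    unfolding put_row_def lessThan_Suc[of p] using prod_m[unfolded lessThan_Suc]
    by (intro nn_integral_PiM_split_row[OF K]) simp_all
  also have "\<dots> = (\<integral>\<^sup>+X. (\<Prod>i<p. h i X) * c p \<partial>data_space K p)"
  proof (intro nn_integral_cong)
    fix X assume X: "X \<in> space (data_space K p)"
    have "(\<integral>\<^sup>+r. (\<Prod>i<Suc p. h i (put_row K X p r)) \<partial>PiM K (\<lambda>_. lborel))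
      = (\<integral>\<^sup>+r. (\<Prod>i<p. h i X) * h p (put_row K X p r) \<partial>PiM K (\<lambda>_. lborel))"
      by (intro nn_integral_cong) (simp add: h_def row_density_put_row row_dist2_put_row)
    also have "\<dots> = (\<Prod>i<p. h i X) * (\<integral>\<^sup>+r. h p (put_row K X p r) \<partial>PiM K (\<lambda>_. lborel))"
      by (rule nn_integral_cmult) (rule measurable_compose[OF measurable_put_row[OF X] hm[OF lessI]])
    also have "\<dots> = (\<Prod>i<p. h i X) * c p"
    proof (cases "(\<Prod>i<p. h i X) = 0")
      case False
      then have "(\<Prod>j<p. g j (row_dist2 K X j)) \<noteq> 0" by (auto simp: h_def prod.distrib)
      from Suc.prems[OF lessI this] show ?thesis by (simp add: h_def)
    qed (simp only: mult_zero_left)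
    finally show "(\<integral>\<^sup>+r. (\<Prod>i<Suc p. h i (put_row K X p r)) \<partial>PiM K (\<lambda>_. lborel)) = (\<Prod>i<p. h i X) * c p" .
  qed
  also have "\<dots> = (\<integral>\<^sup>+X. (\<Prod>i<p. h i X) \<partial>data_space K p) * c p"
    by (intro nn_integral_multc borel_measurable_prod_ennreal hm) auto
  also have "(\<integral>\<^sup>+X. (\<Prod>i<p. h i X) \<partial>data_space K p) = (\<Prod>i<p. c i)"
    unfolding h_def by (rule Suc.IH) (rule Suc.prems, auto)
  finally show ?case unfolding h_def by simp
qed

lemma row_total_mass:
  assumes K: "finite K" and \<sigma>: "\<sigma> i > 0"
  shows "(\<integral>\<^sup>+r. ennreal (row_density K \<mu> \<beta> \<sigma> (put_row K X i r) i) \<partial>PiM K (\<lambda>_. lborel)) = 1"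
proof -
  have "(\<integral>\<^sup>+x. ennreal (normal_density m (\<sigma> i) x) \<partial>lborel) = 1" for m
    using nn_integral_tilted_normal[OF \<sigma>, of 0 m 0] by simp
  then have "(\<Prod>k\<in>K. \<integral>\<^sup>+x. ennreal (normal_density (row_mean \<mu> \<beta> X i k) (\<sigma> i) x) \<partial>lborel) = 1"
    by simp
  also have "(\<Prod>k\<in>K. \<integral>\<^sup>+x. ennreal (normal_density (row_mean \<mu> \<beta> X i k) (\<sigma> i) x) \<partial>lborel)
    = (\<integral>\<^sup>+r. (\<Prod>k\<in>K. ennreal (normal_density (row_mean \<mu> \<beta> X i k) (\<sigma> i) (r k))) \<partial>PiM K (\<lambda>_. lborel))"
    by (rule product_sigma_finite_lborel.product_nn_integral_prod[symmetric, OF K]) simp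
  also have "\<dots> = (\<integral>\<^sup>+r. ennreal (row_density K \<mu> \<beta> \<sigma> (put_row K X i r) i) \<partial>PiM K (\<lambda>_. lborel))"
    unfolding row_density_def
    by (intro nn_integral_cong) (simp add: prod_ennreal row_mean_put_row put_row_apply cong: prod.cong)
  finally show ?thesis .
qed

text \<open>
For nondegenerate earlier rows the next row is an instance of \<open>normal_row\<close>. There are \<open>i + 1\<close> unit
vectors, one for the all-ones vector and one for each earlier row, and the conditional mean lies in
their span because it is affine in the earlier rows.
\<close>

lemma normal_row_of_data:
  fixes X :: "'k \<Rightarrow> nat \<Rightarrow> real"
  assumes K: "finite K" and i: "Suc i < card K" and \<sigma>: "\<sigma> i > 0"
    and pos: "\<And>j. j < i \<Longrightarrow> row_dist2 K X j > 0"
  shows "\<exists>a. normal_row K (Suc i) (gs_unit (dot K) (data_rows X)) (row_mean \<mu> \<beta> X i) a (\<sigma> i)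
    \<and> (\<forall>r. normal_row.dens K (row_mean \<mu> \<beta> X i) (\<sigma> i) r = row_density K \<mu> \<beta> \<sigma> (put_row K X i r) i)
    \<and> (\<forall>r. normal_row.dist2 K (Suc i) (gs_unit (dot K) (data_rows X)) r = row_dist2 K (put_row K X i r) i)"
proof -
  interpret semi_inner_product "dot K" by (rule semi_inner_product_dot[OF K])
  let ?v = "data_rows X"
  let ?u = "gs_unit (dot K) ?v"
  define a where "a l = (\<mu> i - (\<Sum>j<i. \<beta> i j * \<mu> j)) * dot K (?v 0) (?u l)
      + (\<Sum>j<i. \<beta> i j * dot K (?v (Suc j)) (?u l))" for l
  have D: "gs_dist2 (dot K) ?v j > 0" if "j < Suc i" for j
  proof (cases j)
    case 0
    then show ?thesis using i K by (simp add: gs_dist2_def gs_resid_0 dot_def)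
  next
    case (Suc l)
    then show ?thesis using pos[of l] that by (simp add: row_dist2_def)
  qed
  have orth: "dot K (?u j) (?u l) = (if j = l then 1 else 0)" if "j < Suc i" for j l
    using D[OF that] by (auto simp: ip_unit_unit)
  have mean: "row_mean \<mu> \<beta> X i k = (\<Sum>l<Suc i. a l * ?u l k)" if k: "k \<in> K" for k
  proof -
    have v: "?v j k = (\<Sum>l<Suc i. dot K (?v j) (?u l) * ?u l k)" if "j < Suc i" for j
      by (rule gs_expansion_pointwise[OF K k that])
    have "row_mean \<mu> \<beta> X i k = (\<mu> i - (\<Sum>j<i. \<beta> i j * \<mu> j)) * ?v 0 k + (\<Sum>j<i. \<beta> i j * ?v (Suc j) k)"
      by (simp add: row_mean_def right_diff_distrib sum_subtractf)
    also have "\<dots> = (\<mu> i - (\<Sum>j<i. \<beta> i j * \<mu> j)) * (\<Sum>l<Suc i. dot K (?v 0) (?u l) * ?u l k)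
        + (\<Sum>j<i. \<beta> i j * (\<Sum>l<Suc i. dot K (?v (Suc j)) (?u l) * ?u l k))"
      using v[of 0] v[of "Suc _"] by (intro arg_cong2[where f = "(+)"] sum.cong arg_cong2[where f = "(*)"] refl) auto
    also have "(\<Sum>j<i. \<beta> i j * (\<Sum>l<Suc i. dot K (?v (Suc j)) (?u l) * ?u l k))
        = (\<Sum>l<Suc i. (\<Sum>j<i. \<beta> i j * dot K (?v (Suc j)) (?u l)) * ?u l k)"
      unfolding sum_distrib_left sum_distrib_right by (subst sum.swap) (simp only: mult.assoc)
    also have "(\<mu> i - (\<Sum>j<i. \<beta> i j * \<mu> j)) * (\<Sum>l<Suc i. dot K (?v 0) (?u l) * ?u l k)
        + (\<Sum>l<Suc i. (\<Sum>j<i. \<beta> i j * dot K (?v (Suc j)) (?u l)) * ?u l k)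
        = (\<Sum>l<Suc i. a l * ?u l k)"
      unfolding a_def sum_distrib_left[of "\<mu> i - _"] distrib_right sum.distrib by (simp only: mult.assoc)
    finally show ?thesis .
  qed
  have row: "normal_row K (Suc i) ?u (row_mean \<mu> \<beta> X i) a (\<sigma> i)"
    by unfold_locales (use K i \<sigma> orth mean in auto)
  show ?thesis
  proof (intro exI[of _ a] conjI allI row)
    fix r
    show "normal_row.dens K (row_mean \<mu> \<beta> X i) (\<sigma> i) r = row_density K \<mu> \<beta> \<sigma> (put_row K X i r) i"
      unfolding normal_row.dens_def[OF row] row_density_def
      by (intro prod.cong refl) (simp add: row_mean_put_row put_row_apply)
    let ?w = "data_rows (put_row K X i r)"
    have u: "gs_unit (dot K) ?w j k = ?u j k" if "j < Suc i" "k \<in> K" for j k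
      using that by (intro gs_cong(1)) (auto simp: data_rows_def put_row_apply split: nat.split)
    have w: "?w (Suc i) k = r k" if "k \<in> K" for k using that by (simp add: put_row_apply)
    have "row_dist2 K (put_row K X i r) i
      = dot K (?w (Suc i)) (?w (Suc i)) - (\<Sum>j<Suc i. (dot K (?w (Suc i)) (gs_unit (dot K) ?w j))\<^sup>2)"
      unfolding row_dist2_def by (rule gs_dist2_eq)
    also have "dot K (?w (Suc i)) (?w (Suc i)) = dot K r r"
      by (rule dot_cong; rule w)
    also have "(\<Sum>j<Suc i. (dot K (?w (Suc i)) (gs_unit (dot K) ?w j))\<^sup>2) = (\<Sum>j<Suc i. (dot K r (?u j))\<^sup>2)"
      by (intro sum.cong refl arg_cong[where f = "\<lambda>x. x\<^sup>2"] dot_cong) (auto simp: u put_row_apply)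
    finally show "normal_row.dist2 K (Suc i) ?u r = row_dist2 K (put_row K X i r) i"
      unfolding normal_row.dist2_def[OF row] by simp
  qed
qed

lemma row_dist2_pos_mass:
  assumes K: "finite K" and i: "Suc i < card K" and \<sigma>: "\<sigma> i > 0"
    and pos: "\<And>j. j < i \<Longrightarrow> row_dist2 K X j > 0"
  shows "(\<integral>\<^sup>+r. ennreal (row_density K \<mu> \<beta> \<sigma> (put_row K X i r) i)
      * indicator {0<..} (row_dist2 K (put_row K X i r) i) \<partial>PiM K (\<lambda>_. lborel)) = 1"
proof -
  obtain a where row: "normal_row K (Suc i) (gs_unit (dot K) (data_rows X)) (row_mean \<mu> \<beta> X i) a (\<sigma> i)"
    and dist: "\<And>r. normal_row.dist2 K (Suc i) (gs_unit (dot K) (data_rows X)) r = row_dist2 K (put_row K X i r) i"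
    using normal_row_of_data[where i = i and \<sigma> = \<sigma> and X = X and \<mu> = \<mu> and \<beta> = \<beta>, OF K i \<sigma> pos] by auto
  have "(\<integral>\<^sup>+r. ennreal (row_density K \<mu> \<beta> \<sigma> (put_row K X i r) i)
      * indicator {0<..} (row_dist2 K (put_row K X i r) i) \<partial>PiM K (\<lambda>_. lborel))
    = (\<integral>\<^sup>+r. ennreal (row_density K \<mu> \<beta> \<sigma> (put_row K X i r) i) \<partial>PiM K (\<lambda>_. lborel))"
    using normal_row.AE_dist2_pos[OF row]
    by (intro nn_integral_cong_AE, eventually_elim) (simp add: dist)
  also have "\<dots> = 1" by (rule row_total_mass[where i = i and \<sigma> = \<sigma>, OF K \<sigma>])
  finally show ?thesis .
qed

text \<open>
Dividing by \<open>2 (\<sigma> i)\<^sup>2\<close> removes the scale: the quotient behaves like a standard Gamma variable.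
\<close>

lemma row_negative_moment:
  assumes K: "finite K" and i: "Suc i < card K" and \<sigma>: "\<sigma> i > 0"
    and pos: "\<And>j. j < i \<Longrightarrow> row_dist2 K X j > 0"
    and s: "0 < s" "s < real (card K - Suc i) / 2"
  shows "(\<integral>\<^sup>+r. ennreal (row_density K \<mu> \<beta> \<sigma> (put_row K X i r) i)
      * ennreal ((row_dist2 K (put_row K X i r) i / (2 * (\<sigma> i)\<^sup>2)) powr (- s)) \<partial>PiM K (\<lambda>_. lborel))
    = ennreal (Gamma (real (card K - Suc i) / 2 - s) / Gamma (real (card K - Suc i) / 2))"
proof -
  obtain a where row: "normal_row K (Suc i) (gs_unit (dot K) (data_rows X)) (row_mean \<mu> \<beta> X i) a (\<sigma> i)"
    and dens: "\<And>r. normal_row.dens K (row_mean \<mu> \<beta> X i) (\<sigma> i) r = row_density K \<mu> \<beta> \<sigma> (put_row K X i r) i"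
    and dist: "\<And>r. normal_row.dist2 K (Suc i) (gs_unit (dot K) (data_rows X)) r = row_dist2 K (put_row K X i r) i"
    using normal_row_of_data[where i = i and \<sigma> = \<sigma> and X = X and \<mu> = \<mu> and \<beta> = \<beta>, OF K i \<sigma> pos] by auto
  interpret normal_row K "Suc i" "gs_unit (dot K) (data_rows X)" "row_mean \<mu> \<beta> X i" a "\<sigma> i"
    by (rule row)
  let ?q = "(2 * (\<sigma> i)\<^sup>2) powr s"
  have q: "?q > 0" using \<sigma> by simp
  have scale: "(x / (2 * (\<sigma> i)\<^sup>2)) powr (- s) = ?q * x powr (- s)" if "x \<ge> 0" for x
    using that \<sigma> by (simp add: powr_divide powr_minus field_simps)
  have "(\<integral>\<^sup>+r. ennreal (dens r) * ennreal ((dist2 r / (2 * (\<sigma> i)\<^sup>2)) powr (- s)) \<partial>L)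
    = (\<integral>\<^sup>+r. ennreal ?q * (ennreal (dens r) * ennreal (dist2 r powr (- s))) \<partial>L)"
    using q by (intro nn_integral_cong) (simp add: scale dist2_nonneg ennreal_mult mult_ac)
  also have "\<dots> = ennreal ?q * (\<integral>\<^sup>+r. ennreal (dens r) * ennreal (dist2 r powr (- s)) \<partial>L)"
    by (rule nn_integral_cmult) measurable
  also have "\<dots> = ennreal (?q * ((2 * (\<sigma> i)\<^sup>2) powr (- s) * Gamma (shape - s) / Gamma shape))"
    using s q by (simp add: negative_moment shape_def ennreal_mult'[symmetric])
  also have "?q * ((2 * (\<sigma> i)\<^sup>2) powr (- s) * Gamma (shape - s) / Gamma shape) = Gamma (shape - s) / Gamma shape"
    using q by (simp add: powr_minus)
  finally show ?thesis by (simp add: dens dist shape_def)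
qed

section \<open>The risk of the bias-corrected log-determinant\<close>

lemma measurable_mvn_density:
  assumes dens: "\<And>x. mvn_density p \<mu> \<Sigma> (Matrix.vec p x)
       = (\<Prod>i<p. normal_density (m i + (\<Sum>j<i. \<beta> i j * (x j - m j))) (\<sigma> i) (x i))"
  shows "(\<lambda>x. ennreal (mvn_density p \<mu> \<Sigma> (Matrix.vec p x))) \<in> borel_measurable (PiM {..<p} (\<lambda>_. lborel))"
  unfolding dens
  by (intro measurable_compose[OF _ measurable_ennreal] borel_measurable_prod measurable_normal_density
      borel_measurable_add borel_measurable_sum borel_measurable_times borel_measurable_diff
      borel_measurable_const measurable_component_singleton[of _ "{..<p}" "\<lambda>_. lborel :: real measure", simplified]) auto

lemma sets_sample_law: "sets (sample_law n p \<mu> \<Sigma>) = sets (data_space {1..n+1} p)"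
  unfolding sample_law_def mvn_def by (intro sets_PiM_cong) auto

lemma measurable_sample_law:
  "measurable (sample_law n p \<mu> \<Sigma>) M = measurable (data_space {1..n+1} p) M"
  by (intro measurable_cong_sets sets_sample_law refl)

lemma estimator_measurable: "\<delta> \<in> estimators n p \<Longrightarrow> \<delta> \<in> borel_measurable (data_space {1..n+1} p)"
proof -
  have "sets (PiM {1..n+1} (\<lambda>k. PiM {..<p} (\<lambda>i. borel :: real measure))) = sets (data_space {1..n+1} p)"
    by (intro sets_PiM_cong) auto
  from measurable_cong_sets[OF this refl, of borel]
  show "\<delta> \<in> estimators n p \<Longrightarrow> \<delta> \<in> borel_measurable (data_space {1..n+1} p)"
    unfolding estimators_def by simp
qed

lemma nn_integral_sample_law_density:
  assumes dm: "(\<lambda>x. ennreal (mvn_density p \<mu> \<Sigma> (Matrix.vec p x))) \<in> borel_measurable (PiM {..<p} (\<lambda>_. lborel))"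
    and f: "f \<in> borel_measurable (data_space {1..n+1} p)"
  shows "(\<integral>\<^sup>+X. f X \<partial>sample_law n p \<mu> \<Sigma>)
    = (\<integral>\<^sup>+X. (\<Prod>k\<in>{1..n+1}. ennreal (mvn_density p \<mu> \<Sigma> (Matrix.vec p (X k)))) * f X \<partial>data_space {1..n+1} p)"
proof -
  have sf: "sigma_finite_measure (PiM {..<p} (\<lambda>_. lborel :: real measure))"
    by (rule sigma_finite_PiM_lborel) simp
  have "sigma_finite_measure (density (PiM {..<p} (\<lambda>_. lborel)) (\<lambda>x. ennreal (mvn_density p \<mu> \<Sigma> (Matrix.vec p x))))"
    using sigma_finite_measure.sigma_finite_iff_density_finite[OF sf dm] by simp
  from nn_integral_PiM_density[OF _ sf this dm f] show ?thesis
    unfolding sample_law_def mvn_def by simp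
qed

lemma nn_integral_sample_law_rows:
  fixes n p :: nat
  defines "K \<equiv> {1..n+1}"
  assumes dens: "\<And>x. mvn_density p \<mu> \<Sigma> (Matrix.vec p x)
       = (\<Prod>i<p. normal_density (m i + (\<Sum>j<i. \<beta> i j * (x j - m j))) (\<sigma> i) (x i))"
    and g: "\<And>i. g i \<in> borel_measurable borel"
  shows "(\<integral>\<^sup>+X. (\<Prod>i<p. g i (row_dist2 K X i)) \<partial>sample_law n p \<mu> \<Sigma>)
    = (\<integral>\<^sup>+X. (\<Prod>i<p. ennreal (row_density K m \<beta> \<sigma> X i) * g i (row_dist2 K X i)) \<partial>data_space K p)"
proof -
  have "(\<lambda>X. \<Prod>i<p. g i (row_dist2 K X i)) \<in> borel_measurable (data_space K p)"
    by (intro borel_measurable_prod_ennreal measurable_compose[OF measurable_row_dist2 g]) auto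
  note law = nn_integral_sample_law_density[OF measurable_mvn_density[OF dens] this[unfolded K_def]]
  have "(\<Prod>k\<in>K. ennreal (mvn_density p \<mu> \<Sigma> (Matrix.vec p (X k)))) = (\<Prod>i<p. ennreal (row_density K m \<beta> \<sigma> X i))"
    for X :: "nat \<Rightarrow> nat \<Rightarrow> real"
  proof -
    have "(\<Prod>k\<in>K. ennreal (mvn_density p \<mu> \<Sigma> (Matrix.vec p (X k))))
      = (\<Prod>k\<in>K. \<Prod>i<p. ennreal (normal_density (row_mean m \<beta> X i k) (\<sigma> i) (X k i)))"
      by (simp add: dens row_mean_def prod_ennreal)
    also have "\<dots> = (\<Prod>i<p. \<Prod>k\<in>K. ennreal (normal_density (row_mean m \<beta> X i k) (\<sigma> i) (X k i)))"
      by (rule prod.swap)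
    finally show ?thesis by (simp add: row_density_def prod_ennreal)
  qed
  then show ?thesis unfolding law[folded K_def] by (simp add: prod.distrib)
qed

lemma nn_integral_sample_law_rowwise:
  fixes n p :: nat and g :: "nat \<Rightarrow> real \<Rightarrow> ennreal" and c :: "nat \<Rightarrow> ennreal"
  assumes dens: "\<And>x. mvn_density p \<mu> \<Sigma> (Matrix.vec p x)
       = (\<Prod>i<p. normal_density (m i + (\<Sum>j<i. \<beta> i j * (x j - m j))) (\<sigma> i) (x i))"
    and g: "\<And>i. g i \<in> borel_measurable borel"
    and step: "\<And>X i. i < p \<Longrightarrow> (\<Prod>j<i. g j (row_dist2 {1..n+1} X j)) \<noteq> 0 \<Longrightarrow>
      (\<integral>\<^sup>+r. ennreal (row_density {1..n+1} m \<beta> \<sigma> (put_row {1..n+1} X i r) i)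
        * g i (row_dist2 {1..n+1} (put_row {1..n+1} X i r) i) \<partial>PiM {1..n+1} (\<lambda>_. lborel)) = c i"
  shows "(\<integral>\<^sup>+X. (\<Prod>i<p. g i (row_dist2 {1..n+1} X i)) \<partial>sample_law n p \<mu> \<Sigma>) = (\<Prod>i<p. c i)"
  unfolding nn_integral_sample_law_rows[where m = m and \<beta> = \<beta> and \<sigma> = \<sigma> and g = g, OF dens g]
  by (rule nn_integral_rowwise[OF _ g step]) simp_all

text \<open>
Recovers nondegeneracy of the earlier rows from the hypothesis that \<open>nn_integral_rowwise\<close> provides.
\<close>

lemma row_dist2_pos_of_prod:
  fixes g :: "nat \<Rightarrow> real \<Rightarrow> ennreal"
  assumes K: "finite K" and g: "\<And>j. g j 0 = 0"
    and nz: "(\<Prod>j<i. g j (row_dist2 K X j)) \<noteq> 0" and j: "j < i"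
  shows "row_dist2 K X j > 0"
proof -
  have "g j (row_dist2 K X j) \<noteq> 0"
  proof
    assume "g j (row_dist2 K X j) = 0"
    then have "(\<Prod>j<i. g j (row_dist2 K X j)) = 0" using j by (intro prod_zero) auto
    with nz show False by simp
  qed
  with g have "row_dist2 K X j \<noteq> 0" by metis
  then show ?thesis using row_dist2_nonneg[OF K, of X j] by simp
qed

lemma prob_space_sample_law:
  assumes S: "\<Sigma> \<in> pos_def_mats p" and \<mu>: "\<mu> \<in> carrier_vec p"
  shows "prob_space (sample_law n p \<mu> \<Sigma>)"
proof
  obtain \<beta> \<sigma> where factor: "(\<forall>i<p. \<sigma> i > 0) \<and> Determinant.det \<Sigma> = (\<Prod>i<p. (\<sigma> i)\<^sup>2) \<and>
    (\<forall>x. mvn_density p \<mu> \<Sigma> (Matrix.vec p x)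
       = (\<Prod>i<p. normal_density (\<mu> $ i + (\<Sum>j<i. \<beta> i j * (x j - \<mu> $ j))) (\<sigma> i) (x i)))"
    using mvn_density_sequential[OF S \<mu>] by (elim exE) (erule that)
  from factor have dens: "\<And>x. mvn_density p \<mu> \<Sigma> (Matrix.vec p x)
       = (\<Prod>i<p. normal_density (\<mu> $ i + (\<Sum>j<i. \<beta> i j * (x j - \<mu> $ j))) (\<sigma> i) (x i))" by simp
  have "(\<integral>\<^sup>+X. (\<Prod>i<p. 1) \<partial>sample_law n p \<mu> \<Sigma>) = (\<Prod>i<p. 1)"
    by (rule nn_integral_sample_law_rowwise[where m = "($) \<mu>" and n = n and g = "\<lambda>_ _. 1" and c = "\<lambda>_. 1", OF dens])
      (use factor in \<open>auto intro!: row_total_mass\<close>)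
  then show "emeasure (sample_law n p \<mu> \<Sigma>) (space (sample_law n p \<mu> \<Sigma>)) = 1" by simp
qed

text \<open>
\<open>Z\<close> is the estimation error. Almost surely it is the sum over \<open>i\<close> of
\<open>ln (D\<^sub>i/(2 \<sigma>\<^sub>i\<^sup>2)) - \<psi>((n-i)/2)\<close>, so \<open>exp (- s Z)\<close> is a product of negative powers of the distances
and its expectation \<open>M s\<close> is a product of Gamma ratios. The squares \<open>((1 - exp (- s Z))/s)\<^sup>2\<close> tend
to \<open>Z\<^sup>2\<close> as \<open>s\<close> decreases to \<open>0\<close>, and their expectations are second differences of \<open>M\<close>.
\<close>

lemma logdet_risk_le:
  assumes S: "\<Sigma> \<in> pos_def_mats p" and \<mu>: "\<mu> \<in> carrier_vec p" and n: "n \<ge> 1" "p \<le> n"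
  shows "(\<integral>\<^sup>+X. ennreal ((logdet_estimator n p X - ln (Determinant.det \<Sigma>))\<^sup>2) \<partial>sample_law n p \<mu> \<Sigma>)
    \<le> ennreal (\<Sum>i<p. Polygamma 1 (real (n - i) / 2))"
proof -
  obtain \<beta> \<sigma> where factor: "(\<forall>i<p. \<sigma> i > 0) \<and> Determinant.det \<Sigma> = (\<Prod>i<p. (\<sigma> i)\<^sup>2) \<and>
    (\<forall>x. mvn_density p \<mu> \<Sigma> (Matrix.vec p x)
       = (\<Prod>i<p. normal_density (\<mu> $ i + (\<Sum>j<i. \<beta> i j * (x j - \<mu> $ j))) (\<sigma> i) (x i)))"
    using mvn_density_sequential[OF S \<mu>] by (elim exE) (erule that)
  from factor have \<sigma>: "\<And>i. i < p \<Longrightarrow> \<sigma> i > 0" by simp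
  from factor have det: "Determinant.det \<Sigma> = (\<Prod>i<p. (\<sigma> i)\<^sup>2)" by simp
  from factor have dens: "\<And>x. mvn_density p \<mu> \<Sigma> (Matrix.vec p x)
       = (\<Prod>i<p. normal_density (\<mu> $ i + (\<Sum>j<i. \<beta> i j * (x j - \<mu> $ j))) (\<sigma> i) (x i))" by simp
  define P where "P = sample_law n p \<mu> \<Sigma>"
  define K where "K = {1..n+1}"
  have K: "finite K" "card K = n + 1" by (simp_all add: K_def)
  define a where "a i = real (n - i) / 2" for i
  have a: "a i \<ge> 1 / 2" if "i < p" for i using that n by (simp add: a_def)
  have cardK: "Suc i < card K" "real (card K - Suc i) / 2 = a i" if "i < p" for i
    using that n K by (auto simp: a_def)
  define M where "M s = (\<Prod>i\<in>{..<p}. exp (s * Digamma (a i)) * Gamma (a i - s) / Gamma (a i))" for s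
  define Z where "Z X = logdet_estimator n p X - ln (Determinant.det \<Sigma>)" for X
  have Zm [measurable]: "Z \<in> borel_measurable P"
    unfolding Z_def[abs_def] P_def measurable_sample_law
    by (intro borel_measurable_diff estimator_measurable logdet_estimator_in_estimators borel_measurable_const)
  note integral = nn_integral_sample_law_rowwise[where m = "($) \<mu>" and n = n, OF dens, folded K_def P_def]
  interpret P: prob_space P unfolding P_def by (rule prob_space_sample_law[OF S \<mu>])
  have row_m: "(\<lambda>X. row_dist2 K X i) \<in> borel_measurable P" if "i < p" for i
    unfolding P_def measurable_sample_law K_def using that by (rule measurable_row_dist2)
  (* The sample covariance is almost surely nonsingular. *)
  have pos: "AE X in P. \<forall>i<p. row_dist2 K X i > 0"
  proof -
    let ?A = "{X \<in> space P. \<forall>i<p. row_dist2 K X i > 0}"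
    have "{X \<in> space P. \<forall>i\<in>{..<p}. row_dist2 K X i > 0} \<in> sets P"
      by (intro sets.sets_Collect_finite_All borel_measurable_less row_m) auto
    then have A: "?A \<in> sets P" unfolding Ball_def lessThan_iff .
    have ind: "(\<Prod>i<p. indicator {0<..} (row_dist2 K X i)) = (indicator ?A X :: ennreal)"
      if X: "X \<in> space P" for X
    proof (cases "\<forall>i<p. row_dist2 K X i > 0")
      case True
      then have "(\<Prod>i<p. (indicator {0<..} (row_dist2 K X i) :: ennreal)) = (\<Prod>i<p. 1)"
        by (intro prod.cong) auto
      then show ?thesis using True X by simp
    next
      case False
      then have "(\<Prod>i<p. (indicator {0<..} (row_dist2 K X i) :: ennreal)) = 0"
        by (intro prod_zero) (auto simp: indicator_def)
      then show ?thesis using False by simp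
    qed
    have "(\<integral>\<^sup>+X. (\<Prod>i<p. indicator {0<..} (row_dist2 K X i)) \<partial>P) = (\<Prod>i<p. 1)"
    proof (rule integral[where g = "\<lambda>_. indicator {0<..}" and c = "\<lambda>_. 1"])
      fix X i assume i: "i < p" and nz: "(\<Prod>j<i. indicator {0<..} (row_dist2 K X j) :: ennreal) \<noteq> 0"
      have D: "row_dist2 K X j > 0" if "j < i" for j
        using nz that by (intro row_dist2_pos_of_prod[where g = "\<lambda>_. indicator {0<..}" and i = i, OF K(1)]) auto
      show "(\<integral>\<^sup>+r. ennreal (row_density K (($) \<mu>) \<beta> \<sigma> (put_row K X i r) i)
          * indicator {0<..} (row_dist2 K (put_row K X i r) i) \<partial>PiM K (\<lambda>_. lborel)) = 1"
        by (rule row_dist2_pos_mass[where i = i and \<sigma> = \<sigma> and X = X, OF K(1) cardK(1)[OF i] \<sigma>[OF i] D])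
    qed simp
    also have "(\<integral>\<^sup>+X. (\<Prod>i<p. indicator {0<..} (row_dist2 K X i)) \<partial>P) = (\<integral>\<^sup>+X. indicator ?A X \<partial>P)"
      by (intro nn_integral_cong ind)
    also have "\<dots> = emeasure P ?A" by (rule nn_integral_indicator[OF A])
    finally have "P.prob ?A = 1" by (simp add: P.emeasure_eq_measure)
    then have "AE X in P. X \<in> ?A" using P.AE_in_set_eq_1[OF A] by simp
    then show ?thesis by eventually_elim simp
  qed
  have exp_Z: "exp (- s * Z X) = (\<Prod>i<p. (row_dist2 K X i / (2 * (\<sigma> i)\<^sup>2)) powr (- s) * exp (s * Digamma (a i)))"
    if "\<forall>i<p. row_dist2 K X i > 0" for X s
  proof -
    have pw: "exp (- s * (ln x - d)) = x powr (- s) * exp (s * d)" if "x > 0" for x d :: real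
      using that by (simp add: powr_def exp_add[symmetric] algebra_simps)
    have bias: "bias_correction n p = (\<Sum>i<p. Digamma (a i) - ln (real n / 2))"
      unfolding bias_correction_def
      by (rule sum.reindex_bij_witness[of _ "\<lambda>i. Suc i" "\<lambda>k. k - 1"])
        (use n in \<open>auto simp: a_def of_nat_diff algebra_simps\<close>)
    have "ln (Determinant.det (sample_cov n p X)) = (\<Sum>i<p. ln (row_dist2 K X i / real n))"
      unfolding det_sample_cov[OF n(1)] K_def row_dist2_def[symmetric]
      using that n by (intro ln_prod) (auto simp: K_def)
    moreover have "ln (Determinant.det \<Sigma>) = (\<Sum>i<p. ln ((\<sigma> i)\<^sup>2))"
      unfolding det by (intro ln_prod) (auto dest: \<sigma>)
    ultimately have "Z X = (\<Sum>i<p. ln (row_dist2 K X i / real n) - (Digamma (a i) - ln (real n / 2)) - ln ((\<sigma> i)\<^sup>2))"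
      by (simp add: Z_def logdet_estimator_def bias sum_subtractf)
    also have "\<dots> = (\<Sum>i<p. ln (row_dist2 K X i / (2 * (\<sigma> i)\<^sup>2)) - Digamma (a i))"
    proof (intro sum.cong refl)
      fix i assume "i \<in> {..<p}"
      then have "row_dist2 K X i > 0" "\<sigma> i > 0" using that \<sigma> by auto
      then show "ln (row_dist2 K X i / real n) - (Digamma (a i) - ln (real n / 2)) - ln ((\<sigma> i)\<^sup>2)
        = ln (row_dist2 K X i / (2 * (\<sigma> i)\<^sup>2)) - Digamma (a i)"
        using n by (simp add: ln_div ln_mult)
    qed
    finally have "- s * Z X = (\<Sum>i<p. - s * (ln (row_dist2 K X i / (2 * (\<sigma> i)\<^sup>2)) - Digamma (a i)))"
      by (simp add: sum_distrib_left)
    then have "exp (- s * Z X) = (\<Prod>i<p. exp (- s * (ln (row_dist2 K X i / (2 * (\<sigma> i)\<^sup>2)) - Digamma (a i))))"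
      by (simp add: exp_sum)
    also have "\<dots> = (\<Prod>i<p. (row_dist2 K X i / (2 * (\<sigma> i)\<^sup>2)) powr (- s) * exp (s * Digamma (a i)))"
    proof (intro prod.cong refl)
      fix i assume "i \<in> {..<p}"
      then have "row_dist2 K X i / (2 * (\<sigma> i)\<^sup>2) > 0" using that \<sigma>[of i] by auto
      then show "exp (- s * (ln (row_dist2 K X i / (2 * (\<sigma> i)\<^sup>2)) - Digamma (a i)))
        = (row_dist2 K X i / (2 * (\<sigma> i)\<^sup>2)) powr (- s) * exp (s * Digamma (a i))"
        by (rule pw)
    qed
    finally show ?thesis .
  qed
  have M_nonneg: "M s \<ge> 0" if "s < 1 / 2" for s
    unfolding M_def
  proof (intro prod_nonneg)
    fix i assume "i \<in> {..<p}"
    then have "a i > 0" "a i - s > 0" using a[of i] that by auto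
    then show "exp (s * Digamma (a i)) * Gamma (a i - s) / Gamma (a i) \<ge> 0"
      by (simp add: Gamma_real_pos less_imp_le)
  qed
  have mgf: "has_bochner_integral P (\<lambda>X. exp (- s * Z X)) (M s)" if s: "0 < s" "s < 1 / 2" for s
  proof (rule has_bochner_integral_nn_integral)
    let ?E = "\<Prod>i<p. exp (s * Digamma (a i))"
    let ?g = "\<lambda>i x. ennreal ((x / (2 * (\<sigma> i)\<^sup>2)) powr (- s))"
    have "(\<integral>\<^sup>+X. ennreal (exp (- s * Z X)) \<partial>P) = (\<integral>\<^sup>+X. ennreal ?E * (\<Prod>i<p. ?g i (row_dist2 K X i)) \<partial>P)"
      using pos
    proof (intro nn_integral_cong_AE, eventually_elim)
      case (elim X)
      have "exp (- s * Z X) = ?E * (\<Prod>i<p. (row_dist2 K X i / (2 * (\<sigma> i)\<^sup>2)) powr (- s))"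
        unfolding exp_Z[OF elim(2)] prod.distrib by (rule mult.commute)
      then show ?case
        by (simp only:) (intro ennreal_mult_prod prod_nonneg, auto)
    qed
    also have "\<dots> = ennreal ?E * (\<integral>\<^sup>+X. (\<Prod>i<p. ?g i (row_dist2 K X i)) \<partial>P)"
    proof (intro nn_integral_cmult borel_measurable_prod_ennreal)
      fix i assume "i \<in> {..<p}"
      then have [measurable]: "(\<lambda>X. row_dist2 K X i) \<in> borel_measurable P" by (intro row_m) simp
      show "(\<lambda>X. ?g i (row_dist2 K X i)) \<in> borel_measurable P" by measurable
    qed
    also have "(\<integral>\<^sup>+X. (\<Prod>i<p. ?g i (row_dist2 K X i)) \<partial>P) = (\<Prod>i<p. ennreal (Gamma (a i - s) / Gamma (a i)))"
    proof (rule integral[where g = ?g])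
      fix X i
      assume i: "i < p" and nz: "(\<Prod>j<i. ?g j (row_dist2 K X j)) \<noteq> 0"
      have D: "row_dist2 K X j > 0" if "j < i" for j
        using nz that by (intro row_dist2_pos_of_prod[where g = ?g and i = i, OF K(1)]) auto
      have sl: "s < real (card K - Suc i) / 2"
        unfolding cardK(2)[OF i] using a[OF i] s by linarith
      show "(\<integral>\<^sup>+r. ennreal (row_density K (($) \<mu>) \<beta> \<sigma> (put_row K X i r) i)
          * ?g i (row_dist2 K (put_row K X i r) i) \<partial>PiM K (\<lambda>_. lborel))
        = ennreal (Gamma (a i - s) / Gamma (a i))"
        by (rule row_negative_moment[where i = i and \<sigma> = \<sigma> and X = X,
              OF K(1) cardK(1)[OF i] \<sigma>[OF i] D s(1) sl, unfolded cardK(2)[OF i]])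
    qed measurable
    also have "ennreal ?E * \<dots> = ennreal (?E * (\<Prod>i<p. Gamma (a i - s) / Gamma (a i)))"
    proof (intro ennreal_mult_prod[symmetric] prod_nonneg)
      fix i assume "i \<in> {..<p}"
      then have "a i > 0" "a i - s > 0" using a[of i] s by auto
      then show "Gamma (a i - s) / Gamma (a i) \<ge> 0" by (simp add: Gamma_real_pos less_imp_le)
    qed simp
    also have "?E * (\<Prod>i<p. Gamma (a i - s) / Gamma (a i)) = M s"
      by (simp add: M_def prod.distrib[symmetric])
    finally show "(\<integral>\<^sup>+X. ennreal (exp (- s * Z X)) \<partial>P) = ennreal (M s)" .
  qed (use M_nonneg s in auto)
  define \<Delta> where "\<Delta> s = (1 - 2 * M s + M (2 * s)) / s\<^sup>2" for s
  have second: "(\<integral>\<^sup>+X. ennreal (((1 - exp (- s * Z X)) / s)\<^sup>2) \<partial>P) = ennreal (\<Delta> s)" if s: "0 < s" "s < 1 / 4" for s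
  proof -
    have "has_bochner_integral P (\<lambda>X. (1 - 2 * exp (- s * Z X) + exp (- (2 * s) * Z X)) / s\<^sup>2) (\<Delta> s)"
      unfolding \<Delta>_def using s P.prob_space
      by (intro has_bochner_integral_divide_zero has_bochner_integral_add has_bochner_integral_diff
          has_bochner_integral_mult_right mgf) (auto simp: has_bochner_integral_iff)
    moreover have "(1 - 2 * exp (- s * Z X) + exp (- (2 * s) * Z X)) / s\<^sup>2 = ((1 - exp (- s * Z X)) / s)\<^sup>2" for X
    proof -
      have "exp (- (2 * s) * Z X) = (exp (- s * Z X))\<^sup>2"
        by (simp add: exp_double[symmetric] mult.assoc)
      then show ?thesis by (simp add: power_divide power2_diff)
    qed
    ultimately have "has_bochner_integral P (\<lambda>X. ((1 - exp (- s * Z X)) / s)\<^sup>2) (\<Delta> s)" by simp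
    then show ?thesis
      using nn_integral_eq_integral[of P "\<lambda>X. ((1 - exp (- s * Z X)) / s)\<^sup>2"]
      by (simp add: has_bochner_integral_iff)
  qed
  (* The shift by 5 keeps 2 h j below 1/2, the smallest possible shape, so that M (2 h j) is a moment. *)
  define h where "h j = 1 / (real j + 5)" for j
  have h: "0 < h j" "h j < 1 / 4" for j by (auto simp: h_def field_simps)
  have h0: "filterlim h (at_right 0) sequentially" unfolding h_def by real_asymp
  have "(\<integral>\<^sup>+X. ennreal ((Z X)\<^sup>2) \<partial>P) = (\<integral>\<^sup>+X. liminf (\<lambda>j. ennreal (((1 - exp (- h j * Z X)) / h j)\<^sup>2)) \<partial>P)"
  proof (intro nn_integral_cong)
    fix X
    have "((\<lambda>s. exp (- s * Z X)) has_real_derivative - Z X) (at 0)"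
      by (auto intro!: derivative_eq_intros)
    then have "((\<lambda>s. (exp (- s * Z X) - 1) / s) \<longlongrightarrow> - Z X) (at_right 0)"
      by (simp add: has_field_derivative_iff filterlim_at_split)
    from filterlim_compose[OF this h0]
    have "(\<lambda>j. (exp (- h j * Z X) - 1) / h j) \<longlonglongrightarrow> - Z X" .
    from tendsto_power[OF this, of 2]
    have "(\<lambda>j. ((exp (- h j * Z X) - 1) / h j)\<^sup>2) \<longlonglongrightarrow> (Z X)\<^sup>2" by simp
    then have "(\<lambda>j. ((1 - exp (- h j * Z X)) / h j)\<^sup>2) \<longlonglongrightarrow> (Z X)\<^sup>2"
      by (simp add: power_divide power2_commute)
    from lim_imp_Liminf[OF _ tendsto_ennrealI[OF this]]
    show "ennreal ((Z X)\<^sup>2) = liminf (\<lambda>j. ennreal (((1 - exp (- h j * Z X)) / h j)\<^sup>2))" by simp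
  qed
  also have "\<dots> \<le> liminf (\<lambda>j. \<integral>\<^sup>+X. ennreal (((1 - exp (- h j * Z X)) / h j)\<^sup>2) \<partial>P)"
    by (rule nn_integral_liminf) measurable
  also have "\<dots> = liminf (\<lambda>j. ennreal (\<Delta> (h j)))"
    by (simp only: second[OF h])
  also have "\<dots> = ennreal (\<Sum>i<p. Polygamma 1 (a i))"
  proof -
    have "((\<lambda>s. \<Delta> s) \<longlongrightarrow> (\<Sum>i\<in>{..<p}. Polygamma 1 (a i))) (at_right 0)"
      unfolding \<Delta>_def
    proof (rule gamma_ratio_second_difference[where r = "1 / 4"])
      show "a i > 1 / 4" if "i \<in> {..<p}" for i using a[of i] that by simp
    qed (simp_all add: M_def)
    from tendsto_ennrealI[OF filterlim_compose[OF this h0]] show ?thesis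
      by (intro lim_imp_Liminf) auto
  qed
  finally show ?thesis unfolding Z_def P_def a_def .
qed

lemma max_risk_logdet_le:
  assumes "n \<ge> 1" "p \<le> n"
  shows "max_risk n p (logdet_estimator n p) \<le> ennreal (\<Sum>i<p. Polygamma 1 (real (n - i) / 2))"
  unfolding max_risk_def using assms by (intro SUP_least logdet_risk_le)

section \<open>The Bayesian lower bound\<close>

lemma smult_one_mat_vec:
  fixes v :: "real Matrix.vec"
  assumes v: "v \<in> carrier_vec p"
  shows "(c \<cdot>\<^sub>m 1\<^sub>m p) *\<^sub>v v = c \<cdot>\<^sub>v v"
proof (rule eq_vecI)
  fix i assume "i < dim_vec (c \<cdot>\<^sub>v v)"
  then have i: "i < p" using v by simp
  have "((c \<cdot>\<^sub>m 1\<^sub>m p) *\<^sub>v v) $ i = (\<Sum>j<p. c * (if j = i then 1 else 0) * v $ j)"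
    using i v by (simp add: scalar_prod_def atLeast0LessThan)
  also have "\<dots> = (\<Sum>j<p. if j = i then c * v $ j else 0)" by (intro sum.cong) auto
  finally show "((c \<cdot>\<^sub>m 1\<^sub>m p) *\<^sub>v v) $ i = (c \<cdot>\<^sub>v v) $ i" using i v by simp
qed (use v in simp)

lemma mvn_density_isotropic:
  assumes l: "l > 0"
  shows "(1 / l) \<cdot>\<^sub>m 1\<^sub>m p \<in> pos_def_mats p" (is "?S \<in> _")
    and "Determinant.det ((1 / l) \<cdot>\<^sub>m 1\<^sub>m p :: real mat) = (1 / l) ^ p"
    and "mvn_density p (0\<^sub>v p) ((1 / l) \<cdot>\<^sub>m 1\<^sub>m p) (Matrix.vec p x)
      = 1 / sqrt ((2 * pi) ^ p) * l powr (real p / 2) * exp (- l * (\<Sum>i<p. (x i)\<^sup>2) / 2)"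
proof -
  have S: "?S \<in> carrier_mat p p" by simp
  show pd: "?S \<in> pos_def_mats p"
    unfolding pos_def_mats_def
  proof (intro CollectI conjI ballI impI S)
    show "?S\<^sup>T = ?S" by (intro eq_matI) auto
    fix v :: "real Matrix.vec" assume v: "v \<in> carrier_vec p" "v \<noteq> 0\<^sub>v p"
    then obtain i where i: "i < p" "v $ i \<noteq> 0" by (metis carrier_vecD eq_vecI index_zero_vec)
    have "?S *\<^sub>v v = (1 / l) \<cdot>\<^sub>v v"
      using v by (simp add: smult_one_mat_vec)
    then have "scalar_prod v (?S *\<^sub>v v) = (1 / l) * (\<Sum>i<p. (v $ i)\<^sup>2)"
      using v by (simp add: scalar_prod_def atLeast0LessThan power2_eq_square sum_divide_distrib)
    moreover have "(\<Sum>i<p. (v $ i)\<^sup>2) > 0" using i by (intro sum_pos2[of _ i]) auto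
    ultimately show "scalar_prod v (?S *\<^sub>v v) > 0" using l by simp
  qed
  show det: "Determinant.det ?S = (1 / l) ^ p" by (simp add: det_smult)
  have "?S * (l \<cdot>\<^sub>m 1\<^sub>m p) = 1\<^sub>m p"
    using l by (intro eq_matI) (auto simp: mult_smult_distrib[of _ p p] mult_smult_assoc_mat[of _ p p])
  then have inv: "mat_inverse ?S = Some (l \<cdot>\<^sub>m 1\<^sub>m p)"
    by (intro mat_inverse_eqI[OF S]) auto
  have x0: "Matrix.vec p x - 0\<^sub>v p = Matrix.vec p x" by auto
  have "scalar_prod (Matrix.vec p x) ((l \<cdot>\<^sub>m 1\<^sub>m p) *\<^sub>v Matrix.vec p x) = l * (\<Sum>i<p. (x i)\<^sup>2)"
  proof -
    have "(l \<cdot>\<^sub>m 1\<^sub>m p) *\<^sub>v Matrix.vec p x = l \<cdot>\<^sub>v Matrix.vec p x"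
      by (simp add: smult_one_mat_vec)
    then show ?thesis
      by (simp add: scalar_prod_def atLeast0LessThan power2_eq_square sum_distrib_left mult_ac)
  qed
  moreover have "sqrt ((2 * pi) ^ p * (1 / l) ^ p) = sqrt ((2 * pi) ^ p) / l powr (real p / 2)"
  proof -
    have "l powr (real p / 2) = sqrt (l ^ p)"
      using l by (simp add: powr_half_sqrt[symmetric] powr_realpow[symmetric] powr_powr)
    then show ?thesis by (simp add: real_sqrt_divide power_one_over real_sqrt_mult)
  qed
  ultimately show "mvn_density p (0\<^sub>v p) ?S (Matrix.vec p x)
      = 1 / sqrt ((2 * pi) ^ p) * l powr (real p / 2) * exp (- l * (\<Sum>i<p. (x i)\<^sup>2) / 2)"
    unfolding mvn_density_def x0 inv det by simp
qed

lemma sigma_finite_data_space: "finite K \<Longrightarrow> sigma_finite_measure (data_space K p)"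
proof -
  assume K: "finite K"
  interpret product_sigma_finite "\<lambda>_. PiM {..<p} (\<lambda>_. lborel :: real measure)"
    by (simp add: product_sigma_finite_def sigma_finite_PiM_lborel)
  show ?thesis by (rule sigma_finite[OF K])
qed

text \<open>
The prior is the exponential distribution on the precision \<open>l\<close>, that is \<open>gamma_kernel 1 1\<close>, and \<open>w\<close>
is the joint density of the data and \<open>l\<close>. For fixed data \<open>w\<close> is a Gamma kernel in \<open>l\<close> whose shape
\<open>\<alpha>\<close> depends on the sample size alone, so the posterior risk has the same lower bound for all data.
\<close>

lemma minimax_risk_lower_bound:
  assumes p: "p \<ge> 1"
  shows "ennreal (2 * real p / (real n + 3)) \<le> minimax_risk n p"
  unfolding minimax_risk_def
proof (rule INF_greatest)
  fix \<delta> assume \<delta>: "\<delta> \<in> estimators n p"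
  define K where "K = {1..n+1}"
  let ?X = "data_space K p"
  have K: "finite K" "card K = n + 1" by (simp_all add: K_def)
  (* p (n + 1) Gaussian entries contribute 1/2 each to the shape, and the prior contributes 1. *)
  define \<alpha> where "\<alpha> = real p * real (n + 1) / 2 + 1"
  have \<alpha>: "\<alpha> > 0" by (simp add: \<alpha>_def add_nonneg_pos)
  define C where "C = (1 / sqrt ((2 * pi) ^ p)) ^ (n + 1)"
  have C: "C \<ge> 0" by (simp add: C_def)
  define S where "S X = (\<Sum>k\<in>K. \<Sum>i<p. (X k i)\<^sup>2)" for X :: "nat \<Rightarrow> nat \<Rightarrow> real"
  have S_nonneg: "S X \<ge> 0" for X by (simp add: S_def sum_nonneg)
  have [measurable]: "S \<in> borel_measurable ?X"
    unfolding S_def[abs_def] by (intro borel_measurable_sum borel_measurable_power measurable_entry) auto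
  have [measurable]: "\<delta> \<in> borel_measurable ?X"
    unfolding K_def by (rule estimator_measurable[OF \<delta>])
  interpret X: sigma_finite_measure ?X by (rule sigma_finite_data_space[OF K(1)])
  interpret LX: pair_sigma_finite "lborel :: real measure" ?X ..
  let ?L = "\<lambda>l. sample_law n p (0\<^sub>v p) ((1 / l) \<cdot>\<^sub>m 1\<^sub>m p)"
  define w where "w X l = C * gamma_kernel \<alpha> (1 + S X / 2) l" for X l
  have w_nonneg: "w X l \<ge> 0" for X l by (simp add: w_def C)
  have [measurable]: "(\<lambda>(l, X). w X l) \<in> borel_measurable (lborel \<Otimes>\<^sub>M ?X)"
    unfolding w_def by measurable
  have law: "ennreal (gamma_kernel 1 1 l) * (\<integral>\<^sup>+X. f X \<partial>?L l) = (\<integral>\<^sup>+X. ennreal (w X l) * f X \<partial>?X)"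
    if f: "f \<in> borel_measurable ?X" and l: "l > 0" for f l
  proof -
    note dens = mvn_density_isotropic(3)[OF l, of p]
    have dm: "(\<lambda>x. ennreal (mvn_density p (0\<^sub>v p) ((1 / l) \<cdot>\<^sub>m 1\<^sub>m p) (Matrix.vec p x)))
        \<in> borel_measurable (PiM {..<p} (\<lambda>_. lborel))"
      unfolding dens by measurable
    have "(\<Prod>k\<in>K. mvn_density p (0\<^sub>v p) ((1 / l) \<cdot>\<^sub>m 1\<^sub>m p) (Matrix.vec p (X k)))
        = C * l powr (\<alpha> - 1) * exp (- l * S X / 2)" for X
    proof -
      have "(\<Prod>k\<in>K. mvn_density p (0\<^sub>v p) ((1 / l) \<cdot>\<^sub>m 1\<^sub>m p) (Matrix.vec p (X k)))
        = C * (l powr (real p / 2)) ^ (n + 1) * (\<Prod>k\<in>K. exp (- l * (\<Sum>i<p. (X k i)\<^sup>2) / 2))"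
        unfolding dens prod.distrib prod_constant K C_def ..
      also have "(l powr (real p / 2)) ^ (n + 1) = l powr (\<alpha> - 1)"
        using l by (simp only: powr_realpow[symmetric] powr_gt_zero powr_powr) (simp add: \<alpha>_def)
      also have "(\<Prod>k\<in>K. exp (- l * (\<Sum>i<p. (X k i)\<^sup>2) / 2)) = exp (- l * S X / 2)"
        unfolding exp_sum[OF K(1), symmetric] S_def by (simp add: sum_distrib_left sum_divide_distrib sum_negf)
      finally show ?thesis .
    qed
    then have prod: "(\<Prod>k\<in>K. ennreal (mvn_density p (0\<^sub>v p) ((1 / l) \<cdot>\<^sub>m 1\<^sub>m p) (Matrix.vec p (X k))))
        = ennreal (C * l powr (\<alpha> - 1) * exp (- l * S X / 2))" for X
      using l by (subst prod_ennreal) (simp_all add: dens)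
    have "(\<integral>\<^sup>+X. f X \<partial>?L l) = (\<integral>\<^sup>+X. ennreal (C * l powr (\<alpha> - 1) * exp (- l * S X / 2)) * f X \<partial>?X)"
      using nn_integral_sample_law_density[OF dm f[unfolded K_def]] unfolding K_def[symmetric] prod .
    then have "ennreal (gamma_kernel 1 1 l) * (\<integral>\<^sup>+X. f X \<partial>?L l)
      = (\<integral>\<^sup>+X. ennreal (gamma_kernel 1 1 l) * (ennreal (C * l powr (\<alpha> - 1) * exp (- l * S X / 2)) * f X) \<partial>?X)"
      using f by (simp add: nn_integral_cmult)
    also have "\<dots> = (\<integral>\<^sup>+X. ennreal (w X l) * f X \<partial>?X)"
    proof (intro nn_integral_cong)
      fix X
      have "gamma_kernel 1 1 l * (C * l powr (\<alpha> - 1) * exp (- l * S X / 2)) = w X l"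
      proof -
        have "exp (- (1 + S X / 2) * l) = exp (- 1 * l) * exp (- l * S X / 2)"
          unfolding exp_add[symmetric] by (simp add: algebra_simps)
        then show ?thesis using l by (simp add: w_def gamma_kernel_def)
      qed
      then show "ennreal (gamma_kernel 1 1 l) * (ennreal (C * l powr (\<alpha> - 1) * exp (- l * S X / 2)) * f X)
        = ennreal (w X l) * f X"
        using C by (simp only: mult.assoc[symmetric] ennreal_mult[symmetric] gamma_kernel_nonneg
          mult_nonneg_nonneg powr_ge_zero exp_ge_zero)
    qed
    finally show ?thesis .
  qed
  have prior: "(\<integral>\<^sup>+l. ennreal (gamma_kernel 1 1 l) \<partial>lborel) = 1"
    by (simp add: nn_integral_gamma_kernel)
  have risk: "(\<integral>\<^sup>+X. ennreal ((\<delta> X + real p * ln l)\<^sup>2) \<partial>?L l) \<le> max_risk n p \<delta>" if l: "l > 0" for l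
  proof -
    have "ln (Determinant.det ((1 / l) \<cdot>\<^sub>m 1\<^sub>m p :: real mat)) = - real p * ln l"
      unfolding mvn_density_isotropic(2)[OF l] using l by (simp add: ln_realpow ln_div)
    then have "(\<integral>\<^sup>+X. ennreal ((\<delta> X + real p * ln l)\<^sup>2) \<partial>?L l)
      = (\<integral>\<^sup>+X. ennreal ((\<delta> X - ln (Determinant.det ((1 / l) \<cdot>\<^sub>m 1\<^sub>m p :: real mat)))\<^sup>2) \<partial>?L l)"
      by simp
    also have "\<dots> \<le> max_risk n p \<delta>"
      unfolding max_risk_def
      by (rule SUP_upper2[where i = "0\<^sub>v p"], simp, rule SUP_upper[OF mvn_density_isotropic(1)[OF l]])
    finally show ?thesis .
  qed
  have mass: "(\<integral>\<^sup>+X. ennreal (w X l) \<partial>?X) = ennreal (gamma_kernel 1 1 l)" for l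
  proof (cases "l > 0")
    case True
    interpret prob_space "?L l"
      using mvn_density_isotropic(1)[OF True] by (intro prob_space_sample_law) auto
    show ?thesis using law[of "\<lambda>_. 1", OF _ True] emeasure_space_1 by simp
  qed (simp add: w_def gamma_kernel_def)
  have bayes: "ennreal ((real p)\<^sup>2 / \<alpha>) * (\<integral>\<^sup>+l. ennreal (w X l) \<partial>lborel)
      \<le> (\<integral>\<^sup>+l. ennreal (w X l) * ennreal ((\<delta> X + real p * ln l)\<^sup>2) \<partial>lborel)" for X
  proof -
    let ?g = "\<lambda>l. gamma_kernel \<alpha> (1 + S X / 2) l"
    have b: "1 + S X / 2 > 0" using S_nonneg[of X] by simp
    have "ennreal ((real p)\<^sup>2 / \<alpha>) * (\<integral>\<^sup>+l. ennreal (w X l) \<partial>lborel)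
      = ennreal (C * (real p)\<^sup>2) * (ennreal (1 / \<alpha>) * (\<integral>\<^sup>+l. ennreal (?g l) \<partial>lborel))"
    proof -
      have "(\<integral>\<^sup>+l. ennreal (w X l) \<partial>lborel) = ennreal C * (\<integral>\<^sup>+l. ennreal (?g l) \<partial>lborel)"
        unfolding w_def using C by (simp add: ennreal_mult nn_integral_cmult)
      moreover have "ennreal ((real p)\<^sup>2 / \<alpha>) * ennreal C = ennreal (C * (real p)\<^sup>2) * ennreal (1 / \<alpha>)"
        using C \<alpha> by (simp add: ennreal_mult[symmetric] mult_ac)
      ultimately show ?thesis by (simp only: mult.assoc[symmetric])
    qed
    also have "\<dots> \<le> ennreal (C * (real p)\<^sup>2) * (\<integral>\<^sup>+l. ennreal ((\<delta> X / real p + ln l)\<^sup>2 * ?g l) \<partial>lborel)"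
      by (intro mult_left_mono gamma_log_variance_lower_bound \<alpha> b) simp
    also have "\<dots> = (\<integral>\<^sup>+l. ennreal (C * (real p)\<^sup>2) * ennreal ((\<delta> X / real p + ln l)\<^sup>2 * ?g l) \<partial>lborel)"
      by (rule nn_integral_cmult[symmetric]) measurable
    also have "\<dots> = (\<integral>\<^sup>+l. ennreal (w X l) * ennreal ((\<delta> X + real p * ln l)\<^sup>2) \<partial>lborel)"
    proof (intro nn_integral_cong)
      fix l :: real
      have "\<delta> X + real p * ln l = real p * (\<delta> X / real p + ln l)" using p by (simp add: field_simps)
      then have "(\<delta> X + real p * ln l)\<^sup>2 = (real p)\<^sup>2 * (\<delta> X / real p + ln l)\<^sup>2"
        by (simp only: power_mult_distrib)
      then have "w X l * (\<delta> X + real p * ln l)\<^sup>2 = C * (real p)\<^sup>2 * ((\<delta> X / real p + ln l)\<^sup>2 * ?g l)"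
        by (simp add: w_def mult_ac)
      then show "ennreal (C * (real p)\<^sup>2) * ennreal ((\<delta> X / real p + ln l)\<^sup>2 * ?g l)
        = ennreal (w X l) * ennreal ((\<delta> X + real p * ln l)\<^sup>2)"
        using C w_nonneg[of X l] by (subst (1 2) ennreal_mult[symmetric]) auto
    qed
    finally show ?thesis .
  qed
  have "ennreal ((real p)\<^sup>2 / \<alpha>) = ennreal ((real p)\<^sup>2 / \<alpha>) * (\<integral>\<^sup>+l. \<integral>\<^sup>+X. ennreal (w X l) \<partial>?X \<partial>lborel)"
    by (simp add: mass prior)
  also have "(\<integral>\<^sup>+l. \<integral>\<^sup>+X. ennreal (w X l) \<partial>?X \<partial>lborel) = (\<integral>\<^sup>+X. \<integral>\<^sup>+l. ennreal (w X l) \<partial>lborel \<partial>?X)"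
    by (rule LX.Fubini'[symmetric]) measurable
  also have "ennreal ((real p)\<^sup>2 / \<alpha>) * \<dots> = (\<integral>\<^sup>+X. ennreal ((real p)\<^sup>2 / \<alpha>) * (\<integral>\<^sup>+l. ennreal (w X l) \<partial>lborel) \<partial>?X)"
    by (rule nn_integral_cmult[symmetric]) measurable
  also have "\<dots> \<le> (\<integral>\<^sup>+X. \<integral>\<^sup>+l. ennreal (w X l) * ennreal ((\<delta> X + real p * ln l)\<^sup>2) \<partial>lborel \<partial>?X)"
    by (intro nn_integral_mono bayes)
  also have "\<dots> = (\<integral>\<^sup>+l. \<integral>\<^sup>+X. ennreal (w X l) * ennreal ((\<delta> X + real p * ln l)\<^sup>2) \<partial>?X \<partial>lborel)"
    by (rule LX.Fubini') measurable
  also have "\<dots> \<le> (\<integral>\<^sup>+l. ennreal (gamma_kernel 1 1 l) * max_risk n p \<delta> \<partial>lborel)"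
  proof (intro nn_integral_mono)
    fix l :: real
    show "(\<integral>\<^sup>+X. ennreal (w X l) * ennreal ((\<delta> X + real p * ln l)\<^sup>2) \<partial>?X) \<le> ennreal (gamma_kernel 1 1 l) * max_risk n p \<delta>"
    proof (cases "l > 0")
      case True
      then show ?thesis
        by (subst law[symmetric]) (auto intro!: mult_left_mono risk)
    qed (simp add: w_def gamma_kernel_def)
  qed
  also have "\<dots> = max_risk n p \<delta>" by (simp add: nn_integral_multc prior)
  finally have "ennreal ((real p)\<^sup>2 / \<alpha>) \<le> max_risk n p \<delta>" .
  moreover have "2 * real p / (real n + 3) \<le> (real p)\<^sup>2 / \<alpha>"
  proof -
    have "2 * \<alpha> = real p * (real n + 1) + 2" by (simp add: \<alpha>_def add.commute)
    also have "\<dots> \<le> real p * (real n + 3)" using p by (simp add: algebra_simps)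
    finally have "2 * \<alpha> \<le> real p * (real n + 3)" .
    then have "2 * real p * \<alpha> \<le> (real p)\<^sup>2 * (real n + 3)"
      using mult_left_mono[of "2 * \<alpha>" "real p * (real n + 3)" "real p"] by (simp add: power2_eq_square mult_ac)
    then show ?thesis using \<alpha> by (simp add: field_simps)
  qed
  ultimately show "ennreal (2 * real p / (real n + 3)) \<le> max_risk n p \<delta>"
    by (meson ennreal_leI order.trans)
qed

theorem theorem4:
  fixes p :: "nat \<Rightarrow> nat"
  assumes p_bounds: "\<And>n. n \<ge> 1 \<Longrightarrow> 1 \<le> p n \<and> p n \<le> n"
    and gap: "filterlim (\<lambda>n. n - p n) at_top sequentially"
  shows "2 * liminf (\<lambda>n. ennreal (real (p n) / real n)) \<le> liminf (\<lambda>n. minimax_risk n (p n))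
    \<and> liminf (\<lambda>n. minimax_risk n (p n)) \<le> limsup (\<lambda>n. minimax_risk n (p n))
    \<and> limsup (\<lambda>n. minimax_risk n (p n)) \<le> limsup (\<lambda>n. ennreal (- 2 * ln (1 - real (p n) / real n)))
    \<and> ((\<lambda>n. real (p n) / real n) \<longlonglongrightarrow> 0 \<longrightarrow>
        (\<lambda>n. ennreal (real n / real (p n)) * minimax_risk n (p n)) \<longlonglongrightarrow> 2
        \<and> (\<lambda>n. max_risk n (p n) (logdet_estimator n (p n)) / minimax_risk n (p n)) \<longlonglongrightarrow> 1)"
proof -
  have RT: "minimax_risk n (p n) \<le> max_risk n (p n) (logdet_estimator n (p n))" for n
    unfolding minimax_risk_def by (rule INF_lower[OF logdet_estimator_in_estimators])
  have lower: "ennreal (2 * real (p n) / (real n + 3)) \<le> minimax_risk n (p n)" if "n \<ge> 1" for n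
    using p_bounds[OF that] by (intro minimax_risk_lower_bound) simp
  have upper: "max_risk n (p n) (logdet_estimator n (p n)) \<le> ennreal (\<Sum>i<p n. Polygamma 1 (real (n - i) / 2))"
    if "n \<ge> 1" for n
    using p_bounds[OF that] that by (intro max_risk_logdet_le) simp_all
  note asymptotics = risk_asymptotics[OF p_bounds gap RT lower upper]
  show ?thesis
    using asymptotics Liminf_le_Limsup[OF sequentially_bot] by blast
qed

end
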